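(* Let $N\ge 2$, and for $1\le m\le N$ let $\frac14<s_{1,m}<\frac34$, $s_{1,m}<s_{2,m}<1$, $\varepsilon_m\ge 0$. Put $\varepsilon:=\max_m\varepsilon_m$, $s_1:=\min_m s_{1,m}$, $S_1:=\max_m s_{1,m}$. Assume (on $f_m$, $H_m$): for every $1\le m\le N$, $f_m,H_m:\mathbb R^3\to\mathbb R$ satisfy $f_m\in L^1(\mathbb R^3)$, $(-\Delta)^{1-s_{1,m}}f_m\in L^2(\mathbb R^3)$, $H_m\in L^1(\mathbb R^3)$, $(-\Delta)^{1-s_{1,m}}H_m\in L^2(\mathbb R^3)$; $f_m$ is nontrivial for at least one $m$; and $$H^2:=\sum_{m=1}^N\|H_m\|_{L^1(\mathbb R^3)}^2>0,\qquad Q^2:=\sum_{m=1}^N\|(-\Delta)^{1-s_{1,m}}H_m\|_{L^2(\mathbb R^3)}^2>0 .$$ Let $u_0=(u_{0,1},\dots,u_{0,N})^T\in H^2(\mathbb R^3,\mathbb R^N)$ be the vector of the unique solutions of $[(-\Delta)^{s_{1,m}}+(-\Delta)^{s_{2,m}}]u_{0,m}=f_m$, $1\le m\le N$, and let $$I:=\{z\in\mathbb R^N:\ |z|_{\mathbb R^N}\le c_e\|u_0\|_{H^2(\mathbb R^3,\mathbb R^N)}+c_e\}.$$ Assume (on $g$): $M>0$ and $g=(g_1,\dots,g_N)$ with $g_m:\mathbb R^N\to\mathbb R$, $g_m(0)=0$, $\nabla g_m(0)=0$ for $1\le m\le N$, $g\in C^2(I,\mathbb R^N)$ with $\|g\|_{C^2(I,\mathbb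 R^N)}\le M$, and $g$ does not vanish identically in $I$. For $\rho\in(0,1]$ let $B_\rho:=\{u\in H^2(\mathbb R^3,\mathbb R^N):\ \|u\|_{H^2(\mathbb R^3,\mathbb R^N)}\le\rho\}$. Then for every $\rho\in(0,1]$ and for all $\varepsilon$ with $$0<\varepsilon\le\frac{\rho}{M(\|u_0\|_{H^2(\mathbb R^3,\mathbb R^N)}+1)^2}\left[H^2(\|u_0\|_{H^2(\mathbb R^3,\mathbb R^N)}+1)^{\frac{8S_1}{3}-2}\frac{1}{(4s_1)^{\frac{4s_1}{3}}}\,\frac{3}{(3-4S_1)(2\pi^2)^{\frac{4s_1}{3}}}+Q^2\right]^{-\frac12},$$ the system $$[(-\Delta)^{s_{1,m}}+(-\Delta)^{s_{2,m}}]u_m(x)=\varepsilon_m\int_{\mathbb R^3}H_m(x-y)\,g_m(u_0(y)+v(y))\,dy,\qquad 1\le m\le N,$$ defines a map $\tau_g:B_\rho\to B_\rho$, $v\mapsto u=\tau_g v$ (i.e. for each $v\in B_\rho$ the system has a unique solution $u\in B_\rho$), and $\tau_g$ is a strict contraction with respect to the $H^2(\mathbb R^3,\mathbb R^N)$ norm. The unique fixed point $u_p=(u_{p,1},\dots,u_{p,N})^T$ of $\tau_g$ is the only solution in $B_\rho$ of the system $$[(-\Delta)^{s_{1,m}}+(-\Delta)^{s_{2,m}}]u_{p,m}(x)=\varepsilon_m\int_{\mathbb R^3}H_m(x-y)\,g_m(u_0(y)+u_p(y))\,dy,\qquad 1\le m\le N.$$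
   Context: All functions are on $\mathbb R^3$. For $s>0$ the operator $(-\Delta)^{s}$ is the Fourier multiplier with symbol $|p|^{2s}$, where $\widehat\phi(p)=(2\pi)^{-3/2}\int_{\mathbb R^3}\phi(x)e^{-ipx}dx$. For $0<s_{2,m}\le 1$, $H^{2s_{2,m}}(\mathbb R^3)$ is the space of real-valued $\phi\in L^2(\mathbb R^3)$ with $(-\Delta)^{s_{2,m}}\phi\in L^2(\mathbb R^3)$, with norm $\|\phi\|_{H^{2s_{2,m}}}^2=\|\phi\|_{L^2}^2+\|(-\Delta)^{s_{2,m}}\phi\|_{L^2}^2$. In particular $\|\phi\|_{H^2(\mathbb R^3)}^2=\|\phi\|_{L^2}^2+\|\Delta\phi\|_{L^2}^2$. For vector functions, $\|u\|_{H^2(\mathbb R^3,\mathbb R^N)}^2:=\sum_{m=1}^N\{\|u_m\|_{L^2(\mathbb R^3)}^2+\|\Delta u_m\|_{L^2(\mathbb R^3)}^2\}$. $c_e>0$ is the constant of the Sobolev embedding $\|\phi\|_{L^\infty(\mathbb R^3)}\le c_e\|\phi\|_{H^2(\mathbb R^3)}$. $|\cdot|_{\mathbb R^N}$ is the Euclidean length. Under the stated assumptions on $f_m$, each $f_m\in L^2(\mathbb R^3)$ and each linear equation $[(-\Delta)^{s_{1,m}}+(-\Delta)^{s_{2,m}}]u_{0,m}=f_m$ has a unique solution $u_{0,m}\in H^{2s_{2,m}}(\mathbb R^3)$, and this solution belongs to $H^2(\mathbb R^3)$; so $u_0$ is well defined. Norms of nonlinearities: $\|g\|_{C^2(I,\mathbb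 R^N)}:=\sum_{m=1}^N\|g_m\|_{C^2(I)}$, where $$\|g_m\|_{C^2(I)}:=\|g_m\|_{C(I)}+\sum_{n=1}^N\Big\|\frac{\partial g_m}{\partial z_n}\Big\|_{C(I)}+\sum_{n,l=1}^N\Big\|\frac{\partial^2 g_m}{\partial z_n\partial z_l}\Big\|_{C(I)},\qquad \|h\|_{C(I)}:=\max_{z\in I}|h(z)|.$$ The symbols $H$ and $Q$ denote the positive square roots of $H^2$ and $Q^2$. *)

theory Defs
  imports "HOL-Analysis.Analysis"
begin

text \<open>
  Elements of Lebesgue and Sobolev spaces are represented by functions, and equality in these
  spaces is equality almost everywhere. All integrals are taken with respect to the complete
  measure \<open>lebesgue\<close>: compositions such as \<open>g (u y)\<close>, where \<open>g\<close> is only controlled on a set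
  that contains \<open>u y\<close> for almost all \<open>y\<close>, are then measurable.
\<close>

definition square_integrable :: "(real^3 \<Rightarrow> 'b::real_normed_vector) \<Rightarrow> bool" where
  "square_integrable \<phi> \<longleftrightarrow>
     \<phi> \<in> borel_measurable lebesgue \<and> integrable lebesgue (\<lambda>x. (norm (\<phi> x))\<^sup>2)"

definition L1_norm :: "(real^3 \<Rightarrow> real) \<Rightarrow> real" where
  "L1_norm \<phi> = (LINT x|lebesgue. \<bar>\<phi> x\<bar>)"

definition L2_norm :: "(real^3 \<Rightarrow> real) \<Rightarrow> real" where
  "L2_norm \<phi> = sqrt (LINT x|lebesgue. (\<phi> x)\<^sup>2)"

definition fourier_integral :: "(real^3 \<Rightarrow> complex) \<Rightarrow> real^3 \<Rightarrow> complex" where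
  "fourier_integral \<phi> p =
     complex_of_real ((2 * pi) powr (- 3 / 2)) *
       (LINT x|lebesgue. \<phi> x * exp (- \<i> * complex_of_real (p \<bullet> x)))"

text \<open>
  On \<open>L\<^sup>2\<close> the Fourier transform is the \<open>L\<^sup>2\<close> limit of the Fourier integrals over growing balls.
  Together with the integral formula on \<open>L\<^sup>1\<close> this covers every function considered below; on the
  intersection of \<open>L\<^sup>1\<close> and \<open>L\<^sup>2\<close> both clauses describe the same transform.
\<close>

definition has_fourier_L2 :: "(real^3 \<Rightarrow> complex) \<Rightarrow> (real^3 \<Rightarrow> complex) \<Rightarrow> bool" where
  "has_fourier_L2 \<phi> \<psi> \<longleftrightarrow>
     square_integrable \<phi> \<and> square_integrable \<psi> \<and>
     ((\<lambda>R. \<integral>\<^sup>+ p. ennreal ((cmod (\<psi> p -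
          fourier_integral (\<lambda>x. if norm x \<le> R then \<phi> x else 0) p))\<^sup>2) \<partial>lebesgue)
        \<longlongrightarrow> 0) at_top"

definition has_fourier :: "(real^3 \<Rightarrow> complex) \<Rightarrow> (real^3 \<Rightarrow> complex) \<Rightarrow> bool" where
  "has_fourier \<phi> \<psi> \<longleftrightarrow>
     (integrable lebesgue \<phi> \<and> (AE p in lebesgue. \<psi> p = fourier_integral \<phi> p)) \<or>
     has_fourier_L2 \<phi> \<psi>"

text \<open>
  \<open>has_frac_laplacian s \<phi> h\<close> says that \<open>(-\<Delta>)\<^sup>s \<phi>\<close> exists as an \<open>L\<^sup>2\<close> function and equals \<open>h\<close>.
  Since the symbol is real and even, \<open>h\<close> is real-valued when \<open>\<phi>\<close> is. It is unique up to a null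
  set, so the choice in \<open>frac_laplacian\<close> only selects a representative.
\<close>

definition has_frac_laplacian :: "real \<Rightarrow> (real^3 \<Rightarrow> real) \<Rightarrow> (real^3 \<Rightarrow> real) \<Rightarrow> bool" where
  "has_frac_laplacian s \<phi> h \<longleftrightarrow>
     (\<exists>\<psi> \<eta>. has_fourier (\<lambda>x. complex_of_real (\<phi> x)) \<psi> \<and>
            has_fourier_L2 (\<lambda>x. complex_of_real (h x)) \<eta> \<and>
            (AE p in lebesgue. \<eta> p = complex_of_real (norm p powr (2 * s)) * \<psi> p))"

definition frac_laplacian_in_L2 :: "real \<Rightarrow> (real^3 \<Rightarrow> real) \<Rightarrow> bool" where
  "frac_laplacian_in_L2 s \<phi> \<longleftrightarrow> (\<exists>h. has_frac_laplacian s \<phi> h)"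

definition frac_laplacian :: "real \<Rightarrow> (real^3 \<Rightarrow> real) \<Rightarrow> real^3 \<Rightarrow> real" where
  "frac_laplacian s \<phi> = (SOME h. has_frac_laplacian s \<phi> h)"

text \<open>The parameter \<open>r\<close> is the order of the space, so \<open>sobolev_space (2 * s)\<close> involves
  \<open>(-\<Delta>)\<^sup>s\<close> and \<open>sobolev_space 2\<close> involves the Laplacian.\<close>

definition sobolev_space :: "real \<Rightarrow> (real^3 \<Rightarrow> real) set" where
  "sobolev_space r = {\<phi>. square_integrable \<phi> \<and> frac_laplacian_in_L2 (r / 2) \<phi>}"

definition sobolev_norm :: "real \<Rightarrow> (real^3 \<Rightarrow> real) \<Rightarrow> real" where
  "sobolev_norm r \<phi> = sqrt ((L2_norm \<phi>)\<^sup>2 + (L2_norm (frac_laplacian (r / 2) \<phi>))\<^sup>2)"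

definition H2_vec :: "(real^3 \<Rightarrow> real^'n::finite) set" where
  "H2_vec = {u. \<forall>m. (\<lambda>x. u x $ m) \<in> sobolev_space 2}"

definition H2_norm :: "(real^3 \<Rightarrow> real^'n::finite) \<Rightarrow> real" where
  "H2_norm u = sqrt (\<Sum>m\<in>UNIV. (sobolev_norm 2 (\<lambda>x. u x $ m))\<^sup>2)"

definition H2_ball :: "real \<Rightarrow> (real^3 \<Rightarrow> real^'n::finite) set" where
  "H2_ball \<rho> = {u \<in> H2_vec. H2_norm u \<le> \<rho>}"

definition sobolev_embedding_const :: "real \<Rightarrow> bool" where
  "sobolev_embedding_const c \<longleftrightarrow>
     c > 0 \<and> (\<forall>\<phi>\<in>sobolev_space 2. AE x in lebesgue. \<bar>\<phi> x\<bar> \<le> c * sobolev_norm 2 \<phi>)"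

definition solves_double_scale ::
    "real \<Rightarrow> real \<Rightarrow> (real^3 \<Rightarrow> real) \<Rightarrow> (real^3 \<Rightarrow> real) \<Rightarrow> bool" where
  "solves_double_scale s t u f \<longleftrightarrow>
     frac_laplacian_in_L2 s u \<and> frac_laplacian_in_L2 t u \<and>
     (AE x in lebesgue. frac_laplacian s u x + frac_laplacian t u x = f x)"

definition solves_system ::
    "('n::finite \<Rightarrow> real) \<Rightarrow> ('n \<Rightarrow> real) \<Rightarrow> ('n \<Rightarrow> real) \<Rightarrow> ('n \<Rightarrow> real^3 \<Rightarrow> real) \<Rightarrow>
     (real^'n \<Rightarrow> real^'n) \<Rightarrow> (real^3 \<Rightarrow> real^'n) \<Rightarrow> (real^3 \<Rightarrow> real^'n) \<Rightarrow> (real^3 \<Rightarrow> real^'n) \<Rightarrow> bool"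
  where
  "solves_system s1 s2 eps H g u0 v u \<longleftrightarrow>
     (\<forall>m. solves_double_scale (s1 m) (s2 m) (\<lambda>x. u x $ m)
            (\<lambda>x. eps m * (LINT y|lebesgue. H m (x - y) * (g (u0 y + v y) $ m))))"

text \<open>
  Derivatives on the closed ball \<open>I\<close> are taken within \<open>I\<close>; at interior points these are the
  ordinary derivatives, at boundary points their continuous extensions.
\<close>

definition partial_on :: "(real^'n::finite) set \<Rightarrow> 'n \<Rightarrow> (real^'n \<Rightarrow> real) \<Rightarrow> real^'n \<Rightarrow> real" where
  "partial_on I n h z = frechet_derivative h (at z within I) (axis n 1)"

definition C2_on :: "(real^'n::finite) set \<Rightarrow> (real^'n \<Rightarrow> real) \<Rightarrow> bool" where
  "C2_on I h \<longleftrightarrow>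
     h differentiable_on I \<and>
     (\<forall>n. partial_on I n h differentiable_on I) \<and>
     (\<forall>n l. continuous_on I (partial_on I n (partial_on I l h)))"

definition C_norm :: "(real^'n::finite) set \<Rightarrow> (real^'n \<Rightarrow> real) \<Rightarrow> real" where
  "C_norm I h = (SUP z\<in>I. \<bar>h z\<bar>)"

definition C2_norm :: "(real^'n::finite) set \<Rightarrow> (real^'n \<Rightarrow> real) \<Rightarrow> real" where
  "C2_norm I h =
     C_norm I h + (\<Sum>n\<in>UNIV. C_norm I (partial_on I n h)) +
     (\<Sum>n\<in>UNIV. \<Sum>l\<in>UNIV. C_norm I (partial_on I n (partial_on I l h)))"

definition C2_norm_vec :: "(real^'n::finite) set \<Rightarrow> (real^'n \<Rightarrow> real^'n) \<Rightarrow> real" where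
  "C2_norm_vec I g = (\<Sum>m\<in>UNIV. C2_norm I (\<lambda>z. g z $ m))"

end

theory Submission
  imports Defs "HOL-Probability.Probability"
begin

text \<open>
  On the Fourier side the equation for \<open>u\<^sub>m\<close> is division of
  \<open>\<epsilon>\<^sub>m (2\<pi>)\<^bsup>3/2\<^esup> \<cdot> H\<^sub>m^ \<cdot> G\<^sub>m^\<close>, with \<open>G\<^sub>m = g\<^sub>m(u\<^sub>0 + v)\<close>, by the symbol
  \<open>|p|\<^bsup>2s\<^esup> + |p|\<^bsup>2t\<^esup>\<close>. For \<open>\<parallel>\<Delta>u\<^sub>m\<parallel>\<close> this costs \<open>|p|\<^bsup>2-2s\<^esup>\<close> on \<open>H\<^sub>m^\<close> and the \<open>L\<^sup>1\<close> norm of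
  \<open>G\<^sub>m\<close>; for \<open>\<parallel>u\<^sub>m\<parallel>\<close> one splits the frequencies at a radius that balances the \<open>L\<^sup>1\<close> norm of \<open>G\<^sub>m\<close>
  (low frequencies, where \<open>|p|\<^bsup>-4s\<^esup>\<close> is integrable because \<open>4s < 3\<close>) against its \<open>L\<^sup>2\<close> norm.
  Since \<open>g\<^sub>m\<close> vanishes to second order at \<open>0\<close>, both norms of a difference of nonlinearities are
  controlled by the \<open>L\<^sup>2\<close> distance of the arguments, so the solution operator \<open>v \<mapsto> u\<close> is Lipschitz from
  \<open>L\<^sup>2\<close> to \<open>H\<^sup>2\<close> with constant at most \<open>\<rho> / (\<parallel>u\<^sub>0\<parallel> + 1)\<close>. It is a strict contraction because
  \<open>u\<^sub>0 \<noteq> 0\<close>. The iterates converge in \<open>L\<^sup>2\<close>, their limit still satisfies the pointwise bound that the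
  nonlinearity needs, and applying the solution operator once more to the limit returns to \<open>H\<^sup>2\<close>.

  Plancherel's theorem is obtained by Gaussian regularisation: the Gaussian-weighted integral of
  \<open>|f^|\<^sup>2\<close> is a Gaussian average of the autocorrelation of \<open>f\<close>, which is continuous at \<open>0\<close>.
\<close>

section \<open>Square-integrable functions\<close>

text \<open>The smallness condition on \<open>eps\<close> is exactly
  \<open>q * W \<le> \<rho>\<close>, where \<open>W\<close> is the \<open>H\<^sup>2\<close> norm of
  \<open>u0\<close> plus one and \<open>q\<close> is the Lipschitz constant of the solution
  operator. Comparing an argument \<open>u0 + v\<close> with 0 bounds the solution by
  \<open>q * W\<close>, so the ball is preserved; and \<open>W > 1\<close> together with
  \<open>\<rho> \<le> 1\<close> forces \<open>q < 1\<close>. The constant in the theorem must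
  therefore be reached without loss: this dictates the choice of the splitting radius and the
  averaged form of the quadratic estimate. Two technical constraints shape the rest. Iterated
  integrals are exchanged for products of Borel measures, whereas the statement uses the completed
  measure, so transforms and convolutions are computed for Borel representatives and then
  transferred. And unknowns are real-valued while solutions are constructed on the Fourier side, so
  every symbol has to be checked for Hermitian symmetry before it is inverted.\<close>

text \<open>The codomain is an arbitrary normed space so that real data, complex transforms and
  vector unknowns share one theory. Without square integrability the Bochner integral defaults to 0,
  so a bound on \<open>l2n\<close> alone carries no information.\<close>

definition l2n :: "(real^3 \<Rightarrow> 'b::real_normed_vector) \<Rightarrow> real" where
  "l2n \<phi> = sqrt (LINT x|lebesgue. (norm (\<phi> x))\<^sup>2)"

lemma L2_norm_eq_l2n: "L2_norm \<phi> = l2n \<phi>"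
  by (simp add: L2_norm_def l2n_def)

lemma l2n_nonneg [simp]: "0 \<le> l2n \<phi>"
  by (simp add: l2n_def)

lemma l2n_power2: "(l2n \<phi>)\<^sup>2 = (LINT x|lebesgue. (norm (\<phi> x))\<^sup>2)"
  by (simp add: l2n_def)

lemma square_integrable_measurable:
  "square_integrable \<phi> \<Longrightarrow> \<phi> \<in> borel_measurable lebesgue"
  by (simp add: square_integrable_def)

lemma square_integrable_integrable:
  "square_integrable \<phi> \<Longrightarrow> integrable lebesgue (\<lambda>x. (norm (\<phi> x))\<^sup>2)"
  by (simp add: square_integrable_def)

lemma square_integrable_iff_nn_integral:
  "square_integrable \<phi> \<longleftrightarrow>
     \<phi> \<in> borel_measurable lebesgue \<and> (\<integral>\<^sup>+x. ennreal ((norm (\<phi> x))\<^sup>2) \<partial>lebesgue) < \<infinity>"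
  by (auto simp: square_integrable_def integrable_iff_bounded)

lemma nn_integral_eq_l2n:
  assumes "square_integrable \<phi>"
  shows "(\<integral>\<^sup>+x. ennreal ((norm (\<phi> x))\<^sup>2) \<partial>lebesgue) = ennreal ((l2n \<phi>)\<^sup>2)"
  using square_integrable_integrable[OF assms]
  by (simp add: l2n_power2 nn_integral_eq_integral)

text \<open>The extended integral is defined before integrability is known, so one estimate of it
  yields both membership in \<open>L\<^sup>2\<close> and the norm bound.\<close>

lemma square_integrable_bound_nn:
  assumes "\<phi> \<in> borel_measurable lebesgue" and "0 \<le> K"
    and "(\<integral>\<^sup>+x. ennreal ((norm (\<phi> x))\<^sup>2) \<partial>lebesgue) \<le> ennreal (K\<^sup>2)"
  shows "square_integrable \<phi>" and "l2n \<phi> \<le> K"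
proof -
  show sq: "square_integrable \<phi>"
    using assms by (auto simp: square_integrable_iff_nn_integral intro: le_less_trans)
  have "(l2n \<phi>)\<^sup>2 \<le> K\<^sup>2"
    using assms(3) by (simp add: nn_integral_eq_l2n[OF sq])
  then show "l2n \<phi> \<le> K"
    using \<open>0 \<le> K\<close> by (rule power2_le_imp_le)
qed

lemma square_integrable_bound:
  fixes \<phi> :: "real^3 \<Rightarrow> 'b::real_normed_vector" and \<psi> :: "real^3 \<Rightarrow> 'c::real_normed_vector"
  assumes "square_integrable \<psi>" and "\<phi> \<in> borel_measurable lebesgue" and "0 \<le> K"
    and le: "AE x in lebesgue. norm (\<phi> x) \<le> K * norm (\<psi> x)"
  shows "square_integrable \<phi>" and "l2n \<phi> \<le> K * l2n \<psi>"
proof -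
  have "(\<integral>\<^sup>+x. ennreal ((norm (\<phi> x))\<^sup>2) \<partial>lebesgue)
      \<le> (\<integral>\<^sup>+x. ennreal (K\<^sup>2) * ennreal ((norm (\<psi> x))\<^sup>2) \<partial>lebesgue)"
    using le
    by (intro nn_integral_mono_AE)
      (auto elim!: eventually_mono simp flip: ennreal_mult power_mult_distrib
        intro!: ennreal_leI power_mono)
  also have "\<dots> = ennreal (K\<^sup>2) * (\<integral>\<^sup>+x. ennreal ((norm (\<psi> x))\<^sup>2) \<partial>lebesgue)"
    using square_integrable_measurable[OF assms(1)] by (intro nn_integral_cmult) auto
  also have "\<dots> = ennreal ((K * l2n \<psi>)\<^sup>2)"
    by (simp add: nn_integral_eq_l2n[OF assms(1)] power_mult_distrib flip: ennreal_mult)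
  finally have *: "(\<integral>\<^sup>+x. ennreal ((norm (\<phi> x))\<^sup>2) \<partial>lebesgue) \<le> ennreal ((K * l2n \<psi>)\<^sup>2)" .
  show "square_integrable \<phi>" "l2n \<phi> \<le> K * l2n \<psi>"
    using square_integrable_bound_nn[OF assms(2) _ *] \<open>0 \<le> K\<close> by simp_all
qed

lemma square_integrable_cong_AE:
  fixes \<phi> \<psi> :: "real^3 \<Rightarrow> 'b::euclidean_space"
  assumes "square_integrable \<phi>" and "AE x in lebesgue. \<phi> x = \<psi> x"
  shows "square_integrable \<psi>" and "l2n \<psi> = l2n \<phi>"
proof -
  have m: "\<psi> \<in> borel_measurable lebesgue"
    using assms borel_measurable_AE square_integrable_measurable by blast
  show sq: "square_integrable \<psi>"
    using assms(2) by (intro square_integrable_bound(1)[OF assms(1) m, of 1]) (auto elim: eventually_mono)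
  show "l2n \<psi> = l2n \<phi>"
    unfolding l2n_def using assms(2) m square_integrable_measurable[OF assms(1)]
    by (intro arg_cong[where f=sqrt] integral_cong_AE) auto
qed

lemma l2n_cong_AE:
  fixes \<phi> \<psi> :: "real^3 \<Rightarrow> 'b::euclidean_space"
  assumes "\<phi> \<in> borel_measurable lebesgue" and "AE x in lebesgue. \<phi> x = \<psi> x"
  shows "l2n \<psi> = l2n \<phi>"
proof -
  have m: "\<psi> \<in> borel_measurable lebesgue"
    using assms borel_measurable_AE by blast
  show ?thesis
    unfolding l2n_def using assms m
    by (intro arg_cong[where f=sqrt] integral_cong_AE) auto
qed

lemma square_integrable_zero [simp]: "square_integrable (\<lambda>x. 0)"
  by (simp add: square_integrable_def)

lemma l2n_zero [simp]: "l2n (\<lambda>x. 0) = 0"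
  by (simp add: l2n_def)

lemma square_integrable_add:
  fixes \<phi> \<psi> :: "real^3 \<Rightarrow> 'b::euclidean_space"
  assumes "square_integrable \<phi>" and "square_integrable \<psi>"
  shows "square_integrable (\<lambda>x. \<phi> x + \<psi> x)"
  unfolding square_integrable_def
proof
  note [measurable] = assms[THEN square_integrable_measurable]
  show "(\<lambda>x. \<phi> x + \<psi> x) \<in> borel_measurable lebesgue"
    by measurable
  have bound: "(norm (a + b))\<^sup>2 \<le> 2 * (norm a)\<^sup>2 + 2 * (norm b)\<^sup>2" for a b :: 'b
  proof -
    have "(norm (a + b))\<^sup>2 \<le> (norm a + norm b)\<^sup>2"
      by (intro power_mono norm_triangle_ineq) auto
    then show ?thesis
      using zero_le_power2[of "norm a - norm b"] unfolding power2_sum power2_diff by linarith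
  qed
  show "integrable lebesgue (\<lambda>x. (norm (\<phi> x + \<psi> x))\<^sup>2)"
    by (rule Bochner_Integration.integrable_bound[where f="\<lambda>x. 2 * (norm (\<phi> x))\<^sup>2 + 2 * (norm (\<psi> x))\<^sup>2"])
      (use assms bound in \<open>auto simp: square_integrable_integrable\<close>)
qed

lemma square_integrable_uminus:
  fixes \<phi> :: "real^3 \<Rightarrow> 'b::euclidean_space"
  assumes "square_integrable \<phi>"
  shows "square_integrable (\<lambda>x. - \<phi> x)" and "l2n (\<lambda>x. - \<phi> x) = l2n \<phi>"
  using assms by (auto simp: square_integrable_def l2n_def)

lemma square_integrable_diff:
  fixes \<phi> \<psi> :: "real^3 \<Rightarrow> 'b::euclidean_space"
  assumes "square_integrable \<phi>" and "square_integrable \<psi>"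
  shows "square_integrable (\<lambda>x. \<phi> x - \<psi> x)"
  using square_integrable_add[OF assms(1) square_integrable_uminus(1)[OF assms(2)]] by simp

lemma square_integrable_scaleR:
  fixes \<phi> :: "real^3 \<Rightarrow> 'b::euclidean_space"
  assumes "square_integrable \<phi>"
  shows "square_integrable (\<lambda>x. c *\<^sub>R \<phi> x)" and "l2n (\<lambda>x. c *\<^sub>R \<phi> x) = \<bar>c\<bar> * l2n \<phi>"
  using assms by (auto simp: square_integrable_def l2n_def power_mult_distrib real_sqrt_mult)

lemma l2n_minus_commute:
  fixes \<phi> \<psi> :: "real^3 \<Rightarrow> 'b::euclidean_space"
  shows "l2n (\<lambda>x. \<phi> x - \<psi> x) = l2n (\<lambda>x. \<psi> x - \<phi> x)"
  by (simp add: l2n_def norm_minus_commute)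

lemma integrable_norm_mult:
  fixes \<phi> :: "real^3 \<Rightarrow> 'b::euclidean_space" and \<psi> :: "real^3 \<Rightarrow> 'c::euclidean_space"
  assumes "square_integrable \<phi>" and "square_integrable \<psi>"
  shows "integrable lebesgue (\<lambda>x. norm (\<phi> x) * norm (\<psi> x))"
proof -
  note [measurable] = assms[THEN square_integrable_measurable]
  have "a * b \<le> a\<^sup>2 + b\<^sup>2" if "0 \<le> a" "0 \<le> b" for a b :: real
    using zero_le_power2[of "a - b"] that mult_nonneg_nonneg[OF that]
    unfolding power2_sum power2_diff by linarith
  note bound = this[OF norm_ge_zero norm_ge_zero]
  show ?thesis
  proof (rule Bochner_Integration.integrable_bound)
    show "integrable lebesgue (\<lambda>x. (norm (\<phi> x))\<^sup>2 + (norm (\<psi> x))\<^sup>2)"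
      by (intro Bochner_Integration.integrable_add square_integrable_integrable assms)
    show "AE x in lebesgue. norm (norm (\<phi> x) * norm (\<psi> x)) \<le> norm ((norm (\<phi> x))\<^sup>2 + (norm (\<psi> x))\<^sup>2)"
      by (intro AE_I2) (use bound in simp)
  qed measurable
qed

text \<open>Cauchy-Schwarz in its classical form: the integral of the square of
  \<open>norm (\<phi> x) - t * norm (\<psi> x)\<close> is a quadratic polynomial in \<open>t\<close>
  that never becomes negative.\<close>

lemma integral_norm_mult_le:
  fixes \<phi> :: "real^3 \<Rightarrow> 'b::euclidean_space" and \<psi> :: "real^3 \<Rightarrow> 'c::euclidean_space"
  assumes "square_integrable \<phi>" and "square_integrable \<psi>"
  shows "(LINT x|lebesgue. norm (\<phi> x) * norm (\<psi> x)) \<le> l2n \<phi> * l2n \<psi>"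
proof -
  define p where "p = (LINT x|lebesgue. norm (\<phi> x) * norm (\<psi> x))"
  note int = integrable_norm_mult[OF assms] assms[THEN square_integrable_integrable]
  have "0 \<le> (l2n \<phi>)\<^sup>2 - 2 * t * p + t\<^sup>2 * (l2n \<psi>)\<^sup>2" for t
  proof -
    have "0 \<le> (LINT x|lebesgue. (norm (\<phi> x) - t * norm (\<psi> x))\<^sup>2)"
      by simp
    also have "\<dots> = (LINT x|lebesgue. (norm (\<phi> x))\<^sup>2 - 2 * t * (norm (\<phi> x) * norm (\<psi> x))
        + t\<^sup>2 * (norm (\<psi> x))\<^sup>2)"
      by (intro Bochner_Integration.integral_cong) (auto simp: power2_diff power_mult_distrib)
    also have "\<dots> = (l2n \<phi>)\<^sup>2 - 2 * t * p + t\<^sup>2 * (l2n \<psi>)\<^sup>2"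
      using int by (simp add: l2n_power2 p_def)
    finally show ?thesis .
  qed
  note quad = this
  have p0: "0 \<le> p"
    unfolding p_def by simp
  have "p\<^sup>2 \<le> (l2n \<phi> * l2n \<psi>)\<^sup>2"
  proof (cases "l2n \<psi> = 0")
    case True
    have "p = 0"
    proof (rule ccontr)
      assume "p \<noteq> 0"
      with p0 have "0 < p" by simp
      then show False
        \<comment> \<open>With \<open>l2n \<psi> = 0\<close> the polynomial is affine in
          \<open>t\<close>; this \<open>t\<close> gives it the value -1.\<close>
        using quad[of "((l2n \<phi>)\<^sup>2 + 1) / (2 * p)"] True by simp
    qed
    then show ?thesis by simp
  next
    case False
    then show ?thesis
      \<comment> \<open>The minimiser of the quadratic.\<close>
      using quad[of "p / (l2n \<psi>)\<^sup>2"]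
      using l2n_nonneg[of \<psi>]
      by (auto simp: field_simps power2_eq_square zero_le_divide_iff mult_le_0_iff simp del: l2n_nonneg)
  qed
  then show ?thesis
    unfolding p_def by (rule power2_le_imp_le) simp
qed

lemma integrable_inner_square:
  fixes \<phi> \<psi> :: "real^3 \<Rightarrow> 'b::euclidean_space"
  assumes "square_integrable \<phi>" and "square_integrable \<psi>"
  shows "integrable lebesgue (\<lambda>x. \<phi> x \<bullet> \<psi> x)"
    and "\<bar>LINT x|lebesgue. \<phi> x \<bullet> \<psi> x\<bar> \<le> l2n \<phi> * l2n \<psi>"
proof -
  note [measurable] = assms[THEN square_integrable_measurable]
  show int: "integrable lebesgue (\<lambda>x. \<phi> x \<bullet> \<psi> x)"
    by (rule Bochner_Integration.integrable_bound[OF integrable_norm_mult[OF assms]])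
      (auto simp: Cauchy_Schwarz_ineq2)
  have "\<bar>LINT x|lebesgue. \<phi> x \<bullet> \<psi> x\<bar> \<le> (LINT x|lebesgue. \<bar>\<phi> x \<bullet> \<psi> x\<bar>)"
    by (rule integral_abs_bound)
  also have "\<dots> \<le> (LINT x|lebesgue. norm (\<phi> x) * norm (\<psi> x))"
    using int integrable_norm_mult[OF assms]
    by (intro integral_mono) (auto simp: Cauchy_Schwarz_ineq2)
  also have "\<dots> \<le> l2n \<phi> * l2n \<psi>"
    by (rule integral_norm_mult_le[OF assms])
  finally show "\<bar>LINT x|lebesgue. \<phi> x \<bullet> \<psi> x\<bar> \<le> l2n \<phi> * l2n \<psi>" .
qed

text \<open>The inner product is the real one of the value space; for complex values it is the real
  part of the Hermitian product, which is all that the norm identities below require.\<close>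

lemma l2n_add_power2:
  fixes \<phi> \<psi> :: "real^3 \<Rightarrow> 'b::euclidean_space"
  assumes "square_integrable \<phi>" and "square_integrable \<psi>"
  shows "(l2n (\<lambda>x. \<phi> x + \<psi> x))\<^sup>2 = (l2n \<phi>)\<^sup>2 + 2 * (LINT x|lebesgue. \<phi> x \<bullet> \<psi> x) + (l2n \<psi>)\<^sup>2"
proof -
  have "(l2n (\<lambda>x. \<phi> x + \<psi> x))\<^sup>2
      = (LINT x|lebesgue. (norm (\<phi> x))\<^sup>2 + 2 * (\<phi> x \<bullet> \<psi> x) + (norm (\<psi> x))\<^sup>2)"
    unfolding l2n_power2
    by (intro Bochner_Integration.integral_cong)
      (auto simp: power2_norm_eq_inner inner_add_left inner_add_right inner_commute)
  then show ?thesis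
    using integrable_inner_square(1)[OF assms] assms[THEN square_integrable_integrable]
    by (simp add: l2n_power2)
qed

lemma l2n_triangle:
  fixes \<phi> \<psi> :: "real^3 \<Rightarrow> 'b::euclidean_space"
  assumes "square_integrable \<phi>" and "square_integrable \<psi>"
  shows "l2n (\<lambda>x. \<phi> x + \<psi> x) \<le> l2n \<phi> + l2n \<psi>"
proof (rule power2_le_imp_le)
  show "(l2n (\<lambda>x. \<phi> x + \<psi> x))\<^sup>2 \<le> (l2n \<phi> + l2n \<psi>)\<^sup>2"
    using integrable_inner_square(2)[OF assms] by (simp add: l2n_add_power2[OF assms] power2_sum)
qed simp

lemma l2n_triangle_mid:
  fixes \<phi> \<psi> \<zeta> :: "real^3 \<Rightarrow> 'b::euclidean_space"
  assumes "square_integrable \<phi>" and "square_integrable \<psi>" and "square_integrable \<zeta>"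
  shows "l2n (\<lambda>x. \<phi> x - \<psi> x) \<le> l2n (\<lambda>x. \<phi> x - \<zeta> x) + l2n (\<lambda>x. \<zeta> x - \<psi> x)"
  using l2n_triangle[OF square_integrable_diff[OF assms(1,3)] square_integrable_diff[OF assms(3,2)]]
  by simp

lemma l2n_diff_abs_le:
  fixes \<phi> \<psi> :: "real^3 \<Rightarrow> 'b::euclidean_space"
  assumes "square_integrable \<phi>" and "square_integrable \<psi>"
  shows "\<bar>l2n \<phi> - l2n \<psi>\<bar> \<le> l2n (\<lambda>x. \<phi> x - \<psi> x)"
  using l2n_triangle[OF square_integrable_diff[OF assms] assms(2)]
    l2n_triangle[OF square_integrable_diff[OF assms(2,1)] assms(1)]
  by (simp add: l2n_minus_commute[of \<psi> \<phi>])

lemma l2n_eq_0_iff: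
  fixes \<phi> :: "real^3 \<Rightarrow> 'b::euclidean_space"
  assumes "square_integrable \<phi>"
  shows "l2n \<phi> = 0 \<longleftrightarrow> (AE x in lebesgue. \<phi> x = 0)"
  using integral_nonneg_eq_0_iff_AE[OF square_integrable_integrable[OF assms]]
  by (simp add: l2n_def)

lemma l2n_diff_eq_0_iff:
  fixes \<phi> \<psi> :: "real^3 \<Rightarrow> 'b::euclidean_space"
  assumes "square_integrable \<phi>" and "square_integrable \<psi>"
  shows "l2n (\<lambda>x. \<phi> x - \<psi> x) = 0 \<longleftrightarrow> (AE x in lebesgue. \<phi> x = \<psi> x)"
  using l2n_eq_0_iff[OF square_integrable_diff[OF assms]] by simp

lemma l2_limit_unique:
  fixes \<phi> \<psi> :: "real^3 \<Rightarrow> 'b::euclidean_space"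
  assumes "square_integrable \<phi>" "square_integrable \<psi>" "\<And>n. square_integrable (f n)"
    and "((\<lambda>n. l2n (\<lambda>x. f n x - \<phi> x)) \<longlongrightarrow> 0) F" "((\<lambda>n. l2n (\<lambda>x. f n x - \<psi> x)) \<longlongrightarrow> 0) F"
    and "F \<noteq> bot"
  shows "AE x in lebesgue. \<phi> x = \<psi> x"
proof -
  have "((\<lambda>n. l2n (\<lambda>x. f n x - \<phi> x) + l2n (\<lambda>x. f n x - \<psi> x)) \<longlongrightarrow> 0) F"
    using tendsto_add[OF assms(4,5)] by simp
  moreover have "l2n (\<lambda>x. \<phi> x - \<psi> x) \<le> l2n (\<lambda>x. f n x - \<phi> x) + l2n (\<lambda>x. f n x - \<psi> x)" for n
    using l2n_triangle_mid[OF assms(1,2,3), of n] by (simp add: l2n_minus_commute[of \<phi>])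
  ultimately have "l2n (\<lambda>x. \<phi> x - \<psi> x) \<le> 0"
    using \<open>F \<noteq> bot\<close> by (intro tendsto_lowerbound) auto
  then have "l2n (\<lambda>x. \<phi> x - \<psi> x) = 0"
    using l2n_nonneg by (rule antisym)
  then show ?thesis
    using l2n_diff_eq_0_iff assms by blast
qed

lemma l2_Fatou:
  fixes f :: "nat \<Rightarrow> real^3 \<Rightarrow> 'b::euclidean_space"
  assumes sq: "\<And>n. square_integrable (f n)" and [measurable]: "\<phi> \<in> borel_measurable lebesgue"
    and lim: "AE x in lebesgue. (\<lambda>n. f n x) \<longlonglongrightarrow> \<phi> x"
    and K: "eventually (\<lambda>n. l2n (f n) \<le> K) sequentially"
  shows "square_integrable \<phi>" and "l2n \<phi> \<le> K"
proof -
  have [measurable]: "f n \<in> borel_measurable lebesgue" for n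
    by (rule square_integrable_measurable[OF sq])
  have "0 \<le> K"
    using eventually_happens[OF K] by (auto intro: order_trans[OF l2n_nonneg])
  have "(\<integral>\<^sup>+x. ennreal ((norm (\<phi> x))\<^sup>2) \<partial>lebesgue)
      = (\<integral>\<^sup>+x. liminf (\<lambda>n. ennreal ((norm (f n x))\<^sup>2)) \<partial>lebesgue)"
    using lim
  proof (intro nn_integral_cong_AE, eventually_elim)
    case (elim x)
    then have "(\<lambda>n. ennreal ((norm (f n x))\<^sup>2)) \<longlonglongrightarrow> ennreal ((norm (\<phi> x))\<^sup>2)"
      by (intro tendsto_intros) auto
    then have "liminf (\<lambda>n. ennreal ((norm (f n x))\<^sup>2)) = ennreal ((norm (\<phi> x))\<^sup>2)"
      by (intro lim_imp_Liminf) auto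
    then show ?case
      by simp
  qed
  also have "\<dots> \<le> liminf (\<lambda>n. \<integral>\<^sup>+x. ennreal ((norm (f n x))\<^sup>2) \<partial>lebesgue)"
    by (rule nn_integral_liminf) measurable
  also have "\<dots> \<le> liminf (\<lambda>n. ennreal (K\<^sup>2))"
  proof (intro Liminf_mono, use K in eventually_elim)
    case (elim n)
    then show ?case
      by (subst nn_integral_eq_l2n[OF sq]) (auto intro!: ennreal_leI power_mono)
  qed
  also have "\<dots> = ennreal (K\<^sup>2)"
    by (simp add: Liminf_const)
  finally have *: "(\<integral>\<^sup>+x. ennreal ((norm (\<phi> x))\<^sup>2) \<partial>lebesgue) \<le> ennreal (K\<^sup>2)" .
  show "square_integrable \<phi>" "l2n \<phi> \<le> K"
    using square_integrable_bound_nn[OF _ \<open>0 \<le> K\<close> *] by auto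
qed

text \<open>Riesz-Fischer. Along a subsequence with increments below \<open>(1/2)^k\<close> the sums
  of the norms of the increments have \<open>L\<^sup>2\<close> norm at most 2, so by monotone
  convergence they are finite almost everywhere and the subsequence converges pointwise. Fatou's
  lemma then turns the Cauchy estimate into convergence of the full sequence.\<close>

lemma l2_complete:
  fixes f :: "nat \<Rightarrow> real^3 \<Rightarrow> 'b::euclidean_space"
  assumes sq: "\<And>n. square_integrable (f n)"
    and cauchy: "\<And>e. e > 0 \<Longrightarrow> \<exists>K. \<forall>m\<ge>K. \<forall>n\<ge>K. l2n (\<lambda>x. f m x - f n x) < e"
  shows "\<exists>\<phi>. square_integrable \<phi> \<and> (\<lambda>n. l2n (\<lambda>x. f n x - \<phi> x)) \<longlonglongrightarrow> 0"
proof -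
  have [measurable]: "f n \<in> borel_measurable lebesgue" for n
    by (rule square_integrable_measurable[OF sq])
  have "\<forall>k. \<exists>K. \<forall>m\<ge>K. \<forall>n\<ge>K. l2n (\<lambda>x. f m x - f n x) < (1/2)^k"
    using cauchy by simp
  then obtain K where K: "\<And>k m n. m \<ge> K k \<Longrightarrow> n \<ge> K k \<Longrightarrow> l2n (\<lambda>x. f m x - f n x) < (1/2)^k"
    by metis
  \<comment> \<open>The sum makes \<open>r\<close> monotone and at least \<open>K k\<close> at
    \<open>k\<close>; the summand \<open>k\<close> makes it unbounded.\<close>
  define r where "r k = k + (\<Sum>i\<le>k. K i)" for k
  have rK: "r k \<ge> K k" for k
    unfolding r_def by (metis atMost_iff finite_atMost le_refl member_le_sum trans_le_add2 zero_le)
  have r_mono: "r k \<le> r (Suc k)" and r_ge: "k \<le> r k" for k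
    by (auto simp: r_def)
  define d where "d k x = norm (f (r (Suc k)) x - f (r k) x)" for k x
  have [measurable]: "d k \<in> borel_measurable lebesgue" for k
    unfolding d_def by measurable
  have d_sq: "square_integrable (d k)" for k
    using square_integrable_diff[OF sq sq, of "r (Suc k)" "r k"]
    by (simp add: square_integrable_def d_def)
  have d_le: "l2n (d k) \<le> (1/2)^k" for k
    using K[of k "r (Suc k)" "r k"] rK[of k] r_mono[of k] by (simp add: l2n_def d_def)
  define S where "S n x = (\<Sum>k<n. d k x)" for n x
  have S_sq: "square_integrable (S n) \<and> l2n (S n) \<le> (\<Sum>k<n. (1/2)^k)" for n
  proof (induction n)
    case 0
    show ?case by (simp add: S_def)
  next
    case (Suc n)
    have "S (Suc n) = (\<lambda>x. S n x + d n x)"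
      by (auto simp: S_def)
    then show ?case
      using Suc square_integrable_add[OF _ d_sq, of "S n" n] l2n_triangle[OF _ d_sq, of "S n" n]
        d_le[of n] by simp
  qed
  have S_le: "l2n (S n) \<le> 2" for n
  proof -
    have "(\<Sum>k<n. (1/2)^k) \<le> (\<Sum>k. (1/2::real)^k)"
      by (intro sum_le_suminf) auto
    then show ?thesis
      using S_sq[of n] suminf_geometric[of "1/2::real"] by simp
  qed
  have S_nonneg: "0 \<le> S n x" for n x
    by (auto simp: S_def d_def intro: sum_nonneg)
  have S_mono: "S n x \<le> S (Suc n) x" for n x
    by (simp add: S_def d_def)
  have "(\<integral>\<^sup>+x. (SUP n. ennreal ((norm (S n x))\<^sup>2)) \<partial>lebesgue)
      = (SUP n. \<integral>\<^sup>+x. ennreal ((norm (S n x))\<^sup>2) \<partial>lebesgue)"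
  proof (rule nn_integral_monotone_convergence_SUP)
    show "incseq (\<lambda>n x. ennreal ((norm (S n x))\<^sup>2))"
      using S_mono S_nonneg
      by (intro incseq_SucI le_funI ennreal_leI power_mono) auto
    show "(\<lambda>x. ennreal ((norm (S n x))\<^sup>2)) \<in> borel_measurable lebesgue" for n
      unfolding S_def by measurable
  qed
  also have "\<dots> \<le> ennreal 4"
  proof (rule SUP_least)
    fix n
    have "(l2n (S n))\<^sup>2 \<le> 2\<^sup>2"
      by (intro power_mono S_le) simp
    then show "(\<integral>\<^sup>+x. ennreal ((norm (S n x))\<^sup>2) \<partial>lebesgue) \<le> ennreal 4"
      using S_sq[of n] ennreal_leI[of "(l2n (S n))\<^sup>2" 4] by (subst nn_integral_eq_l2n) auto
  qed
  finally have "(\<integral>\<^sup>+x. (SUP n. ennreal ((norm (S n x))\<^sup>2)) \<partial>lebesgue) \<noteq> \<infinity>"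
    by (auto simp: top_unique)
  then have "AE x in lebesgue. (SUP n. ennreal ((norm (S n x))\<^sup>2)) \<noteq> \<infinity>"
    by (intro nn_integral_noteq_infinite) (auto simp: S_def)
  then have conv: "AE x in lebesgue. convergent (\<lambda>k. f (r k) x)"
  proof eventually_elim
    case (elim x)
    then obtain B where B: "(SUP n. ennreal ((norm (S n x))\<^sup>2)) = ennreal B" "0 \<le> B"
      by (cases "SUP n. ennreal ((norm (S n x))\<^sup>2)") auto
    have "summable (\<lambda>k. d k x)"
    proof (rule bounded_imp_summable)
      fix n
      have "ennreal ((norm (S (Suc n) x))\<^sup>2) \<le> ennreal B"
        unfolding B(1)[symmetric] by (rule SUP_upper) simp
      then have "(norm (S (Suc n) x))\<^sup>2 \<le> B"
        using B(2) by simp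
      then have "S (Suc n) x \<le> sqrt B"
        using S_nonneg real_le_rsqrt by auto
      then show "(\<Sum>k\<le>n. d k x) \<le> sqrt B"
        by (simp add: S_def lessThan_Suc_atMost)
    qed (simp add: d_def)
    then have "summable (\<lambda>k. f (r (Suc k)) x - f (r k) x)"
      unfolding d_def by (rule summable_norm_cancel)
    then have "convergent (\<lambda>k. f (r k) x - f (r 0) x)"
      by (simp add: summable_iff_convergent sum_lessThan_telescope[of "\<lambda>k. f (r k) x"])
    from convergent_add[OF this convergent_const[of "f (r 0) x"]] show ?case
      by simp
  qed
  define \<phi> where "\<phi> x = lim (\<lambda>k. f (r k) x)" for x
  have [measurable]: "\<phi> \<in> borel_measurable lebesgue"
    unfolding \<phi>_def by measurable
  have lim: "AE x in lebesgue. (\<lambda>k. f (r k) x) \<longlonglongrightarrow> \<phi> x"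
    using conv by eventually_elim (simp add: \<phi>_def convergent_LIMSEQ_iff)
  \<comment> \<open>Only the first index runs along the subsequence; \<open>n\<close> stays
    arbitrary, which is why the whole sequence converges at the end.\<close>
  have key: "square_integrable (\<lambda>x. \<phi> x - f n x) \<and> l2n (\<lambda>x. \<phi> x - f n x) \<le> (1/2)^j" if "n \<ge> K j" for n j
  proof -
    have "eventually (\<lambda>k. l2n (\<lambda>x. f (r k) x - f n x) \<le> (1/2)^j) sequentially"
      using eventually_ge_at_top[of "K j"]
    proof eventually_elim
      case (elim k)
      then have "r k \<ge> K j" using r_ge[of k] by simp
      then show ?case using K[OF _ that] less_imp_le by blast
    qed
    moreover have "AE x in lebesgue. (\<lambda>k. f (r k) x - f n x) \<longlonglongrightarrow> \<phi> x - f n x"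
      using lim by eventually_elim (auto intro: tendsto_intros)
    ultimately show ?thesis
      using l2_Fatou[where f="\<lambda>k x. f (r k) x - f n x" and \<phi>="\<lambda>x. \<phi> x - f n x"]
        square_integrable_diff[OF sq sq] by auto
  qed
  have "square_integrable (\<lambda>x. (\<phi> x - f (K 0) x) + f (K 0) x)"
    using key[of 0 "K 0"] sq by (intro square_integrable_add) auto
  then have "square_integrable \<phi>"
    by simp
  moreover have "(\<lambda>n. l2n (\<lambda>x. f n x - \<phi> x)) \<longlonglongrightarrow> 0"
  proof (rule LIMSEQ_I)
    fix e :: real assume "0 < e"
    then obtain j where j: "(1/2)^j < e"
      using real_arch_pow_inv[of e "1/2"] by auto
    then have "norm (l2n (\<lambda>x. f n x - \<phi> x) - 0) < e" if "n \<ge> K j" for n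
      using key[OF that] by (simp add: l2n_minus_commute[of "f n"])
    then show "\<exists>N. \<forall>n\<ge>N. norm (l2n (\<lambda>x. f n x - \<phi> x) - 0) < e"
      by blast
  qed
  ultimately show ?thesis by blast
qed

lemma integral_inner_tendsto:
  fixes \<phi> \<psi> :: "real^3 \<Rightarrow> 'b::euclidean_space"
  assumes "square_integrable \<phi>" "square_integrable \<psi>"
    and "\<And>n. square_integrable (f n)" "\<And>n. square_integrable (h n)"
    and f: "((\<lambda>n. l2n (\<lambda>x. f n x - \<phi> x)) \<longlongrightarrow> 0) F" and h: "((\<lambda>n. l2n (\<lambda>x. h n x - \<psi> x)) \<longlongrightarrow> 0) F"
  shows "((\<lambda>n. LINT x|lebesgue. f n x \<bullet> h n x) \<longlongrightarrow> (LINT x|lebesgue. \<phi> x \<bullet> \<psi> x)) F"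
proof (rule Lim_null_comparison[THEN LIM_zero_cancel])
  show "\<forall>\<^sub>F n in F. norm ((LINT x|lebesgue. f n x \<bullet> h n x) - (LINT x|lebesgue. \<phi> x \<bullet> \<psi> x))
      \<le> l2n (\<lambda>x. f n x - \<phi> x) * (l2n (\<lambda>x. h n x - \<psi> x) + l2n \<psi>) + l2n \<phi> * l2n (\<lambda>x. h n x - \<psi> x)"
  proof (intro always_eventually allI)
    fix n
    note sq = assms(1,2) assms(3)[of n] assms(4)[of n]
    have "(LINT x|lebesgue. f n x \<bullet> h n x) - (LINT x|lebesgue. \<phi> x \<bullet> \<psi> x)
        = (LINT x|lebesgue. (f n x - \<phi> x) \<bullet> h n x) + (LINT x|lebesgue. \<phi> x \<bullet> (h n x - \<psi> x))"
      using sq by (simp add: inner_diff_left inner_diff_right integrable_inner_square)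
    moreover have "\<bar>LINT x|lebesgue. (f n x - \<phi> x) \<bullet> h n x\<bar> \<le> l2n (\<lambda>x. f n x - \<phi> x) * l2n (h n)"
      by (intro integrable_inner_square square_integrable_diff sq)
    moreover have "\<dots> \<le> l2n (\<lambda>x. f n x - \<phi> x) * (l2n (\<lambda>x. h n x - \<psi> x) + l2n \<psi>)"
      using l2n_triangle[OF square_integrable_diff[OF sq(4,2)] sq(2)] by (intro mult_left_mono) auto
    moreover have "\<bar>LINT x|lebesgue. \<phi> x \<bullet> (h n x - \<psi> x)\<bar> \<le> l2n \<phi> * l2n (\<lambda>x. h n x - \<psi> x)"
      by (intro integrable_inner_square square_integrable_diff sq)
    ultimately show "norm ((LINT x|lebesgue. f n x \<bullet> h n x) - (LINT x|lebesgue. \<phi> x \<bullet> \<psi> x))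
      \<le> l2n (\<lambda>x. f n x - \<phi> x) * (l2n (\<lambda>x. h n x - \<psi> x) + l2n \<psi>) + l2n \<phi> * l2n (\<lambda>x. h n x - \<psi> x)"
      by (simp add: abs_le_iff)
  qed
  show "((\<lambda>n. l2n (\<lambda>x. f n x - \<phi> x) * (l2n (\<lambda>x. h n x - \<psi> x) + l2n \<psi>)
      + l2n \<phi> * l2n (\<lambda>x. h n x - \<psi> x)) \<longlongrightarrow> 0) F"
    by (rule tendsto_eq_intros f h | simp)+
qed

section \<open>Gaussians and translations\<close>

lemma lborel_distr_reflect:
  fixes a :: "'a::euclidean_space"
  shows "distr lborel borel (\<lambda>x. a - x) = (lborel :: 'a measure)"
  using lborel_affine[of "-1" a] by (simp add: density_1)

lemma lborel_distr_translate:
  fixes a :: "'a::euclidean_space"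
  shows "distr lborel borel (\<lambda>x. x - a) = (lborel :: 'a measure)"
  using lborel_affine[of 1 "-a"] by (simp add: density_1)

lemma
  fixes a :: "'a::euclidean_space" and f :: "'a \<Rightarrow> 'b::{banach, second_countable_topology}"
  assumes [measurable]: "f \<in> borel_measurable borel"
  shows integrable_lborel_reflect: "integrable lborel (\<lambda>x. f (a - x)) \<longleftrightarrow> integrable lborel f"
    and integral_lborel_reflect: "(LINT x|lborel. f (a - x)) = (LINT x|lborel. f x)"
    and integrable_lborel_translate: "integrable lborel (\<lambda>x. f (x - a)) \<longleftrightarrow> integrable lborel f"
    and integral_lborel_translate: "(LINT x|lborel. f (x - a)) = (LINT x|lborel. f x)"
proof -
  have *: "T \<in> borel \<rightarrow>\<^sub>M borel \<Longrightarrow> distr lborel borel T = (lborel :: 'a measure) \<Longrightarrow>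
      (integrable lborel (\<lambda>x. f (T x)) \<longleftrightarrow> integrable lborel f) \<and>
      (LINT x|lborel. f (T x)) = (LINT x|lborel. f x)" for T
    using integrable_distr_eq[of T lborel borel f] integral_distr[of T lborel borel f]
    by auto
  show "integrable lborel (\<lambda>x. f (a - x)) \<longleftrightarrow> integrable lborel f"
    "(LINT x|lborel. f (a - x)) = (LINT x|lborel. f x)"
    using *[OF _ lborel_distr_reflect] by auto
  show "integrable lborel (\<lambda>x. f (x - a)) \<longleftrightarrow> integrable lborel f"
    "(LINT x|lborel. f (x - a)) = (LINT x|lborel. f x)"
    using *[OF _ lborel_distr_translate] by auto
qed

lemma integral_lborel_scale:
  fixes f :: "'a::euclidean_space \<Rightarrow> 'b::{banach, second_countable_topology}"
  assumes [measurable]: "f \<in> borel_measurable borel" and c: "0 < c"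
  shows "(LINT x|lborel. f (c *\<^sub>R x)) = (1 / c ^ DIM('a)) *\<^sub>R (LINT x|lborel. f x)"
    and "integrable lborel f \<Longrightarrow> integrable lborel (\<lambda>x. f (c *\<^sub>R x))"
proof -
  have eq: "lborel = density (distr lborel borel (\<lambda>x::'a. c *\<^sub>R x)) (\<lambda>_. ennreal (c ^ DIM('a)))"
    using lborel_affine[of c "0::'a"] c by (simp add: ennreal_power)
  have "(LINT x|lborel. f x) = (LINT x|density (distr lborel borel (\<lambda>x::'a. c *\<^sub>R x)) (\<lambda>_. ennreal (c ^ DIM('a))). f x)"
    by (subst eq) simp
  also have "\<dots> = c ^ DIM('a) *\<^sub>R (LINT x|lborel. f (c *\<^sub>R x))"
    using c by (subst integral_density) (auto simp: integral_distr)
  finally show "(LINT x|lborel. f (c *\<^sub>R x)) = (1 / c ^ DIM('a)) *\<^sub>R (LINT x|lborel. f x)"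
    using c by simp
  assume "integrable lborel f"
  then have "integrable (density (distr lborel borel (\<lambda>x::'a. c *\<^sub>R x)) (\<lambda>_. ennreal (c ^ DIM('a)))) f"
    using eq by simp
  then have "integrable lborel (\<lambda>x. c ^ DIM('a) *\<^sub>R f (c *\<^sub>R x))"
    using c by (subst (asm) integrable_density) (auto simp: integrable_distr_eq)
  from integrable_scaleR_right[OF this, of "1 / c ^ DIM('a)"] show "integrable lborel (\<lambda>x. f (c *\<^sub>R x))"
    using c by simp
qed

text \<open>Lebesgue measure on a Euclidean space is the image of the product of the measures on the
  coordinate axes. This reduces the transform of a Gaussian to one dimension.\<close>

lemma product_lborel:
  fixes h :: "'a::euclidean_space \<Rightarrow> real \<Rightarrow> complex"
  assumes h: "\<And>b. b \<in> Basis \<Longrightarrow> integrable lborel (h b)"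
  shows "integrable lborel (\<lambda>x. \<Prod>b\<in>Basis. h b (x \<bullet> b))"
    and "(LINT x|lborel. (\<Prod>b\<in>Basis. h b (x \<bullet> b))) = (\<Prod>b\<in>Basis. (LINT t|lborel. h b t))"
proof -
  interpret product_sigma_finite "\<lambda>_::'a. lborel :: real measure" ..
  have [measurable]: "h b \<in> borel_measurable borel" if "b \<in> Basis" for b
    using borel_measurable_integrable[OF h[OF that]] by simp
  have m: "(\<lambda>f. \<Sum>b\<in>Basis. f b *\<^sub>R b) \<in> (\<Pi>\<^sub>M b\<in>Basis. lborel) \<rightarrow>\<^sub>M borel"
    by measurable
  have m2: "(\<lambda>x. \<Prod>b\<in>Basis. h b (x \<bullet> b)) \<in> borel_measurable borel"
    by measurable
  have eq: "(\<Prod>b\<in>Basis. h b ((\<Sum>b\<in>Basis. f b *\<^sub>R b) \<bullet> b)) = (\<Prod>b\<in>Basis. h b (f b))" for f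
    by (intro prod.cong) (auto simp: inner_sum_left inner_Basis if_distrib[where f="\<lambda>x. _ * x"] sum.If_cases)
  show "integrable lborel (\<lambda>x. \<Prod>b\<in>Basis. h b (x \<bullet> b))"
    unfolding lborel_eq[where 'a='a] using h product_integrable_prod[of Basis h]
    by (subst integrable_distr_eq[OF m m2]) (simp add: eq)
  show "(LINT x|lborel. (\<Prod>b\<in>Basis. h b (x \<bullet> b))) = (\<Prod>b\<in>Basis. (LINT t|lborel. h b t))"
    unfolding lborel_eq[where 'a='a] using h product_integral_prod[of Basis h]
    by (subst integral_distr[OF m m2]) (simp add: eq)
qed

lemma norm_power2_eq_sum_Basis: "(norm (x::'a::euclidean_space))\<^sup>2 = (\<Sum>b\<in>Basis. (x \<bullet> b)\<^sup>2)"
  by (subst power2_norm_eq_inner, subst euclidean_inner) (simp add: power2_eq_square)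

text \<open>Up to the factor \<open>sqrt (2 * pi)\<close> the integral is the characteristic
  function of the standard normal distribution at \<open>- w\<close>.\<close>

lemma gauss_fourier_real:
  fixes w :: real
  shows "integrable lborel (\<lambda>s. complex_of_real (exp (- s\<^sup>2 / 2)) * exp (- \<i> * complex_of_real (s * w)))"
    and "(LINT s|lborel. complex_of_real (exp (- s\<^sup>2 / 2)) * exp (- \<i> * complex_of_real (s * w)))
      = complex_of_real (sqrt (2 * pi) * exp (- w\<^sup>2 / 2))"
proof -
  have dens: "complex_of_real (exp (- s\<^sup>2 / 2)) = complex_of_real (sqrt (2 * pi)) * of_real (std_normal_density s)" for s
    by (simp add: std_normal_density_def)
  have int: "integrable lborel (\<lambda>s. complex_of_real (exp (- s\<^sup>2 / 2)))"
    using integrable_normal_density[of 1 0] unfolding dens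
    by (intro integrable_mult_right integrable_of_real) simp
  show "integrable lborel (\<lambda>s. complex_of_real (exp (- s\<^sup>2 / 2)) * exp (- \<i> * complex_of_real (s * w)))"
    by (rule Bochner_Integration.integrable_bound[OF int]) (auto simp: norm_mult)
  have "(LINT s|lborel. complex_of_real (exp (- s\<^sup>2 / 2)) * exp (- \<i> * complex_of_real (s * w)))
      = complex_of_real (sqrt (2 * pi)) * (LINT s|lborel. std_normal_density s *\<^sub>R iexp (- w * s))"
    unfolding dens integral_mult_right_zero[symmetric] by (intro Bochner_Integration.integral_cong) (auto simp: scaleR_conv_of_real mult_ac)
  also have "\<dots> = complex_of_real (sqrt (2 * pi)) * char std_normal_distribution (- w)"
    unfolding char_def by (subst integral_density) (auto simp: normal_density_nonneg)
  also have "\<dots> = complex_of_real (sqrt (2 * pi) * exp (- w\<^sup>2 / 2))"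
    by (simp add: char_std_normal_distribution)
  finally show "(LINT s|lborel. complex_of_real (exp (- s\<^sup>2 / 2)) * exp (- \<i> * complex_of_real (s * w)))
      = complex_of_real (sqrt (2 * pi) * exp (- w\<^sup>2 / 2))" .
qed

lemma gauss_fourier:
  fixes z :: "'a::euclidean_space"
  shows "integrable lborel (\<lambda>p::'a. complex_of_real (exp (- (norm p)\<^sup>2 / 2)) * exp (- \<i> * complex_of_real (p \<bullet> z)))"
    and "(LINT p|lborel. complex_of_real (exp (- (norm p)\<^sup>2 / 2)) * exp (- \<i> * complex_of_real (p \<bullet> z)))
      = complex_of_real (sqrt (2 * pi) ^ DIM('a) * exp (- (norm z)\<^sup>2 / 2))"
proof -
  define h where "h b s = complex_of_real (exp (- s\<^sup>2 / 2)) * exp (- \<i> * complex_of_real (s * (z \<bullet> b)))" for b :: 'a and s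
  have eq: "complex_of_real (exp (- (norm p)\<^sup>2 / 2)) * exp (- \<i> * complex_of_real (p \<bullet> z))
      = (\<Prod>b\<in>Basis. h b (p \<bullet> b))" for p :: 'a
    unfolding h_def norm_power2_eq_sum_Basis
    by (subst euclidean_inner)
      (simp add: prod.distrib exp_sum sum_divide_distrib sum_negf[symmetric] sum_distrib_left
        flip: of_real_prod)
  have h: "integrable lborel (h b)" and hI: "(LINT s|lborel. h b s) = complex_of_real (sqrt (2 * pi) * exp (- (z \<bullet> b)\<^sup>2 / 2))" for b
    unfolding h_def by (rule gauss_fourier_real)+
  show "integrable lborel (\<lambda>p::'a. complex_of_real (exp (- (norm p)\<^sup>2 / 2)) * exp (- \<i> * complex_of_real (p \<bullet> z)))"
    unfolding eq using h by (rule product_lborel)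
  have "(LINT p|lborel. complex_of_real (exp (- (norm p)\<^sup>2 / 2)) * exp (- \<i> * complex_of_real (p \<bullet> z)))
      = (\<Prod>b\<in>(Basis :: 'a set). complex_of_real (sqrt (2 * pi) * exp (- (z \<bullet> b)\<^sup>2 / 2)))"
    unfolding eq using h hI by (subst product_lborel) auto
  also have "\<dots> = complex_of_real (sqrt (2 * pi) ^ DIM('a) * exp (- (norm z)\<^sup>2 / 2))"
    unfolding norm_power2_eq_sum_Basis
    by (simp add: prod.distrib exp_sum sum_divide_distrib sum_negf[symmetric] flip: of_real_prod)
  finally show "(LINT p|lborel. complex_of_real (exp (- (norm p)\<^sup>2 / 2)) * exp (- \<i> * complex_of_real (p \<bullet> z)))
      = complex_of_real (sqrt (2 * pi) ^ DIM('a) * exp (- (norm z)\<^sup>2 / 2))" .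
qed

text \<open>Induction over integrable functions. The substance is the case of an indicator, where
  outer regularity replaces the set by an open one and openness gives pointwise control from one
  side.\<close>

lemma L1_translation_continuous:
  fixes f :: "'a::euclidean_space \<Rightarrow> 'b::{banach, second_countable_topology}"
  assumes "integrable lborel f" and w: "w \<longlonglongrightarrow> 0"
  shows "(\<lambda>n. LINT x|lborel. norm (f (x - w n) - f x)) \<longlonglongrightarrow> 0"
  using assms(1)
proof (induct rule: integrable_induct)
  case (base A c)
  then have A [measurable]: "A \<in> sets borel" by simp
  have ind: "integrable lborel (\<lambda>x. indicator B x :: real)"
    "integrable lborel (\<lambda>x. indicator B (x - v) :: real)"
    "(LINT x|lborel. indicator B (x - v) :: real) = (LINT x|lborel. indicator B x)"
    if [measurable]: "B \<in> sets borel" and "emeasure lborel B < \<infinity>" for B :: "'a set" and v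
    using that by (auto simp: integrable_lborel_translate[of "indicator B :: _ \<Rightarrow> real"]
        integral_lborel_translate[of "indicator B :: _ \<Rightarrow> real"])
  have "(\<lambda>n. LINT x|lborel. \<bar>indicator A (x - w n) - indicator A x :: real\<bar>) \<longlonglongrightarrow> 0"
  proof (rule LIMSEQ_I)
    fix r :: real assume r: "0 < r"
    \<comment> \<open>Four error terms arise: two from \<open>U - A\<close> and its translate, and
      twice the integral of \<open>D n\<close>.\<close>
    define e where "e = r / 4"
    have "0 < e" using r by (simp add: e_def)
    obtain U where U: "open U" "A \<subseteq> U" "emeasure lborel (U - A) < e"
      using outer_regular_lborel[of A e] A \<open>0 < e\<close> by auto
    have [measurable]: "U \<in> sets borel" using U by simp
    have fin_UA: "emeasure lborel (U - A) < \<infinity>" "emeasure lborel U < \<infinity>"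
    proof -
      show *: "emeasure lborel (U - A) < \<infinity>"
        using U(3) by (rule less_trans) simp
      have "emeasure lborel U \<le> emeasure lborel A + emeasure lborel (U - A)"
        using U by (intro order_trans[OF _ emeasure_subadditive] emeasure_mono) auto
      then show "emeasure lborel U < \<infinity>"
        using * base by (auto simp: less_top le_less_trans ennreal_add_less_top)
    qed
    \<comment> \<open>A point of the open set \<open>U\<close> stays in \<open>U\<close> under small
      translations, so the positive part tends to 0 pointwise. The negative part needs no separate
      limit, because both indicators have the same integral.\<close>
    define D where "D n x = max 0 (indicator U x - indicator U (x - w n) :: real)" for n x
    have D: "(\<lambda>n. LINT x|lborel. D n x) \<longlonglongrightarrow> (LINT x::'a|lborel. (0::real))"
    proof (rule integral_dominated_convergence[where w="\<lambda>x. indicator U x"])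
      show "integrable lborel (\<lambda>x. indicator U x :: real)"
        using ind fin_UA by simp
      show "AE x in lborel. (\<lambda>n. D n x) \<longlonglongrightarrow> 0"
      proof (intro AE_I2)
        fix x
        show "(\<lambda>n. D n x) \<longlonglongrightarrow> 0"
        proof (cases "x \<in> U")
          case True
          have "(\<lambda>n. x - w n) \<longlonglongrightarrow> x - 0"
            by (intro tendsto_intros w)
          then have "eventually (\<lambda>n. x - w n \<in> U) sequentially"
            using U(1) True by (auto elim: topological_tendstoD)
          then have "eventually (\<lambda>n. D n x = 0) sequentially"
            by eventually_elim (use True in \<open>simp add: D_def\<close>)
          then show ?thesis
            by (rule tendsto_eventually)
        next
          case False
          then show ?thesis by (simp add: D_def)
        qed
      qed
      show "AE x in lborel. norm (D n x) \<le> indicator U x" for n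
        by (intro AE_I2) (auto simp: D_def split: split_indicator)
    qed (auto simp: D_def)
    then obtain n0 where n0: "\<And>n. n \<ge> n0 \<Longrightarrow> (LINT x|lborel. D n x) < e"
      using order_tendstoD(2)[OF D, of e] \<open>0 < e\<close> by (auto simp: eventually_sequentially)
    have "norm ((LINT x|lborel. \<bar>indicator A (x - w n) - indicator A x :: real\<bar>) - 0) < r" if "n \<ge> n0" for n
    proof -
      have D_int: "integrable lborel (D n)"
        unfolding D_def using ind(1,2)[of U] fin_UA by (intro integrable_max) auto
      \<comment> \<open>For a real number \<open>a\<close> the absolute value is
        \<open>2 * max 0 a - a\<close>; with \<open>a\<close> the difference of the indicators of
        \<open>U\<close>, the integral of the last term vanishes by translation invariance.\<close>
      have "(LINT x|lborel. \<bar>indicator A (x - w n) - indicator A x :: real\<bar>)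
          \<le> (LINT x|lborel. indicator (U - A) (x - w n) + indicator (U - A) x
              + (2 * D n x + (indicator U (x - w n) - indicator U x)))"
      proof (rule integral_mono)
        show "integrable lborel (\<lambda>x. indicator (U - A) (x - w n) + indicator (U - A) x
              + (2 * D n x + (indicator U (x - w n) - indicator U x)) :: real)"
          using D_int ind[of U] ind[of "U - A"] fin_UA by auto
        show "integrable lborel (\<lambda>x. \<bar>indicator A (x - w n) - indicator A x :: real\<bar>)"
          using ind[of A] base by auto
        show "\<bar>indicator A (x - w n) - indicator A x :: real\<bar> \<le> indicator (U - A) (x - w n) + indicator (U - A) x
              + (2 * D n x + (indicator U (x - w n) - indicator U x))" for x
          using U(2) unfolding D_def by (auto split: split_indicator)
      qed
      also have "\<dots> = 2 * measure lborel (U - A) + 2 * (LINT x|lborel. D n x)"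
        using D_int ind[of U] ind[of "U - A"] fin_UA by simp
      also have "measure lborel (U - A) < e"
        using U(3) fin_UA \<open>0 < e\<close> by (simp add: measure_def enn2real_less_iff)
      also note n0[OF that]
      finally show ?thesis
        using Bochner_Integration.integral_nonneg[of lborel "\<lambda>x. \<bar>indicator A (x - w n) - indicator A x :: real\<bar>"]
        by (simp add: e_def)
    qed
    then show "\<exists>no. \<forall>n\<ge>no. norm ((LINT x|lborel. \<bar>indicator A (x - w n) - indicator A x :: real\<bar>) - 0) < r"
      by blast
  qed
  from tendsto_mult_right[OF this, of "norm c"] show ?case
    by (simp flip: scaleR_diff_left)
next
  case (add f g)
  note meas [measurable] = add(1,3)[THEN borel_measurable_integrable, simplified]
  have tr: "integrable lborel (\<lambda>x. f (x - v))" "integrable lborel (\<lambda>x. g (x - v))" for v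
    using add integrable_lborel_translate[of f v] integrable_lborel_translate[of g v] by auto
  show ?case
  proof (rule tendsto_sandwich[OF _ _ tendsto_const])
    show "(\<lambda>n. (LINT x|lborel. norm (f (x - w n) - f x)) + (LINT x|lborel. norm (g (x - w n) - g x))) \<longlonglongrightarrow> 0"
      using tendsto_add[OF add(2,4)] by simp
    show "\<forall>\<^sub>F n in sequentially. (LINT x|lborel. norm (f (x - w n) + g (x - w n) - (f x + g x)))
      \<le> (LINT x|lborel. norm (f (x - w n) - f x)) + (LINT x|lborel. norm (g (x - w n) - g x))"
    proof (intro always_eventually allI)
      fix n
      have "(LINT x|lborel. norm (f (x - w n) + g (x - w n) - (f x + g x)))
        \<le> (LINT x|lborel. norm (f (x - w n) - f x) + norm (g (x - w n) - g x))"
        using tr add norm_triangle_ineq[of "f (x - w n) - f x" "g (x - w n) - g x" for x]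
        by (intro integral_mono) (auto simp: algebra_simps)
      then show "(LINT x|lborel. norm (f (x - w n) + g (x - w n) - (f x + g x)))
      \<le> (LINT x|lborel. norm (f (x - w n) - f x)) + (LINT x|lborel. norm (g (x - w n) - g x))"
        using tr add by simp
    qed
  qed simp
next
  case (lim f s)
  note [measurable] = lim(1,5)[THEN borel_measurable_integrable, simplified]
  have tr: "integrable lborel (\<lambda>x. f (x - v))" "integrable lborel (\<lambda>x. s i (x - v))" for v i
    using lim integrable_lborel_translate[of f v] integrable_lborel_translate[of "s i" v] by auto
  \<comment> \<open>The approximants satisfy \<open>norm (s i x) \<le> 2 * norm (f x)\<close>,
    whence the factor 3 in the dominating function.\<close>
  have s_lim: "(\<lambda>i. LINT x|lborel. norm (s i x - f x)) \<longlonglongrightarrow> (LINT x::'a|lborel. (0::real))"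
  proof (rule integral_dominated_convergence[where w="\<lambda>x. 3 * norm (f x)"])
    show "AE x in lborel. (\<lambda>i. norm (s i x - f x)) \<longlonglongrightarrow> 0"
      using lim(3) by (intro AE_I2) (simp add: LIM_zero tendsto_norm_zero)
    show "AE x in lborel. norm (norm (s i x - f x)) \<le> 3 * norm (f x)" for i
    proof (intro AE_I2)
      fix x :: 'a
      show "norm (norm (s i x - f x)) \<le> 3 * norm (f x)"
        using lim(4)[of x i] norm_triangle_ineq4[of "s i x" "f x"] by simp
    qed
  qed (use lim in auto)
  show ?case
  proof (rule LIMSEQ_I)
    fix r :: real assume "0 < r"
    then obtain i where i: "(LINT x|lborel. norm (s i x - f x)) < r / 3"
      using order_tendstoD(2)[OF s_lim, of "r / 3"] by (auto simp: eventually_sequentially)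
    obtain n0 where n0: "\<And>n. n \<ge> n0 \<Longrightarrow> (LINT x|lborel. norm (s i (x - w n) - s i x)) < r / 3"
      using order_tendstoD(2)[OF lim(2), of "r / 3" i] \<open>0 < r\<close> by (auto simp: eventually_sequentially)
    have "norm ((LINT x|lborel. norm (f (x - w n) - f x)) - 0) < r" if "n \<ge> n0" for n
    proof -
      have "(LINT x|lborel. norm (f (x - w n) - f x))
        \<le> (LINT x|lborel. norm (s i (x - w n) - f (x - w n)) + norm (s i (x - w n) - s i x) + norm (s i x - f x))"
      proof (rule integral_mono)
        show "norm (f (x - w n) - f x)
          \<le> norm (s i (x - w n) - f (x - w n)) + norm (s i (x - w n) - s i x) + norm (s i x - f x)" for x
          using norm_triangle_ineq[of "(f (x - w n) - s i (x - w n)) + (s i (x - w n) - s i x)" "s i x - f x"]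
            norm_triangle_ineq[of "f (x - w n) - s i (x - w n)" "s i (x - w n) - s i x"]
          by (simp add: norm_minus_commute)
      qed (use tr lim in auto)
      also have "\<dots> = (LINT x|lborel. norm (s i (x - w n) - f (x - w n)))
          + (LINT x|lborel. norm (s i (x - w n) - s i x)) + (LINT x|lborel. norm (s i x - f x))"
        using tr lim by simp
      also have "(LINT x|lborel. norm (s i (x - w n) - f (x - w n))) = (LINT x|lborel. norm (s i x - f x))"
        by (rule integral_lborel_translate[of "\<lambda>x. norm (s i x - f x)"]) measurable
      finally show ?thesis
        using i n0[OF that] Bochner_Integration.integral_nonneg[of lborel "\<lambda>x. norm (f (x - w n) - f x)"] by simp
    qed
    then show "\<exists>no. \<forall>n\<ge>no. norm ((LINT x|lborel. norm (f (x - w n) - f x)) - 0) < r"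
      by blast
  qed
qed


section \<open>The Plancherel identity\<close>

lemma borel_measurable_cnj [measurable (raw)]:
  "f \<in> borel_measurable M \<Longrightarrow> (\<lambda>x. cnj (f x)) \<in> borel_measurable M"
  by (intro borel_measurable_continuous_on[where f=cnj] continuous_intros)

lemma borel_measurable_exp_complex [measurable (raw)]:
  "f \<in> borel_measurable M \<Longrightarrow> (\<lambda>x. exp (f x :: complex)) \<in> borel_measurable M"
  by (intro borel_measurable_continuous_on[where f=exp] continuous_intros)

lemma fourier_integral_lborel:
  assumes "f \<in> borel_measurable borel"
  shows "fourier_integral f p = complex_of_real ((2 * pi) powr (- 3 / 2)) *
       (LINT x|lborel. f x * exp (- \<i> * complex_of_real (p \<bullet> x)))"
  unfolding fourier_integral_def using assms by (subst integral_completion) auto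

lemma norm_exp_i [simp]: "cmod (exp (- \<i> * complex_of_real t)) = 1" "cmod (exp (- (\<i> * complex_of_real t))) = 1"
  using norm_exp_i_times[of "- t"] by simp_all

lemma fourier_integral_measurable_borel:
  assumes [measurable]: "f \<in> borel_measurable borel"
  shows "fourier_integral f \<in> borel_measurable borel"
proof -
  have "(\<lambda>p. complex_of_real ((2 * pi) powr (- 3 / 2)) *
       (LINT x|lborel. f x * exp (- \<i> * complex_of_real (p \<bullet> x)))) \<in> borel_measurable borel"
    by measurable
  moreover have "fourier_integral f = (\<lambda>p. complex_of_real ((2 * pi) powr (- 3 / 2)) *
       (LINT x|lborel. f x * exp (- \<i> * complex_of_real (p \<bullet> x))))"
    by (intro ext fourier_integral_lborel assms)
  ultimately show ?thesis
    by simp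
qed

text \<open>Supplies the joint integrability behind the exchanges of integrals below. The kernel is
  once the Fourier character and once a translate of a bounded function.\<close>

lemma integrable_pair_bounded_kernel:
  fixes f g :: "'a::euclidean_space \<Rightarrow> complex" and k :: "'a \<Rightarrow> 'a \<Rightarrow> complex"
  assumes f: "integrable lborel f" and g: "integrable lborel g"
    and [measurable]: "(\<lambda>(x, y). k x y) \<in> borel_measurable (borel \<Otimes>\<^sub>M borel)"
    and k: "\<And>x y. cmod (k x y) \<le> B"
  shows "integrable (lborel \<Otimes>\<^sub>M lborel) (\<lambda>(x, y). f x * g y * k x y)"
proof -
  note [measurable] = borel_measurable_integrable[OF f, simplified] borel_measurable_integrable[OF g, simplified]
  have fg: "integrable (lborel \<Otimes>\<^sub>M lborel) (\<lambda>(x, y). f x * g y)"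
  proof (rule lborel_pair.Fubini_integrable)
    show "integrable lborel (\<lambda>x. LINT y|lborel. norm (case (x, y) of (x, y) \<Rightarrow> f x * g y))"
      using f by (simp add: norm_mult)
    show "AE x in lborel. integrable lborel (\<lambda>y. case (x, y) of (x, y) \<Rightarrow> f x * g y)"
      using g by simp
  qed measurable
  have m: "(\<lambda>(x, y). f x * g y * k x y) \<in> borel_measurable (lborel \<Otimes>\<^sub>M lborel)"
    by measurable
  show ?thesis
  proof (rule Bochner_Integration.integrable_bound[OF integrable_mult_right[OF fg, of "complex_of_real \<bar>B\<bar>"] m])
    have "cmod (k x y) \<le> \<bar>B\<bar>" for x y
      using k[of x y] by linarith
    then show "AE z in lborel \<Otimes>\<^sub>M lborel. norm (case z of (x, y) \<Rightarrow> f x * g y * k x y)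
        \<le> norm (complex_of_real \<bar>B\<bar> * (case z of (x, y) \<Rightarrow> f x * g y))"
      by (intro AE_I2) (auto simp: norm_mult mult.commute intro!: mult_right_mono)
  qed
qed

lemma norm_fourier_integral_le:
  assumes [measurable]: "f \<in> borel_measurable borel"
  shows "cmod (fourier_integral f p) \<le> (2 * pi) powr (- 3 / 2) * (LINT x|lborel. cmod (f x))"
proof -
  have "cmod (LINT x|lborel. f x * exp (- \<i> * complex_of_real (p \<bullet> x)))
      \<le> (LINT x|lborel. cmod (f x * exp (- \<i> * complex_of_real (p \<bullet> x))))"
    by (rule integral_norm_bound)
  then show ?thesis
    unfolding fourier_integral_lborel[OF assms] by (simp add: norm_mult)
qed

lemma fourier_integral_multiplication:
  assumes f: "integrable lborel f" and g: "integrable lborel g"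
  shows "(LINT p|lborel. fourier_integral f p * g p) = (LINT x|lborel. f x * fourier_integral g x)"
proof -
  note [measurable] = borel_measurable_integrable[OF f, simplified] borel_measurable_integrable[OF g, simplified]
  have *: "integrable (lborel \<Otimes>\<^sub>M lborel) (\<lambda>(x, p). f x * g p * exp (- \<i> * complex_of_real (p \<bullet> x)))"
    by (rule integrable_pair_bounded_kernel[OF f g, where B=1]) auto
  define c where "c = complex_of_real ((2 * pi) powr (- 3 / 2))"
  have "(LINT p|lborel. fourier_integral f p * g p)
      = c * (LINT p|lborel. (LINT x|lborel. f x * g p * exp (- \<i> * complex_of_real (p \<bullet> x))))"
    by (simp add: fourier_integral_lborel c_def mult_ac flip: integral_mult_right_zero integral_mult_left_zero)
  also have "\<dots> = c * (LINT x|lborel. (LINT p|lborel. f x * g p * exp (- \<i> * complex_of_real (p \<bullet> x))))"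
    using lborel_pair.Fubini_integral[OF *] by simp
  also have "\<dots> = (LINT x|lborel. f x * fourier_integral g x)"
    by (simp add: fourier_integral_lborel c_def mult_ac inner_commute flip: integral_mult_right_zero integral_mult_left_zero)
  finally show ?thesis .
qed

lemma fourier_integral_gaussian:
  fixes z :: "real^3"
  assumes "0 < e"
  shows "complex_of_real ((2 * pi) powr (- 3 / 2)) *
      (LINT p|lborel. complex_of_real (exp (- (norm (e *\<^sub>R p))\<^sup>2 / 2)) * exp (- \<i> * complex_of_real (p \<bullet> z)))
    = complex_of_real (exp (- (norm (z /\<^sub>R e))\<^sup>2 / 2) / e ^ 3)"
    and "integrable lborel (\<lambda>p::real^3. complex_of_real (exp (- (norm (e *\<^sub>R p))\<^sup>2 / 2)))"
proof -
  define h where "h p = complex_of_real (exp (- (norm p)\<^sup>2 / 2)) * exp (- \<i> * complex_of_real (p \<bullet> (z /\<^sub>R e)))" for p :: "real^3"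
  have [measurable]: "h \<in> borel_measurable borel"
    unfolding h_def by measurable
  have hp: "h (e *\<^sub>R p) = complex_of_real (exp (- (norm (e *\<^sub>R p))\<^sup>2 / 2)) * exp (- \<i> * complex_of_real (p \<bullet> z))" for p
  proof -
    have "(e *\<^sub>R p) \<bullet> (z /\<^sub>R e) = p \<bullet> z"
      using assms by simp
    then show ?thesis
      by (simp only: h_def)
  qed
  have c: "(2 * pi) powr (- 3 / 2) * sqrt (2 * pi) ^ 3 = 1"
  proof -
    have "sqrt (2 * pi) ^ 3 = (2 * pi) powr (3 / 2)"
      by (simp add: powr_half_sqrt[symmetric] powr_power)
    then show ?thesis
      by (simp flip: powr_add)
  qed
  have "(LINT p|lborel. h (e *\<^sub>R p)) = (1 / e ^ 3) *\<^sub>R (LINT p|lborel. h p)"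
    using integral_lborel_scale(1)[of h e] assms by simp
  also have "(LINT p|lborel. h p) = complex_of_real (sqrt (2 * pi) ^ 3 * exp (- (norm (z /\<^sub>R e))\<^sup>2 / 2))"
    unfolding h_def by (subst gauss_fourier) simp
  finally show "complex_of_real ((2 * pi) powr (- 3 / 2)) *
      (LINT p|lborel. complex_of_real (exp (- (norm (e *\<^sub>R p))\<^sup>2 / 2)) * exp (- \<i> * complex_of_real (p \<bullet> z)))
    = complex_of_real (exp (- (norm (z /\<^sub>R e))\<^sup>2 / 2) / e ^ 3)"
    unfolding hp using c by (simp add: scaleR_conv_of_real mult_ac flip: of_real_mult)
  have "integrable lborel (\<lambda>p::real^3. complex_of_real (exp (- (norm p)\<^sup>2 / 2)))"
    using gauss_fourier(1)[of "0::real^3"] by simp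
  from integral_lborel_scale(2)[OF _ assms this]
  show "integrable lborel (\<lambda>p::real^3. complex_of_real (exp (- (norm (e *\<^sub>R p))\<^sup>2 / 2)))"
    by measurable
qed

lemma fourier_integral_cnj_reflect:
  assumes [measurable]: "f \<in> borel_measurable borel"
  shows "fourier_integral (\<lambda>y. cnj (f (- y))) p = cnj (fourier_integral f p)"
proof -
  have "(LINT y|lborel. cnj (f (- y)) * exp (- \<i> * complex_of_real (p \<bullet> y)))
      = (LINT y|lborel. (\<lambda>x. cnj (f x) * exp (\<i> * complex_of_real (p \<bullet> x))) (0 - y))"
    by (intro Bochner_Integration.integral_cong) auto
  also have "\<dots> = (LINT x|lborel. cnj (f x) * exp (\<i> * complex_of_real (p \<bullet> x)))"
    by (rule integral_lborel_reflect) measurable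
  also have "\<dots> = (LINT x|lborel. cnj (f x * exp (- \<i> * complex_of_real (p \<bullet> x))))"
    by (intro Bochner_Integration.integral_cong) (auto simp: exp_cnj)
  also have "\<dots> = cnj (LINT x|lborel. f x * exp (- \<i> * complex_of_real (p \<bullet> x)))"
    by (rule Bochner_Integration.integral_cnj)
  finally show ?thesis
    by (simp add: fourier_integral_lborel)
qed

text \<open>The multiplication formula moves the transform from \<open>f\<close> onto
  \<open>cnj (fourier_integral f p) * w p\<close>. A second use computes the transform of that
  product: the conjugate factor is the transform of the reflected conjugate of \<open>f\<close>, and
  a modulated Gaussian transforms into a translated one. The bound \<open>B\<close> makes the kernel
  of the final exchange of integrals bounded.\<close>

lemma fourier_gauss_identity:
  assumes f: "integrable lborel f" and B: "\<And>x. cmod (f x) \<le> B" and e: "0 < e"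
  shows "(LINT p|lborel. complex_of_real (exp (- (norm (e *\<^sub>R p))\<^sup>2 / 2) * (cmod (fourier_integral f p))\<^sup>2))
    = (LINT z|lborel. complex_of_real ((2 * pi) powr (- 3 / 2) * exp (- (norm z)\<^sup>2 / 2)) *
        (LINT x|lborel. f x * cnj (f (x - e *\<^sub>R z))))"
proof -
  define c where "c = complex_of_real ((2 * pi) powr (- 3 / 2))"
  define w where "w p = complex_of_real (exp (- (norm (e *\<^sub>R p))\<^sup>2 / 2))" for p :: "real^3"
  define w1 where "w1 p = complex_of_real (exp (- (norm p)\<^sup>2 / 2))" for p :: "real^3"
  define f' where "f' y = cnj (f (- y))" for y
  define C where "C = (2 * pi) powr (- 3 / 2) * (LINT x|lborel. cmod (f x))"
  have meas [measurable]: "f \<in> borel_measurable borel"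
    using borel_measurable_integrable[OF f] by simp
  note [measurable] = fourier_integral_measurable_borel[OF meas]
  have [measurable]: "w \<in> borel_measurable borel" "w1 \<in> borel_measurable borel"
    unfolding w_def w1_def by measurable
  have w_int: "integrable lborel w" "integrable lborel w1"
    unfolding w_def w1_def using fourier_integral_gaussian(2)[OF e] fourier_integral_gaussian(2)[of 1] by simp_all
  have f'_int: "integrable lborel f'"
    unfolding f'_def using integrable_lborel_reflect[of f 0] f by simp
  have FI_f': "fourier_integral f' p = cnj (fourier_integral f p)" for p
    unfolding f'_def by (rule fourier_integral_cnj_reflect[OF meas])
  have FIle: "cmod (fourier_integral f p) \<le> C" for p
    unfolding C_def by (rule norm_fourier_integral_le) measurable
  have int_g: "integrable lborel (\<lambda>p. cnj (fourier_integral f p) * w p)"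
    by (rule Bochner_Integration.integrable_bound[OF integrable_mult_right[OF w_int(1), of "complex_of_real C"]])
      (auto simp: norm_mult intro!: mult_right_mono order_trans[OF FIle])
  have int_we: "integrable lborel (\<lambda>p. w p * exp (- \<i> * complex_of_real (p \<bullet> x)))" for x
    by (rule Bochner_Integration.integrable_bound[OF w_int(1)]) (auto simp: norm_mult)
  have FI_g: "fourier_integral (\<lambda>p. cnj (fourier_integral f p) * w p) x
      = (LINT z|lborel. c * w1 z * cnj (f (x - e *\<^sub>R z)))" for x
  proof -
    have FI_we: "fourier_integral (\<lambda>p. w p * exp (- \<i> * complex_of_real (p \<bullet> x))) y
        = complex_of_real (exp (- (norm ((x + y) /\<^sub>R e))\<^sup>2 / 2) / e ^ 3)" for y
    proof -
      have "fourier_integral (\<lambda>p. w p * exp (- \<i> * complex_of_real (p \<bullet> x))) y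
        = c * (LINT p|lborel. w p * exp (- \<i> * complex_of_real (p \<bullet> (x + y))))"
        by (subst fourier_integral_lborel)
          (auto simp: c_def inner_add_right inner_commute[of y] ring_distribs exp_diff exp_minus field_simps
            intro!: Bochner_Integration.integral_cong)
      then show ?thesis
        using fourier_integral_gaussian(1)[OF e, of "x + y"] by (simp add: c_def w_def)
    qed
    \<comment> \<open>The substitutions are \<open>u = x + y\<close>, which turns
      \<open>f' y\<close> into \<open>cnj (f (x - u))\<close>, and then
      \<open>u = e *\<^sub>R z\<close>, whose Jacobian cancels \<open>e ^ 3\<close>.\<close>
    define h where "h u = c * cnj (f (x - u)) * complex_of_real (exp (- (norm (u /\<^sub>R e))\<^sup>2 / 2))" for u
    have [measurable]: "h \<in> borel_measurable borel"
      unfolding h_def by measurable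
    have "fourier_integral (\<lambda>p. cnj (fourier_integral f p) * w p) x
      = c * (LINT p|lborel. fourier_integral f' p * (w p * exp (- \<i> * complex_of_real (p \<bullet> x))))"
      by (subst fourier_integral_lborel[of "\<lambda>p. cnj (fourier_integral f p) * w p"])
        (auto simp: FI_f' c_def inner_commute[of x] mult_ac
          intro!: Bochner_Integration.integral_cong)
    also have "\<dots> = c * (LINT y|lborel. f' y * complex_of_real (exp (- (norm ((x + y) /\<^sub>R e))\<^sup>2 / 2) / e ^ 3))"
      by (simp only: fourier_integral_multiplication[OF f'_int int_we] FI_we)
    also have "\<dots> = (1 / e ^ 3) *\<^sub>R (LINT y|lborel. h (y - (- x)))"
      unfolding integral_mult_right_zero[symmetric] integral_scaleR_right[symmetric]
      by (intro Bochner_Integration.integral_cong)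
        (auto simp: h_def f'_def scaleR_conv_of_real add.commute)
    also have "\<dots> = (1 / e ^ 3) *\<^sub>R (LINT u|lborel. h u)"
      by (subst integral_lborel_translate) auto
    also have "\<dots> = (LINT z|lborel. h (e *\<^sub>R z))"
      using e by (subst integral_lborel_scale) auto
    also have "\<dots> = (LINT z|lborel. c * w1 z * cnj (f (x - e *\<^sub>R z)))"
      using e by (intro Bochner_Integration.integral_cong) (auto simp: h_def w1_def)
    finally show ?thesis .
  qed
  have "(LINT p|lborel. complex_of_real (exp (- (norm (e *\<^sub>R p))\<^sup>2 / 2) * (cmod (fourier_integral f p))\<^sup>2))
      = (LINT p|lborel. fourier_integral f p * (cnj (fourier_integral f p) * w p))"
    unfolding w_def of_real_mult complex_norm_square
    by (intro Bochner_Integration.integral_cong) (auto simp: mult_ac)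
  also have "\<dots> = (LINT x|lborel. f x * (LINT z|lborel. c * w1 z * cnj (f (x - e *\<^sub>R z))))"
    by (subst fourier_integral_multiplication[OF f int_g]) (simp add: FI_g)
  also have "\<dots> = (LINT x|lborel. LINT z|lborel. f x * (c * w1 z) * cnj (f (x - e *\<^sub>R z)))"
    by (simp add: mult_ac flip: integral_mult_right_zero)
  also have "\<dots> = (LINT z|lborel. LINT x|lborel. f x * (c * w1 z) * cnj (f (x - e *\<^sub>R z)))"
  proof (rule lborel_pair.Fubini_integral[symmetric], rule integrable_pair_bounded_kernel[where B=B])
    show "(\<lambda>(x, y). cnj (f (x - e *\<^sub>R y))) \<in> borel_measurable (borel \<Otimes>\<^sub>M borel)"
      by measurable
  qed (use f w_int B in auto)
  also have "\<dots> = (LINT z|lborel. complex_of_real ((2 * pi) powr (- 3 / 2) * exp (- (norm z)\<^sup>2 / 2)) *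
        (LINT x|lborel. f x * cnj (f (x - e *\<^sub>R z))))"
    unfolding integral_mult_right_zero[symmetric]
    by (intro Bochner_Integration.integral_cong) (auto simp: c_def w1_def mult_ac)
  finally show ?thesis .
qed

text \<open>The parameter of the Gaussian regularisation tends to 0. On the frequency side the
  weights increase to 1 and monotone convergence also provides integrability; on the other side
  dominated convergence leaves the autocorrelation at 0.\<close>

lemma plancherel_bounded:
  assumes f: "integrable lborel f" and B: "\<And>x. cmod (f x) \<le> B"
  shows "integrable lborel (\<lambda>p. (cmod (fourier_integral f p))\<^sup>2)"
    and "(LINT p|lborel. (cmod (fourier_integral f p))\<^sup>2) = (LINT x|lborel. (cmod (f x))\<^sup>2)"
proof -
  define e where "e n = 1 / real (Suc n)" for n
  define C where "C = (2 * pi) powr (- 3 / 2) * (LINT x|lborel. cmod (f x))"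
  define \<gamma> where "\<gamma> z = (2 * pi) powr (- 3 / 2) * exp (- (norm z)\<^sup>2 / 2)" for z :: "real^3"
  have e: "0 < e n" "e \<longlonglongrightarrow> 0" for n
    using LIMSEQ_inverse_real_of_nat unfolding e_def by (auto simp: inverse_eq_divide)
  have meas [measurable]: "f \<in> borel_measurable borel"
    using borel_measurable_integrable[OF f] by simp
  note [measurable] = fourier_integral_measurable_borel[OF meas]
  have B0: "0 \<le> B" using B[of 0] norm_ge_zero order_trans by blast
  have FIle: "cmod (fourier_integral f p) \<le> C" for p
    unfolding C_def by (rule norm_fourier_integral_le) measurable
  have tr: "integrable lborel (\<lambda>x. f (x - v))" for v
    using f integrable_lborel_translate[of f v] by simp
  have \<gamma>_int: "integrable lborel \<gamma>" and \<gamma>_1: "(LINT z|lborel. \<gamma> z) = 1"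
  proof -
    have "integrable lborel (\<lambda>z::real^3. complex_of_real (exp (- (norm z)\<^sup>2 / 2)))"
      using fourier_integral_gaussian(2)[of 1] by simp
    then show "integrable lborel \<gamma>"
      unfolding \<gamma>_def by (subst (asm) complex_of_real_integrable_eq) simp
    have "complex_of_real (LINT z|lborel. \<gamma> z) = 1"
      using fourier_integral_gaussian(1)[of 1 0] unfolding \<gamma>_def integral_complex_of_real[symmetric]
      by simp
    then show "(LINT z|lborel. \<gamma> z) = 1"
      by simp
  qed
  have prod_le: "cmod (f x * cnj (f (x - v))) \<le> B * cmod (f x)" for x v
    unfolding norm_mult complex_mod_cnj by (subst mult.commute) (intro mult_right_mono B norm_ge_zero)
  have prod_int: "integrable lborel (\<lambda>x. f x * cnj (f (x - v)))" for v
    by (rule Bochner_Integration.integrable_bound[OF integrable_mult_right[OF f, of "complex_of_real B"]])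
      (auto simp: norm_mult B0 intro!: AE_I2 prod_le[unfolded norm_mult complex_mod_cnj])
  have sq_int: "integrable lborel (\<lambda>x. (cmod (f x))\<^sup>2)"
    using integrable_norm[OF prod_int[of 0]] by (simp add: norm_mult power2_eq_square)
  \<comment> \<open>The autocorrelation. Its value at 0 is the squared norm of \<open>f\<close>, and
    continuity there follows from continuity of translations in \<open>L\<^sup>1\<close> because
    \<open>f\<close> is bounded.\<close>
  define A where "A v = (LINT x|lborel. f x * cnj (f (x - v)))" for v
  have A0: "A 0 = complex_of_real (LINT x|lborel. (cmod (f x))\<^sup>2)"
    unfolding A_def integral_complex_of_real[symmetric] by (simp add: complex_norm_square del: of_real_power)
  have A_meas [measurable]: "A \<in> borel_measurable borel"
    unfolding A_def by measurable
  have A_le: "cmod (A v) \<le> B * (LINT x|lborel. cmod (f x))" for v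
  proof -
    have "cmod (A v) \<le> (LINT x|lborel. cmod (f x * cnj (f (x - v))))"
      unfolding A_def by (rule integral_norm_bound)
    also have "\<dots> \<le> (LINT x|lborel. B * cmod (f x))"
      using integrable_norm[OF prod_int[of v]] f prod_le
      by (intro integral_mono) auto
    finally show ?thesis by simp
  qed
  have A_lim: "(\<lambda>n. A (v n)) \<longlonglongrightarrow> A 0" if v: "v \<longlonglongrightarrow> 0" for v
  proof (rule Lim_null_comparison[THEN LIM_zero_cancel])
    show "(\<lambda>n. B * (LINT x|lborel. norm (f (x - v n) - f x))) \<longlonglongrightarrow> 0"
      using tendsto_mult_right_zero[OF L1_translation_continuous[OF f v], of B] by simp
    show "\<forall>\<^sub>F n in sequentially. norm (A (v n) - A 0) \<le> B * (LINT x|lborel. norm (f (x - v n) - f x))"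
    proof (intro always_eventually allI)
      fix n
      have "A (v n) - A 0 = (LINT x|lborel. f x * cnj (f (x - v n) - f x))"
        unfolding A_def using prod_int[of "v n"] prod_int[of 0] by (simp add: right_diff_distrib)
      also have "cmod \<dots> \<le> (LINT x|lborel. cmod (f x * cnj (f (x - v n) - f x)))"
        by (rule integral_norm_bound)
      also have "\<dots> \<le> (LINT x|lborel. B * norm (f (x - v n) - f x))"
      proof (rule integral_mono)
        have "integrable lborel (\<lambda>x. f x * cnj (f (x - v n) - f x))"
          using prod_int[of "v n"] prod_int[of 0] by (simp add: right_diff_distrib)
        then show "integrable lborel (\<lambda>x. cmod (f x * cnj (f (x - v n) - f x)))"
          by (rule integrable_norm)
        show "integrable lborel (\<lambda>x. B * norm (f (x - v n) - f x))"
          using tr f by auto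
        show "cmod (f x * cnj (f (x - v n) - f x)) \<le> B * norm (f (x - v n) - f x)" for x
          using B by (simp only: norm_mult complex_mod_cnj) (intro mult_right_mono, auto)
      qed
      finally show "norm (A (v n) - A 0) \<le> B * (LINT x|lborel. norm (f (x - v n) - f x))"
        by simp
    qed
  qed
  define L where "L n = (LINT p|lborel. exp (- (norm (e n *\<^sub>R p))\<^sup>2 / 2) * (cmod (fourier_integral f p))\<^sup>2)" for n
  have int_n: "integrable lborel (\<lambda>p. exp (- (norm (e n *\<^sub>R p))\<^sup>2 / 2) * (cmod (fourier_integral f p))\<^sup>2)" for n
  proof (rule Bochner_Integration.integrable_bound)
    show "integrable lborel (\<lambda>p::real^3. C\<^sup>2 * exp (- (norm (e n *\<^sub>R p))\<^sup>2 / 2))"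
      using fourier_integral_gaussian(2)[OF e(1), of n] by (subst (asm) complex_of_real_integrable_eq) simp
    have "(cmod (fourier_integral f p))\<^sup>2 \<le> C\<^sup>2" for p
      by (intro power_mono FIle) simp
    then show "AE p in lborel. norm (exp (- (norm (e n *\<^sub>R p))\<^sup>2 / 2) * (cmod (fourier_integral f p))\<^sup>2)
        \<le> norm (C\<^sup>2 * exp (- (norm (e n *\<^sub>R p))\<^sup>2 / 2))"
      by (intro AE_I2) (simp add: mult.commute)
  qed measurable
  have L_eq: "complex_of_real (L n) = (LINT z|lborel. complex_of_real (\<gamma> z) * A (e n *\<^sub>R z))" for n
    unfolding L_def integral_complex_of_real[symmetric] \<gamma>_def A_def
    by (rule fourier_gauss_identity[OF f B e(1)])
  have "(\<lambda>n. complex_of_real (L n)) \<longlonglongrightarrow> (LINT z|lborel. complex_of_real (\<gamma> z) * A 0)"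
    unfolding L_eq
  proof (rule integral_dominated_convergence)
    show "integrable lborel (\<lambda>z. \<gamma> z * (B * (LINT x|lborel. cmod (f x))))"
      using \<gamma>_int by simp
    show "AE z in lborel. (\<lambda>n. complex_of_real (\<gamma> z) * A (e n *\<^sub>R z)) \<longlonglongrightarrow> complex_of_real (\<gamma> z) * A 0"
      using e(2) by (intro AE_I2 tendsto_intros A_lim) (auto intro!: tendsto_eq_intros)
    show "AE z in lborel. norm (complex_of_real (\<gamma> z) * A (e n *\<^sub>R z)) \<le> \<gamma> z * (B * (LINT x|lborel. cmod (f x)))" for n
      using A_le by (intro AE_I2) (auto simp: norm_mult \<gamma>_def intro!: mult_left_mono)
  qed (auto simp: \<gamma>_def)
  also have "(LINT z|lborel. complex_of_real (\<gamma> z) * A 0) = complex_of_real (LINT x|lborel. (cmod (f x))\<^sup>2)"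
    using \<gamma>_1 \<gamma>_int by (simp add: A0)
  finally have L_lim: "L \<longlonglongrightarrow> (LINT x|lborel. (cmod (f x))\<^sup>2)"
    by (simp add: tendsto_of_real_iff)
  have mono: "AE p in lborel. mono (\<lambda>n. exp (- (norm (e n *\<^sub>R p))\<^sup>2 / 2) * (cmod (fourier_integral f p))\<^sup>2)"
  proof (intro AE_I2 monoI mult_right_mono)
    fix p :: "real^3" and m n :: nat assume "m \<le> n"
    then have "e n \<le> e m" by (simp add: e_def frac_le)
    then have "(norm (e n *\<^sub>R p))\<^sup>2 \<le> (norm (e m *\<^sub>R p))\<^sup>2"
      using e(1)[of n] by (intro power_mono) (auto intro: mult_right_mono)
    then show "exp (- (norm (e m *\<^sub>R p))\<^sup>2 / 2) \<le> exp (- (norm (e n *\<^sub>R p))\<^sup>2 / 2)"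
      by simp
  qed simp
  have lim: "AE p in lborel. (\<lambda>n. exp (- (norm (e n *\<^sub>R p))\<^sup>2 / 2) * (cmod (fourier_integral f p))\<^sup>2)
      \<longlonglongrightarrow> (cmod (fourier_integral f p))\<^sup>2"
    using e(2) by (intro AE_I2) (auto intro!: tendsto_eq_intros)
  show "integrable lborel (\<lambda>p. (cmod (fourier_integral f p))\<^sup>2)"
    "(LINT p|lborel. (cmod (fourier_integral f p))\<^sup>2) = (LINT x|lborel. (cmod (f x))\<^sup>2)"
    using integrable_monotone_convergence[OF int_n mono lim L_lim[unfolded L_def]]
      integral_monotone_convergence[OF int_n mono lim L_lim[unfolded L_def]] by auto
qed

lemma borel_version:
  fixes \<phi> :: "real^3 \<Rightarrow> complex"
  assumes \<phi> [measurable]: "\<phi> \<in> borel_measurable lebesgue"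
  shows "\<exists>f. f \<in> borel_measurable borel \<and> (AE x in lebesgue. \<phi> x = f x)"
proof -
  have "(\<lambda>x. Re (\<phi> x)) \<in> borel_measurable lebesgue" "(\<lambda>x. Im (\<phi> x)) \<in> borel_measurable lebesgue"
    by measurable
  from this[THEN completion_ex_borel_measurable_real] obtain a b
    where [measurable]: "a \<in> borel_measurable lborel" "b \<in> borel_measurable lborel"
      and ab: "AE x in lborel. Re (\<phi> x) = a x" "AE x in lborel. Im (\<phi> x) = b x"
    by blast
  have "(\<lambda>x. Complex (a x) (b x)) \<in> borel_measurable borel"
    using \<open>a \<in> _\<close> \<open>b \<in> _\<close> by (simp add: Complex_eq)
  moreover have "AE x in lborel. \<phi> x = Complex (a x) (b x)"
    using ab by eventually_elim (simp add: complex_eq_iff)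
  ultimately show ?thesis
    using AE_completion by blast
qed

lemma borel_measurable_lebesgue_ident [measurable]: "(\<lambda>x. x) \<in> borel_measurable lebesgue"
  by (intro measurable_completion) simp

lemma fourier_integral_cong_AE:
  assumes [measurable]: "\<phi> \<in> borel_measurable lebesgue" and ae: "AE x in lebesgue. \<phi> x = \<psi> x"
  shows "fourier_integral \<phi> = fourier_integral \<psi>"
proof
  fix p
  have [measurable]: "\<psi> \<in> borel_measurable lebesgue"
    using assms by (rule borel_measurable_AE)
  show "fourier_integral \<phi> p = fourier_integral \<psi> p"
    unfolding fourier_integral_def
    by (intro arg_cong2[where f="(*)"] refl integral_cong_AE) (use ae in \<open>auto elim: eventually_mono\<close>)
qed

lemma integrable_fourier_integrand:
  assumes "integrable lebesgue \<phi>"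
  shows "integrable lebesgue (\<lambda>x. \<phi> x * exp (- \<i> * complex_of_real (p \<bullet> x)))"
proof -
  note [measurable] = borel_measurable_integrable[OF assms]
  show ?thesis
    by (rule Bochner_Integration.integrable_bound[OF assms]) (auto simp: norm_mult)
qed

lemma fourier_integral_add:
  assumes "integrable lebesgue \<phi>" "integrable lebesgue \<psi>"
  shows "fourier_integral (\<lambda>x. \<phi> x + \<psi> x) p = fourier_integral \<phi> p + fourier_integral \<psi> p"
  using assms[THEN integrable_fourier_integrand, of p]
  by (simp add: fourier_integral_def ring_distribs)

lemma fourier_integral_cmult:
  "fourier_integral (\<lambda>x. c * \<phi> x) p = c * fourier_integral \<phi> p"
  by (simp add: fourier_integral_def mult.assoc mult.left_commute)

lemma fourier_integral_diff:
  assumes "integrable lebesgue \<phi>" "integrable lebesgue \<psi>"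
  shows "fourier_integral (\<lambda>x. \<phi> x - \<psi> x) p = fourier_integral \<phi> p - fourier_integral \<psi> p"
  using assms[THEN integrable_fourier_integrand, of p]
  by (simp add: fourier_integral_def ring_distribs)

text \<open>The bridge between the completed measure of the statement and the Borel measure for
  which integrals are exchanged. Changing a null set leaves the Fourier integral unchanged at every
  point.\<close>

lemma L1_borel_version:
  fixes \<phi> :: "real^3 \<Rightarrow> complex"
  assumes "integrable lebesgue \<phi>"
  obtains f where "f \<in> borel_measurable borel" "integrable lborel f" "AE x in lebesgue. \<phi> x = f x"
    "fourier_integral \<phi> = fourier_integral f"
proof -
  note m [measurable] = borel_measurable_integrable[OF assms]
  obtain f where f [measurable]: "f \<in> borel_measurable borel" and ae: "AE x in lebesgue. \<phi> x = f x"
    using borel_version[OF m] by blast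
  have "integrable lebesgue f"
    by (rule integrable_cong_AE_imp[OF assms _ ae]) (use f in \<open>auto intro: measurable_completion\<close>)
  then have "integrable lborel f"
    by (subst (asm) integrable_completion) auto
  then show ?thesis
    using f ae fourier_integral_cong_AE[OF m ae] that by blast
qed

lemma fourier_integral_measurable:
  assumes "integrable lebesgue \<phi>"
  shows "fourier_integral \<phi> \<in> borel_measurable lebesgue"
proof -
  obtain f where "f \<in> borel_measurable borel" "fourier_integral \<phi> = fourier_integral f"
    using assms by (rule L1_borel_version)
  then show ?thesis
    using fourier_integral_measurable_borel[of f] by (simp add: measurable_completion)
qed

lemma norm_fourier_integral_le_L1:
  assumes "integrable lebesgue \<phi>"
  shows "cmod (fourier_integral \<phi> p) \<le> (2 * pi) powr (- 3 / 2) * (LINT x|lebesgue. cmod (\<phi> x))"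
proof -
  have "cmod (LINT x|lebesgue. \<phi> x * exp (- \<i> * complex_of_real (p \<bullet> x)))
      \<le> (LINT x|lebesgue. cmod (\<phi> x * exp (- \<i> * complex_of_real (p \<bullet> x))))"
    by (rule integral_norm_bound)
  then show ?thesis
    unfolding fourier_integral_def by (simp add: norm_mult)
qed

lemma plancherel_bounded_lebesgue:
  assumes \<phi>: "integrable lebesgue \<phi>" and B: "\<And>x. cmod (\<phi> x) \<le> B"
  shows "square_integrable (fourier_integral \<phi>)" and "l2n (fourier_integral \<phi>) = l2n \<phi>"
proof -
  obtain f where f [measurable]: "f \<in> borel_measurable borel" and f_int: "integrable lborel f"
    and ae: "AE x in lebesgue. \<phi> x = f x" and FI: "fourier_integral \<phi> = fourier_integral f"
    using \<phi> by (rule L1_borel_version)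
  \<comment> \<open>The Borel representative may exceed \<open>B\<close> on the exceptional null
    set; truncation restores the bound at every point.\<close>
  define f' where "f' x = (if cmod (f x) \<le> B then f x else 0)" for x
  have f' [measurable]: "f' \<in> borel_measurable borel"
    unfolding f'_def by measurable
  have f'_int: "integrable lborel f'"
    by (rule Bochner_Integration.integrable_bound[OF f_int]) (auto simp: f'_def)
  have f'_B: "cmod (f' x) \<le> B" for x
    using order_trans[OF norm_ge_zero B] by (auto simp: f'_def)
  have ae': "AE x in lebesgue. \<phi> x = f' x"
    using ae by eventually_elim (metis B f'_def)
  have FI': "fourier_integral \<phi> = fourier_integral f'"
    by (rule fourier_integral_cong_AE[OF borel_measurable_integrable[OF \<phi>] ae'])
  note m [measurable] = fourier_integral_measurable_borel[OF f']
  show "square_integrable (fourier_integral \<phi>)"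
    unfolding FI' square_integrable_def
    using m plancherel_bounded(1)[OF f'_int f'_B]
    by (auto intro!: measurable_completion simp: integrable_completion)
  have "l2n (fourier_integral \<phi>) = l2n f'"
    unfolding FI' l2n_def using plancherel_bounded(2)[OF f'_int f'_B] by (simp add: integral_completion)
  also have "\<dots> = l2n \<phi>"
    using l2n_cong_AE[OF borel_measurable_integrable[OF \<phi>] ae'] .
  finally show "l2n (fourier_integral \<phi>) = l2n \<phi>" .
qed

text \<open>Truncating the values of \<open>\<phi>\<close> gives bounded integrable functions that
  converge to it in \<open>L\<^sup>2\<close>, with transforms that converge pointwise. Fatou yields
  an inequality, and that inequality for the differences upgrades the limit to an equality of
  norms.\<close>

lemma plancherel_L1_L2:
  assumes \<phi>: "integrable lebesgue \<phi>" and sq: "square_integrable \<phi>"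
  shows "square_integrable (fourier_integral \<phi>)" and "l2n (fourier_integral \<phi>) = l2n \<phi>"
proof -
  \<comment> \<open>Stated for every \<open>\<phi>\<close>, because it is applied again to
    \<open>f n - \<phi>\<close>.\<close>
  have half: "square_integrable (fourier_integral \<phi>) \<and> l2n (fourier_integral \<phi>) \<le> l2n \<phi> \<and>
      (\<exists>f. (\<forall>n. integrable lebesgue (f n) \<and> square_integrable (f n) \<and> l2n (fourier_integral (f n)) = l2n (f n) \<and>
        square_integrable (fourier_integral (f n))) \<and>
        (\<lambda>n::nat. l2n (\<lambda>x. f n x - \<phi> x)) \<longlonglongrightarrow> 0)"
    if \<phi>: "integrable lebesgue \<phi>" and sq: "square_integrable \<phi>" for \<phi>
  proof -
    note [measurable] = borel_measurable_integrable[OF \<phi>] fourier_integral_measurable[OF \<phi>]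
    define f where "f n x = (if cmod (\<phi> x) \<le> real n then \<phi> x else 0)" for n x
    have [measurable]: "f n \<in> borel_measurable lebesgue" for n
      unfolding f_def by measurable
    have int: "integrable lebesgue (f n)" for n
      by (rule Bochner_Integration.integrable_bound[OF \<phi>]) (auto simp: f_def)
    have sqf: "square_integrable (f n)" "l2n (f n) \<le> l2n \<phi>" for n
      using square_integrable_bound[OF sq, of "f n" 1] by (auto simp: f_def)
    have "cmod (f n x) \<le> real n" for n x
      by (simp add: f_def)
    note pl = plancherel_bounded_lebesgue[OF int this]
    have ev: "\<forall>\<^sub>F n in sequentially. f n x = \<phi> x" for x
      using eventually_ge_at_top[of "nat \<lceil>cmod (\<phi> x)\<rceil>"]
      by eventually_elim (auto simp: f_def nat_le_iff ceiling_le_iff)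
    have lim: "(\<lambda>n. fourier_integral (f n) p) \<longlonglongrightarrow> fourier_integral \<phi> p" for p
      unfolding fourier_integral_def
    proof (intro tendsto_intros integral_dominated_convergence)
      show "integrable lebesgue (\<lambda>x. cmod (\<phi> x))"
        using \<phi> by simp
      show "AE x in lebesgue. (\<lambda>n. f n x * exp (- \<i> * complex_of_real (p \<bullet> x))) \<longlonglongrightarrow>
          \<phi> x * exp (- \<i> * complex_of_real (p \<bullet> x))"
        using ev by (intro AE_I2 tendsto_intros tendsto_eventually) auto
      show "AE x in lebesgue. norm (f n x * exp (- \<i> * complex_of_real (p \<bullet> x))) \<le> cmod (\<phi> x)" for n
        by (intro AE_I2) (auto simp: f_def norm_mult)
    qed measurable
    have "(\<lambda>n. LINT x|lebesgue. (cmod (f n x - \<phi> x))\<^sup>2) \<longlonglongrightarrow> (LINT x::real^3|lebesgue. 0)"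
    proof (rule integral_dominated_convergence)
      show "integrable lebesgue (\<lambda>x. (cmod (\<phi> x))\<^sup>2)"
        using sq by (rule square_integrable_integrable)
      show "AE x in lebesgue. (\<lambda>n. (cmod (f n x - \<phi> x))\<^sup>2) \<longlonglongrightarrow> 0"
        using ev by (intro AE_I2 tendsto_eventually) (auto elim: eventually_mono)
      show "AE x in lebesgue. norm ((cmod (f n x - \<phi> x))\<^sup>2) \<le> (cmod (\<phi> x))\<^sup>2" for n
        by (intro AE_I2) (auto simp: f_def)
    qed measurable
    then have "(\<lambda>n. (l2n (\<lambda>x. f n x - \<phi> x))\<^sup>2) \<longlonglongrightarrow> 0"
      by (simp add: l2n_power2)
    from tendsto_real_sqrt[OF this] have l2lim: "(\<lambda>n. l2n (\<lambda>x. f n x - \<phi> x)) \<longlonglongrightarrow> 0"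
      by simp
    have "\<forall>\<^sub>F n in sequentially. l2n (fourier_integral (f n)) \<le> l2n \<phi>"
      using sqf pl by simp
    from l2_Fatou[OF pl(1) _ AE_I2[OF lim] this]
    have "square_integrable (fourier_integral \<phi>)" "l2n (fourier_integral \<phi>) \<le> l2n \<phi>"
      by auto
    then show ?thesis
      using int sqf pl l2lim by blast
  qed
  then obtain f :: "nat \<Rightarrow> real^3 \<Rightarrow> complex"
    where f: "\<And>n. integrable lebesgue (f n)" "\<And>n. square_integrable (f n)"
      "\<And>n. l2n (fourier_integral (f n)) = l2n (f n)" "\<And>n. square_integrable (fourier_integral (f n))"
      and lim: "(\<lambda>n. l2n (\<lambda>x. f n x - \<phi> x)) \<longlonglongrightarrow> 0"
    using half[OF assms] by blast
  show sqF: "square_integrable (fourier_integral \<phi>)"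
    using half[OF assms] by blast
  have "(\<lambda>n. l2n (f n)) \<longlonglongrightarrow> l2n \<phi>"
  proof (rule Lim_null_comparison[THEN LIM_zero_cancel, OF _ lim], intro always_eventually allI)
    show "norm (l2n (f n) - l2n \<phi>) \<le> l2n (\<lambda>x. f n x - \<phi> x)" for n
      using l2n_diff_abs_le[OF f(2) sq] by simp
  qed
  moreover have "(\<lambda>n. l2n (f n)) \<longlonglongrightarrow> l2n (fourier_integral \<phi>)"
  proof (rule Lim_null_comparison[THEN LIM_zero_cancel, OF _ lim], intro always_eventually allI)
    fix n
    have "fourier_integral (\<lambda>x. f n x - \<phi> x) = (\<lambda>p. fourier_integral (f n) p - fourier_integral \<phi> p)"
      using fourier_integral_diff[OF f(1) \<phi>] by blast
    then have "l2n (\<lambda>p. fourier_integral (f n) p - fourier_integral \<phi> p) \<le> l2n (\<lambda>x. f n x - \<phi> x)"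
      using half[OF Bochner_Integration.integrable_diff[OF f(1) \<phi>] square_integrable_diff[OF f(2) sq], of n]
      by simp
    then show "norm (l2n (f n) - l2n (fourier_integral \<phi>)) \<le> l2n (\<lambda>x. f n x - \<phi> x)"
      using l2n_diff_abs_le[OF f(4) sqF, of n] f(3)[of n] by simp
  qed
  ultimately show "l2n (fourier_integral \<phi>) = l2n \<phi>"
    by (rule LIMSEQ_unique[symmetric])
qed

section \<open>The Fourier transform on square-integrable functions\<close>

text \<open>The truncation that occurs inside \<open>has_fourier_L2\<close>. It acts on the
  variable, so the result is integrable merely because balls have finite measure.\<close>

definition cutoff :: "real \<Rightarrow> (real^3 \<Rightarrow> complex) \<Rightarrow> real^3 \<Rightarrow> complex" where
  "cutoff R \<phi> = (\<lambda>x. if norm x \<le> R then \<phi> x else 0)"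

lemma cutoff_square_integrable:
  assumes "square_integrable \<phi>"
  shows "square_integrable (cutoff R \<phi>)" and "integrable lebesgue (cutoff R \<phi>)"
proof -
  note [measurable] = square_integrable_measurable[OF assms]
  have [measurable]: "cutoff R \<phi> \<in> borel_measurable lebesgue"
    unfolding cutoff_def by measurable
  show "square_integrable (cutoff R \<phi>)"
    using square_integrable_bound(1)[OF assms, of "cutoff R \<phi>" 1] by (auto simp: cutoff_def)
  have "integrable lebesgue (\<lambda>x::real^3. indicator (cball 0 R) x :: real)"
    using lmeasurable_cball[of 0 R] by (auto simp: fmeasurable_def)
  from Bochner_Integration.integrable_add[OF this square_integrable_integrable[OF assms]]
  show "integrable lebesgue (cutoff R \<phi>)"
  proof (rule Bochner_Integration.integrable_bound)
    have "a \<le> 1 + a\<^sup>2" for a :: real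
      using zero_le_power2[of "a - 1 / 2"] unfolding power2_diff by (simp add: power2_eq_square)
    then show "AE x in lebesgue. norm (cutoff R \<phi> x) \<le> norm (indicator (cball 0 R) x + (norm (\<phi> x))\<^sup>2)"
      by (intro AE_I2) (auto simp: cutoff_def)
  qed measurable
qed

lemma cutoff_tendsto:
  assumes sq: "square_integrable \<phi>"
  shows "((\<lambda>R. l2n (\<lambda>x. cutoff R \<phi> x - \<phi> x)) \<longlongrightarrow> 0) at_top"
proof -
  note [measurable] = square_integrable_measurable[OF assms]
  have [measurable]: "cutoff R \<phi> \<in> borel_measurable lebesgue" for R
    unfolding cutoff_def by measurable
  have "((\<lambda>R. LINT x|lebesgue. (cmod (cutoff R \<phi> x - \<phi> x))\<^sup>2) \<longlongrightarrow> (LINT x::real^3|lebesgue. 0)) at_top"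
  proof (rule integral_dominated_convergence_at_top)
    show "integrable lebesgue (\<lambda>x. (cmod (\<phi> x))\<^sup>2)"
      using sq by (rule square_integrable_integrable)
    show "AE x in lebesgue. ((\<lambda>R. (cmod (cutoff R \<phi> x - \<phi> x))\<^sup>2) \<longlongrightarrow> 0) at_top"
    proof (intro AE_I2 tendsto_eventually)
      fix x :: "real^3"
      show "\<forall>\<^sub>F R in at_top. (cmod (cutoff R \<phi> x - \<phi> x))\<^sup>2 = 0"
        using eventually_ge_at_top[of "norm x"] by eventually_elim (simp add: cutoff_def)
    qed
    show "\<forall>\<^sub>F R in at_top. AE x in lebesgue. norm ((cmod (cutoff R \<phi> x - \<phi> x))\<^sup>2) \<le> (cmod (\<phi> x))\<^sup>2"
      by (intro always_eventually allI AE_I2) (auto simp: cutoff_def)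
  qed measurable
  then have "((\<lambda>R. (l2n (\<lambda>x. cutoff R \<phi> x - \<phi> x))\<^sup>2) \<longlongrightarrow> 0) at_top"
    by (simp add: l2n_power2)
  from tendsto_real_sqrt[OF this] show ?thesis
    by simp
qed

lemma fourier_cutoff:
  assumes "square_integrable \<phi>"
  shows "square_integrable (fourier_integral (cutoff R \<phi>))"
    and "l2n (\<lambda>p. fourier_integral (cutoff R \<phi>) p - fourier_integral (cutoff S \<phi>) p)
      = l2n (\<lambda>x. cutoff R \<phi> x - cutoff S \<phi> x)"
proof -
  note c = cutoff_square_integrable[OF assms]
  show "square_integrable (fourier_integral (cutoff R \<phi>))"
    using plancherel_L1_L2(1)[OF c(2,1)] .
  have "fourier_integral (\<lambda>x. cutoff R \<phi> x - cutoff S \<phi> x)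
      = (\<lambda>p. fourier_integral (cutoff R \<phi>) p - fourier_integral (cutoff S \<phi>) p)"
    using fourier_integral_diff[OF c(2) c(2)] by blast
  then show "l2n (\<lambda>p. fourier_integral (cutoff R \<phi>) p - fourier_integral (cutoff S \<phi>) p)
      = l2n (\<lambda>x. cutoff R \<phi> x - cutoff S \<phi> x)"
    using plancherel_L1_L2(2)[OF Bochner_Integration.integrable_diff[OF c(2) c(2)]
        square_integrable_diff[OF c(1) c(1)], of R S] by simp
qed

text \<open>Replaces the extended integral of the definition by the real number \<open>l2n\<close>,
  so that triangle inequalities become available.\<close>

lemma has_fourier_L2_iff:
  "has_fourier_L2 \<phi> \<psi> \<longleftrightarrow> square_integrable \<phi> \<and> square_integrable \<psi> \<and>
     ((\<lambda>R. l2n (\<lambda>p. \<psi> p - fourier_integral (cutoff R \<phi>) p)) \<longlongrightarrow> 0) at_top"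
proof (cases "square_integrable \<phi> \<and> square_integrable \<psi>")
  case True
  then have sq: "square_integrable (\<lambda>p. \<psi> p - fourier_integral (cutoff R \<phi>) p)" for R
    using fourier_cutoff(1) square_integrable_diff by blast
  define l where "l R = l2n (\<lambda>p. \<psi> p - fourier_integral (cutoff R \<phi>) p)" for R
  have "((\<lambda>R. \<integral>\<^sup>+ p. ennreal ((cmod (\<psi> p - fourier_integral (cutoff R \<phi>) p))\<^sup>2) \<partial>lebesgue) \<longlongrightarrow> 0) at_top
      \<longleftrightarrow> ((\<lambda>R. ennreal ((l R)\<^sup>2)) \<longlongrightarrow> ennreal 0) at_top"
    by (simp add: nn_integral_eq_l2n[OF sq] l_def)
  also have "\<dots> \<longleftrightarrow> ((\<lambda>R. (l R)\<^sup>2) \<longlongrightarrow> 0) at_top"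
    by (subst tendsto_ennreal_iff) auto
  also have "\<dots> \<longleftrightarrow> (l \<longlongrightarrow> 0) at_top"
  proof
    assume "((\<lambda>R. (l R)\<^sup>2) \<longlongrightarrow> 0) at_top"
    from tendsto_real_sqrt[OF this] show "(l \<longlongrightarrow> 0) at_top"
      by (simp add: l_def[abs_def])
  next
    assume "(l \<longlongrightarrow> 0) at_top"
    from tendsto_power[OF this, of 2] show "((\<lambda>R. (l R)\<^sup>2) \<longlongrightarrow> 0) at_top"
      by simp
  qed
  finally show ?thesis
    using True by (simp add: has_fourier_L2_def cutoff_def l_def[abs_def])
qed (auto simp: has_fourier_L2_def)

lemma has_fourier_L2_square_integrable:
  assumes "has_fourier_L2 \<phi> \<psi>"
  shows "square_integrable \<phi>" "square_integrable \<psi>"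
  using assms by (auto simp: has_fourier_L2_def)

lemma has_fourier_L2_limit:
  assumes "has_fourier_L2 \<phi> \<psi>"
  shows "(\<lambda>n. l2n (\<lambda>x. cutoff (real n) \<phi> x - \<phi> x)) \<longlonglongrightarrow> 0"
    and "(\<lambda>n. l2n (\<lambda>p. fourier_integral (cutoff (real n) \<phi>) p - \<psi> p)) \<longlonglongrightarrow> 0"
proof -
  note sq = has_fourier_L2_square_integrable[OF assms]
  show "(\<lambda>n. l2n (\<lambda>x. cutoff (real n) \<phi> x - \<phi> x)) \<longlonglongrightarrow> 0"
    by (rule filterlim_compose[OF cutoff_tendsto[OF sq(1)] filterlim_real_sequentially])
  have "((\<lambda>R. l2n (\<lambda>p. \<psi> p - fourier_integral (cutoff R \<phi>) p)) \<longlongrightarrow> 0) at_top"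
    using assms by (simp add: has_fourier_L2_iff)
  from filterlim_compose[OF this filterlim_real_sequentially]
  show "(\<lambda>n. l2n (\<lambda>p. fourier_integral (cutoff (real n) \<phi>) p - \<psi> p)) \<longlonglongrightarrow> 0"
    by (simp only: l2n_minus_commute[of \<psi>])
qed

text \<open>The transforms of the truncations form a Cauchy sequence by isometry, so completeness
  provides the limit.\<close>

lemma fourier_L2_exists:
  assumes sq: "square_integrable \<phi>"
  shows "\<exists>\<psi>. has_fourier_L2 \<phi> \<psi>"
proof -
  define c where "c n = cutoff (real n) \<phi>" for n
  have lim: "(\<lambda>n. l2n (\<lambda>x. c n x - \<phi> x)) \<longlonglongrightarrow> 0"
    unfolding c_def by (rule filterlim_compose[OF cutoff_tendsto[OF sq] filterlim_real_sequentially])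
  note cs = cutoff_square_integrable(1)[OF sq]
  note F = fourier_cutoff[OF sq]
  have "\<exists>\<psi>. square_integrable \<psi> \<and> (\<lambda>n. l2n (\<lambda>x. fourier_integral (c n) x - \<psi> x)) \<longlonglongrightarrow> 0"
  proof (rule l2_complete)
    show "square_integrable (fourier_integral (c n))" for n
      unfolding c_def by (rule F)
    fix e :: real assume "0 < e"
    then obtain K where K: "\<And>n. n \<ge> K \<Longrightarrow> l2n (\<lambda>x. c n x - \<phi> x) < e / 2"
      using order_tendstoD(2)[OF lim, of "e / 2"] by (auto simp: eventually_sequentially)
    have "l2n (\<lambda>x. fourier_integral (c m) x - fourier_integral (c n) x) < e" if "m \<ge> K" "n \<ge> K" for m n
      using l2n_triangle_mid[OF cs cs sq, of m n] K[OF that(1)] K[OF that(2)]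
      by (simp add: F c_def l2n_minus_commute[of \<phi>])
    then show "\<exists>K. \<forall>m\<ge>K. \<forall>n\<ge>K. l2n (\<lambda>x. fourier_integral (c m) x - fourier_integral (c n) x) < e"
      by blast
  qed
  then obtain \<psi> where \<psi>: "square_integrable \<psi>"
    and \<psi>_lim: "(\<lambda>n. l2n (\<lambda>x. fourier_integral (c n) x - \<psi> x)) \<longlonglongrightarrow> 0"
    by blast
  \<comment> \<open>Completeness was used along integer radii only. Letting \<open>n\<close> tend to
    infinity in the triangle inequality gives a bound for every real radius \<open>R\<close>, as the
    definition demands.\<close>
  have "l2n (\<lambda>p. \<psi> p - fourier_integral (cutoff R \<phi>) p) \<le> l2n (\<lambda>x. cutoff R \<phi> x - \<phi> x)" for R
  proof (rule tendsto_lowerbound)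
    show "(\<lambda>n. l2n (\<lambda>x. fourier_integral (c n) x - \<psi> x) +
        (l2n (\<lambda>x. c n x - \<phi> x) + l2n (\<lambda>x. cutoff R \<phi> x - \<phi> x))) \<longlonglongrightarrow> l2n (\<lambda>x. cutoff R \<phi> x - \<phi> x)"
      using lim \<psi>_lim by (auto intro!: tendsto_eq_intros)
    show "\<forall>\<^sub>F n in sequentially. l2n (\<lambda>p. \<psi> p - fourier_integral (cutoff R \<phi>) p) \<le>
        l2n (\<lambda>x. fourier_integral (c n) x - \<psi> x) + (l2n (\<lambda>x. c n x - \<phi> x) + l2n (\<lambda>x. cutoff R \<phi> x - \<phi> x))"
    proof (intro always_eventually allI)
      fix n
      show "l2n (\<lambda>p. \<psi> p - fourier_integral (cutoff R \<phi>) p) \<le>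
        l2n (\<lambda>x. fourier_integral (c n) x - \<psi> x) + (l2n (\<lambda>x. c n x - \<phi> x) + l2n (\<lambda>x. cutoff R \<phi> x - \<phi> x))"
        using l2n_triangle_mid[OF \<psi> F(1)[of R] F(1)[of "real n"]] F(2)[of "real n" R]
          l2n_triangle_mid[OF cs[of "real n"] cs[of R] sq]
        by (simp add: c_def l2n_minus_commute[of \<psi>] l2n_minus_commute[of \<phi>])
    qed
  qed simp
  then have "((\<lambda>R. l2n (\<lambda>p. \<psi> p - fourier_integral (cutoff R \<phi>) p)) \<longlongrightarrow> 0) at_top"
    using cutoff_tendsto[OF sq]
    by (intro tendsto_sandwich[OF _ _ tendsto_const cutoff_tendsto[OF sq]]) auto
  then show ?thesis
    using sq \<psi> by (auto simp: has_fourier_L2_iff)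
qed

lemma plancherel:
  assumes "has_fourier_L2 \<phi> \<psi>"
  shows "l2n \<psi> = l2n \<phi>"
proof -
  note sq = has_fourier_L2_square_integrable[OF assms]
  note cs = cutoff_square_integrable[OF sq(1)]
  have 1: "(\<lambda>n. l2n (cutoff (real n) \<phi>)) \<longlonglongrightarrow> l2n \<phi>"
  proof (rule Lim_null_comparison[THEN LIM_zero_cancel, OF _ has_fourier_L2_limit(1)[OF assms]], intro always_eventually allI)
    show "norm (l2n (cutoff (real n) \<phi>) - l2n \<phi>) \<le> l2n (\<lambda>x. cutoff (real n) \<phi> x - \<phi> x)" for n
      using l2n_diff_abs_le[OF cs(1) sq(1)] by simp
  qed
  have 2: "(\<lambda>n. l2n (cutoff (real n) \<phi>)) \<longlonglongrightarrow> l2n \<psi>"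
  proof (rule Lim_null_comparison[THEN LIM_zero_cancel, OF _ has_fourier_L2_limit(2)[OF assms]], intro always_eventually allI)
    show "norm (l2n (cutoff (real n) \<phi>) - l2n \<psi>) \<le> l2n (\<lambda>x. fourier_integral (cutoff (real n) \<phi>) x - \<psi> x)" for n
      using l2n_diff_abs_le[OF fourier_cutoff(1)[OF sq(1)] sq(2), of "real n"] plancherel_L1_L2(2)[OF cs(2) cs(1), of "real n"]
      by simp
  qed
  show ?thesis
    using LIMSEQ_unique[OF 2 1] .
qed

lemma has_fourier_L2_add:
  assumes "has_fourier_L2 \<phi> \<psi>" "has_fourier_L2 \<phi>' \<psi>'"
  shows "has_fourier_L2 (\<lambda>x. \<phi> x + \<phi>' x) (\<lambda>p. \<psi> p + \<psi>' p)"
  unfolding has_fourier_L2_iff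
proof (intro conjI)
  note sq = assms[THEN has_fourier_L2_square_integrable(1)] assms[THEN has_fourier_L2_square_integrable(2)]
  show "square_integrable (\<lambda>x. \<phi> x + \<phi>' x)" "square_integrable (\<lambda>p. \<psi> p + \<psi>' p)"
    using sq by (auto intro: square_integrable_add)
  note cs = cutoff_square_integrable(2)[OF sq(1)] cutoff_square_integrable(2)[OF sq(2)]
  have eq: "fourier_integral (cutoff R (\<lambda>x. \<phi> x + \<phi>' x)) p
      = fourier_integral (cutoff R \<phi>) p + fourier_integral (cutoff R \<phi>') p" for R p
    unfolding fourier_integral_add[OF cs, symmetric] by (simp add: cutoff_def if_distrib cong: if_cong)
  show "((\<lambda>R. l2n (\<lambda>p. \<psi> p + \<psi>' p - fourier_integral (cutoff R (\<lambda>x. \<phi> x + \<phi>' x)) p)) \<longlongrightarrow> 0) at_top"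
  proof (rule tendsto_sandwich[OF _ _ tendsto_const])
    show "((\<lambda>R. l2n (\<lambda>p. \<psi> p - fourier_integral (cutoff R \<phi>) p)
      + l2n (\<lambda>p. \<psi>' p - fourier_integral (cutoff R \<phi>') p)) \<longlongrightarrow> 0) at_top"
      using assms by (auto simp: has_fourier_L2_iff intro!: tendsto_eq_intros)
    show "\<forall>\<^sub>F R in at_top. l2n (\<lambda>p. \<psi> p + \<psi>' p - fourier_integral (cutoff R (\<lambda>x. \<phi> x + \<phi>' x)) p)
        \<le> l2n (\<lambda>p. \<psi> p - fourier_integral (cutoff R \<phi>) p) + l2n (\<lambda>p. \<psi>' p - fourier_integral (cutoff R \<phi>') p)"
    proof (intro always_eventually allI)
      fix R
      show "l2n (\<lambda>p. \<psi> p + \<psi>' p - fourier_integral (cutoff R (\<lambda>x. \<phi> x + \<phi>' x)) p)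
        \<le> l2n (\<lambda>p. \<psi> p - fourier_integral (cutoff R \<phi>) p) + l2n (\<lambda>p. \<psi>' p - fourier_integral (cutoff R \<phi>') p)"
        using l2n_triangle[OF square_integrable_diff[OF sq(3) fourier_cutoff(1)[OF sq(1)]]
            square_integrable_diff[OF sq(4) fourier_cutoff(1)[OF sq(2)]], of R R]
        by (simp add: eq algebra_simps)
    qed
  qed simp
qed

lemma has_fourier_L2_cmult:
  assumes "has_fourier_L2 \<phi> \<psi>"
  shows "has_fourier_L2 (\<lambda>x. c * \<phi> x) (\<lambda>p. c * \<psi> p)"
  unfolding has_fourier_L2_iff
proof (intro conjI)
  note sq = has_fourier_L2_square_integrable[OF assms]
  have *: "square_integrable (\<lambda>x. c * \<theta> x)" if "square_integrable \<theta>" for \<theta>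
    using square_integrable_bound(1)[OF that, of "\<lambda>x. c * \<theta> x" "cmod c"] square_integrable_measurable[OF that]
    by (simp add: norm_mult)
  show "square_integrable (\<lambda>x. c * \<phi> x)" "square_integrable (\<lambda>p. c * \<psi> p)"
    using sq * by auto
  have eq: "fourier_integral (cutoff R (\<lambda>x. c * \<phi> x)) p = c * fourier_integral (cutoff R \<phi>) p" for R p
    unfolding fourier_integral_cmult[symmetric] by (simp add: cutoff_def if_distrib cong: if_cong)
  have "l2n (\<lambda>p. c * \<psi> p - fourier_integral (cutoff R (\<lambda>x. c * \<phi> x)) p)
      = cmod c * l2n (\<lambda>p. \<psi> p - fourier_integral (cutoff R \<phi>) p)" for R
    by (simp add: eq l2n_def norm_mult power_mult_distrib real_sqrt_mult flip: right_diff_distrib)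
  then show "((\<lambda>R. l2n (\<lambda>p. c * \<psi> p - fourier_integral (cutoff R (\<lambda>x. c * \<phi> x)) p)) \<longlongrightarrow> 0) at_top"
    using assms by (auto simp: has_fourier_L2_iff intro!: tendsto_eq_intros)
qed

lemma has_fourier_L2_diff:
  assumes "has_fourier_L2 \<phi> \<psi>" "has_fourier_L2 \<phi>' \<psi>'"
  shows "has_fourier_L2 (\<lambda>x. \<phi> x - \<phi>' x) (\<lambda>p. \<psi> p - \<psi>' p)"
  using has_fourier_L2_add[OF assms(1) has_fourier_L2_cmult[OF assms(2), of "- 1"]] by simp

lemma has_fourier_L2_cong_AE:
  assumes "has_fourier_L2 \<phi> \<psi>" "AE x in lebesgue. \<phi> x = \<phi>' x" "AE p in lebesgue. \<psi> p = \<psi>' p"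
  shows "has_fourier_L2 \<phi>' \<psi>'"
proof -
  note sq = has_fourier_L2_square_integrable[OF assms(1)]
  note [measurable] = sq[THEN square_integrable_measurable]
  have FI: "fourier_integral (cutoff R \<phi>) = fourier_integral (cutoff R \<phi>')" for R
    using assms(2) by (intro fourier_integral_cong_AE) (auto simp: cutoff_def elim: eventually_mono)
  have "l2n (\<lambda>p. \<psi> p - fourier_integral (cutoff R \<phi>) p) = l2n (\<lambda>p. \<psi>' p - fourier_integral (cutoff R \<phi>) p)" for R
    using square_integrable_measurable[OF fourier_cutoff(1)[OF sq(1)], of R] assms(3)
    by (intro l2n_cong_AE[symmetric]) (auto elim: eventually_mono)
  then show ?thesis
    using assms(1) square_integrable_cong_AE(1)[OF sq(1) assms(2)] square_integrable_cong_AE(1)[OF sq(2) assms(3)]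
    by (simp add: has_fourier_L2_iff FI)
qed

text \<open>Isometry applied to the difference. One direction says that the transform is well
  defined on classes, the other that it is injective.\<close>

lemma has_fourier_L2_unique:
  assumes "has_fourier_L2 \<phi> \<psi>" "has_fourier_L2 \<phi>' \<psi>'"
  shows "(AE x in lebesgue. \<phi> x = \<phi>' x) \<longleftrightarrow> (AE p in lebesgue. \<psi> p = \<psi>' p)"
  using plancherel[OF has_fourier_L2_diff[OF assms]]
    l2n_diff_eq_0_iff assms[THEN has_fourier_L2_square_integrable(1)] assms[THEN has_fourier_L2_square_integrable(2)]
  by metis

text \<open>Reconciles the two clauses of \<open>has_fourier\<close> on their common domain.\<close>

lemma has_fourier_L2_L1:
  assumes int: "integrable lebesgue \<phi>" and sq: "square_integrable \<phi>"
  shows "has_fourier_L2 \<phi> (fourier_integral \<phi>)"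
  unfolding has_fourier_L2_iff
proof (intro conjI sq plancherel_L1_L2(1)[OF assms])
  note c = cutoff_square_integrable[OF sq]
  have "l2n (\<lambda>p. fourier_integral \<phi> p - fourier_integral (cutoff R \<phi>) p) = l2n (\<lambda>x. cutoff R \<phi> x - \<phi> x)" for R
    using plancherel_L1_L2(2)[OF Bochner_Integration.integrable_diff[OF int c(2)] square_integrable_diff[OF sq c(1)], of R]
      fourier_integral_diff[OF int c(2)[of R]] by (simp add: l2n_minus_commute[of \<phi>] l2n_def)
  then show "((\<lambda>R. l2n (\<lambda>p. fourier_integral \<phi> p - fourier_integral (cutoff R \<phi>) p)) \<longlongrightarrow> 0) at_top"
    using cutoff_tendsto[OF sq] by simp
qed

lemma
  fixes \<phi> :: "real^3 \<Rightarrow> complex"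
  shows square_integrable_cnj: "square_integrable \<phi> \<Longrightarrow> square_integrable (\<lambda>x. cnj (\<phi> x))"
    and l2n_cnj [simp]: "l2n (\<lambda>x. cnj (\<phi> x)) = l2n \<phi>"
  by (auto simp: square_integrable_def l2n_def)

lemma fourier_integral_multiplication_lebesgue:
  assumes \<phi>: "integrable lebesgue \<phi>" and \<theta>: "integrable lebesgue \<theta>"
  shows "(LINT p|lebesgue. fourier_integral \<phi> p * \<theta> p) = (LINT x|lebesgue. \<phi> x * fourier_integral \<theta> x)"
proof -
  obtain f where f [measurable]: "f \<in> borel_measurable borel" and f_int: "integrable lborel f"
    and f_ae: "AE x in lebesgue. \<phi> x = f x" and FIf: "fourier_integral \<phi> = fourier_integral f"
    using \<phi> by (rule L1_borel_version)
  obtain h where h [measurable]: "h \<in> borel_measurable borel" and h_int: "integrable lborel h"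
    and h_ae: "AE x in lebesgue. \<theta> x = h x" and FIh: "fourier_integral \<theta> = fourier_integral h"
    using \<theta> by (rule L1_borel_version)
  note [measurable] = fourier_integral_measurable_borel[OF f] fourier_integral_measurable_borel[OF h]
    borel_measurable_integrable[OF \<phi>] borel_measurable_integrable[OF \<theta>]
  have [measurable]: "f \<in> borel_measurable lebesgue" "h \<in> borel_measurable lebesgue"
    "fourier_integral f \<in> borel_measurable lebesgue" "fourier_integral h \<in> borel_measurable lebesgue"
    by (auto intro!: measurable_completion)
  have "(LINT p|lebesgue. fourier_integral \<phi> p * \<theta> p) = (LINT p|lebesgue. fourier_integral f p * h p)"
    unfolding FIf using h_ae by (intro integral_cong_AE) (auto elim: eventually_mono)
  also have "\<dots> = (LINT x|lebesgue. f x * fourier_integral h x)"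
    using fourier_integral_multiplication[OF f_int h_int] by (simp add: integral_completion)
  also have "\<dots> = (LINT x|lebesgue. \<phi> x * fourier_integral \<theta> x)"
    unfolding FIh using f_ae by (intro integral_cong_AE) (auto elim: eventually_mono)
  finally show ?thesis .
qed

lemma inner_cnj_eq_Re_mult: "x \<bullet> cnj y = Re (x * y)"
  by (simp add: inner_complex_def)

lemma integrable_fourier_mult:
  assumes \<phi>: "integrable lebesgue \<phi>" and \<theta>: "integrable lebesgue \<theta>"
  shows "integrable lebesgue (\<lambda>p. fourier_integral \<phi> p * \<theta> p)"
proof -
  note [measurable] = fourier_integral_measurable[OF \<phi>] borel_measurable_integrable[OF \<theta>]
  define C where "C = (2 * pi) powr (- 3 / 2) * (LINT x|lebesgue. cmod (\<phi> x))"
  show ?thesis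
  proof (rule Bochner_Integration.integrable_bound)
    show "integrable lebesgue (\<lambda>p. complex_of_real C * \<theta> p)"
      using \<theta> by simp
    have "cmod (fourier_integral \<phi> p) \<le> \<bar>C\<bar>" for p
      using norm_fourier_integral_le_L1[OF \<phi>, of p] unfolding C_def by linarith
    then show "AE p in lebesgue. norm (fourier_integral \<phi> p * \<theta> p) \<le> norm (complex_of_real C * \<theta> p)"
      by (intro AE_I2) (auto simp: norm_mult intro!: mult_right_mono)
  qed measurable
qed

text \<open>Since \<open>x \<bullet> cnj y\<close> is the real part of \<open>x * y\<close>, this is
  the real part of the bilinear multiplication formula, extended from truncations by
  continuity.\<close>

lemma fourier_L2_adjoint:
  assumes a: "has_fourier_L2 a A" and b: "has_fourier_L2 b B"
  shows "(LINT p|lebesgue. A p \<bullet> cnj (b p)) = (LINT x|lebesgue. a x \<bullet> cnj (B x))"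
proof (rule LIMSEQ_unique)
  note sq = has_fourier_L2_square_integrable[OF a] has_fourier_L2_square_integrable[OF b]
  note c = cutoff_square_integrable[OF sq(1)] cutoff_square_integrable[OF sq(3)]
  define an where "an n = cutoff (real n) a" for n
  define bn where "bn n = cutoff (real n) b" for n
  have cnj_lim: "(\<lambda>n. l2n (\<lambda>x. cnj (f n x) - cnj (g x))) \<longlonglongrightarrow> 0" if "(\<lambda>n. l2n (\<lambda>x. f n x - g x)) \<longlonglongrightarrow> 0"
    for f :: "nat \<Rightarrow> real^3 \<Rightarrow> complex" and g
  proof -
    have "l2n (\<lambda>x. cnj (f n x) - cnj (g x)) = l2n (\<lambda>x. f n x - g x)" for n
      using l2n_cnj[of "\<lambda>x. f n x - g x"] by simp
    then show ?thesis
      using that by simp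
  qed
  show "(\<lambda>n. LINT p|lebesgue. fourier_integral (an n) p \<bullet> cnj (bn n p)) \<longlonglongrightarrow> (LINT p|lebesgue. A p \<bullet> cnj (b p))"
    unfolding an_def bn_def using sq c fourier_cutoff(1)[OF sq(1)] has_fourier_L2_limit[OF a] has_fourier_L2_limit[OF b]
    by (intro integral_inner_tendsto square_integrable_cnj cnj_lim) auto
  have "(LINT p|lebesgue. fourier_integral (an n) p \<bullet> cnj (bn n p)) = (LINT x|lebesgue. an n x \<bullet> cnj (fourier_integral (bn n) x))" for n
  proof -
    have i: "integrable lebesgue (an n)" "integrable lebesgue (bn n)"
      unfolding an_def bn_def using c by auto
    have "(LINT p|lebesgue. fourier_integral (an n) p \<bullet> cnj (bn n p)) = Re (LINT p|lebesgue. fourier_integral (an n) p * bn n p)"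
      unfolding inner_cnj_eq_Re_mult by (rule integral_Re[OF integrable_fourier_mult[OF i]])
    also have "\<dots> = Re (LINT x|lebesgue. an n x * fourier_integral (bn n) x)"
      using fourier_integral_multiplication_lebesgue[OF i] by simp
    also have "\<dots> = (LINT x|lebesgue. an n x \<bullet> cnj (fourier_integral (bn n) x))"
      unfolding inner_cnj_eq_Re_mult
      using integral_Re[OF integrable_fourier_mult[OF i(2,1)]] by (simp only: mult.commute)
    finally show ?thesis .
  qed
  moreover have "(\<lambda>n. LINT x|lebesgue. an n x \<bullet> cnj (fourier_integral (bn n) x)) \<longlonglongrightarrow> (LINT x|lebesgue. a x \<bullet> cnj (B x))"
    unfolding an_def bn_def using sq c fourier_cutoff(1)[OF sq(3)] has_fourier_L2_limit[OF a] has_fourier_L2_limit[OF b]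
    by (intro integral_inner_tendsto square_integrable_cnj cnj_lim) auto
  ultimately show "(\<lambda>n. LINT p|lebesgue. fourier_integral (an n) p \<bullet> cnj (bn n p)) \<longlonglongrightarrow> (LINT x|lebesgue. a x \<bullet> cnj (B x))"
    by simp
qed

text \<open>The inverse transform is the conjugate of the transform of the conjugate. Let
  \<open>\<zeta>\<close> be the transform of \<open>cnj (\<psi> p)\<close>: the adjoint identity
  makes its inner product with \<open>cnj (f x)\<close> equal to the squared norm of
  \<open>\<psi>\<close>, and all norms involved agree. Expanding the square of the difference gives
  0, so no pointwise inversion formula enters.\<close>

lemma fourier_L2_inversion:
  assumes f: "has_fourier_L2 f \<psi>"
  shows "has_fourier_L2 (\<lambda>p. cnj (\<psi> p)) (\<lambda>x. cnj (f x))"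
proof -
  note sq = has_fourier_L2_square_integrable[OF f]
  obtain \<zeta> where \<zeta>: "has_fourier_L2 (\<lambda>p. cnj (\<psi> p)) \<zeta>"
    using fourier_L2_exists[OF square_integrable_cnj[OF sq(2)]] by blast
  note sq\<zeta> = has_fourier_L2_square_integrable(2)[OF \<zeta>]
  have "(LINT x|lebesgue. \<zeta> x \<bullet> - cnj (f x)) = - (LINT x|lebesgue. \<zeta> x \<bullet> cnj (f x))"
    by simp
  also have "(LINT x|lebesgue. \<zeta> x \<bullet> cnj (f x)) = (LINT p|lebesgue. cnj (\<psi> p) \<bullet> cnj (\<psi> p))"
    by (rule fourier_L2_adjoint[OF \<zeta> f])
  also have "\<dots> = (l2n \<psi>)\<^sup>2"
    by (simp add: l2n_power2 flip: power2_norm_eq_inner)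
  finally have "(l2n (\<lambda>x. \<zeta> x + - cnj (f x)))\<^sup>2 = (l2n \<zeta>)\<^sup>2 + 2 * (- (l2n \<psi>)\<^sup>2) + (l2n f)\<^sup>2"
    using square_integrable_uminus(2)[OF square_integrable_cnj[OF sq(1)]]
    by (subst l2n_add_power2[OF sq\<zeta> square_integrable_uminus(1)[OF square_integrable_cnj[OF sq(1)]]]) simp
  also have "\<dots> = 0"
    using plancherel[OF f] plancherel[OF \<zeta>] by simp
  finally have "AE x in lebesgue. \<zeta> x = cnj (f x)"
    using l2n_diff_eq_0_iff[OF sq\<zeta> square_integrable_cnj[OF sq(1)]] by simp
  then show ?thesis
    by (intro has_fourier_L2_cong_AE[OF \<zeta>]) auto
qed

lemma fourier_L2_surjective:
  assumes "square_integrable \<psi>"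
  shows "\<exists>f. has_fourier_L2 f \<psi>"
proof -
  obtain \<zeta> where "has_fourier_L2 (\<lambda>p. cnj (\<psi> p)) \<zeta>"
    using fourier_L2_exists[OF square_integrable_cnj[OF assms]] by blast
  from fourier_L2_inversion[OF this] show ?thesis
    by auto
qed

lemma lebesgue_reflect:
  shows "distr lebesgue lebesgue (\<lambda>x. - x :: 'a::euclidean_space) = lebesgue"
    and "(\<lambda>x. - x :: 'a) \<in> lebesgue \<rightarrow>\<^sub>M lebesgue"
proof -
  have eq: "(\<lambda>x. 0 + (\<Sum>j\<in>Basis. ((- 1) * (x \<bullet> j)) *\<^sub>R j)) = (\<lambda>x. - x :: 'a)"
    by (auto simp: sum_negf euclidean_representation)
  show "distr lebesgue lebesgue (\<lambda>x. - x :: 'a::euclidean_space) = lebesgue"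
    using lebesgue_affine_euclidean[of "\<lambda>_. -1" "0 :: 'a", unfolded eq] by (simp add: density_1)
  show "(\<lambda>x. - x :: 'a) \<in> lebesgue \<rightarrow>\<^sub>M lebesgue"
    using lebesgue_affine_measurable[of "\<lambda>_. -1" "0 :: 'a", unfolded eq] by simp
qed

lemma
  fixes \<phi> :: "real^3 \<Rightarrow> complex"
  assumes m: "\<phi> \<in> borel_measurable lebesgue"
  shows l2n_reflect: "l2n (\<lambda>x. \<phi> (- x)) = l2n \<phi>"
    and square_integrable_reflect: "square_integrable \<phi> \<Longrightarrow> square_integrable (\<lambda>x. \<phi> (- x))"
proof -
  have m': "(\<lambda>x. \<phi> (- x)) \<in> borel_measurable lebesgue"
    using measurable_comp[OF lebesgue_reflect(2) m] by (simp add: comp_def)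
  have n: "(\<lambda>x. (norm (\<phi> x))\<^sup>2) \<in> borel_measurable lebesgue"
    using m by measurable
  show "l2n (\<lambda>x. \<phi> (- x)) = l2n \<phi>"
    using integral_distr[OF lebesgue_reflect(2) n] by (simp add: l2n_def lebesgue_reflect(1))
  show "square_integrable \<phi> \<Longrightarrow> square_integrable (\<lambda>x. \<phi> (- x))"
    using integrable_distr_eq[OF lebesgue_reflect(2) n] m'
    by (simp add: square_integrable_def lebesgue_reflect(1))
qed

lemma fourier_integral_cnj: "fourier_integral (\<lambda>x. cnj (\<phi> x)) p = cnj (fourier_integral \<phi> (- p))"
proof -
  have "(LINT x|lebesgue. cnj (\<phi> x) * exp (- \<i> * complex_of_real (p \<bullet> x)))
      = (LINT x|lebesgue. cnj (\<phi> x * exp (- \<i> * complex_of_real (- p \<bullet> x))))"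
    by (intro Bochner_Integration.integral_cong) (auto simp: exp_cnj)
  also have "\<dots> = cnj (LINT x|lebesgue. \<phi> x * exp (- \<i> * complex_of_real (- p \<bullet> x)))"
    by (rule Bochner_Integration.integral_cnj)
  finally show ?thesis
    by (simp add: fourier_integral_def)
qed

lemma has_fourier_L2_cnj:
  assumes "has_fourier_L2 \<phi> \<psi>"
  shows "has_fourier_L2 (\<lambda>x. cnj (\<phi> x)) (\<lambda>p. cnj (\<psi> (- p)))"
  unfolding has_fourier_L2_iff
proof (intro conjI)
  note sq = has_fourier_L2_square_integrable[OF assms]
  note m = sq[THEN square_integrable_measurable]
  show "square_integrable (\<lambda>x. cnj (\<phi> x))" "square_integrable (\<lambda>p. cnj (\<psi> (- p)))"
    using sq m by (auto intro!: square_integrable_cnj square_integrable_reflect)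
  have "l2n (\<lambda>p. cnj (\<psi> (- p)) - fourier_integral (cutoff R (\<lambda>x. cnj (\<phi> x))) p)
      = l2n (\<lambda>p. \<psi> p - fourier_integral (cutoff R \<phi>) p)" for R
  proof -
    have "cutoff R (\<lambda>x. cnj (\<phi> x)) = (\<lambda>x. cnj (cutoff R \<phi> x))"
      by (auto simp: cutoff_def)
    then have "l2n (\<lambda>p. cnj (\<psi> (- p)) - fourier_integral (cutoff R (\<lambda>x. cnj (\<phi> x))) p)
        = l2n (\<lambda>p. cnj (\<psi> (- p) - fourier_integral (cutoff R \<phi>) (- p)))"
      by (simp add: fourier_integral_cnj)
    also have "\<dots> = l2n (\<lambda>p. \<psi> p - fourier_integral (cutoff R \<phi>) p)"
      unfolding l2n_cnj
      by (rule l2n_reflect[of "\<lambda>p. \<psi> p - fourier_integral (cutoff R \<phi>) p"])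
        (intro square_integrable_measurable square_integrable_diff sq fourier_cutoff)
    finally show ?thesis .
  qed
  then show "((\<lambda>R. l2n (\<lambda>p. cnj (\<psi> (- p)) - fourier_integral (cutoff R (\<lambda>x. cnj (\<phi> x))) p)) \<longlongrightarrow> 0) at_top"
    using assms by (simp add: has_fourier_L2_iff)
qed

lemma has_fourier_L2_real_hermitian:
  assumes "has_fourier_L2 (\<lambda>x. complex_of_real (\<phi> x)) \<psi>"
  shows "AE p in lebesgue. \<psi> (- p) = cnj (\<psi> p)"
proof -
  have "AE p in lebesgue. \<psi> p = cnj (\<psi> (- p))"
    using has_fourier_L2_unique[OF assms has_fourier_L2_cnj[OF assms]] by simp
  then show ?thesis
    by eventually_elim (metis complex_cnj_cnj)
qed

text \<open>Hermitian symmetry says that the inverse transform and its conjugate have the same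
  transform, hence agree almost everywhere; the real part is then a representative that is real at
  every point.\<close>

lemma real_inverse_fourier:
  assumes sq: "square_integrable \<psi>" and herm: "AE p in lebesgue. \<psi> (- p) = cnj (\<psi> p)"
  shows "\<exists>\<phi>. has_fourier_L2 (\<lambda>x. complex_of_real (\<phi> x)) \<psi>"
proof -
  obtain f where f: "has_fourier_L2 f \<psi>"
    using fourier_L2_surjective[OF sq] by blast
  have "AE p in lebesgue. cnj (\<psi> (- p)) = \<psi> p"
    using herm by eventually_elim simp
  then have "AE x in lebesgue. cnj (f x) = f x"
    using has_fourier_L2_unique[OF has_fourier_L2_cnj[OF f] f] by simp
  then have "AE x in lebesgue. f x = complex_of_real (Re (f x))"
    by eventually_elim (simp add: complex_eq_iff)
  then show ?thesis
    using has_fourier_L2_cong_AE[OF f] by fastforce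
qed

lemma has_fourier_square_integrable:
  assumes "square_integrable \<phi>"
  shows "has_fourier \<phi> \<psi> \<longleftrightarrow> has_fourier_L2 \<phi> \<psi>"
proof
  assume "has_fourier \<phi> \<psi>"
  then consider "integrable lebesgue \<phi>" "AE p in lebesgue. \<psi> p = fourier_integral \<phi> p" | "has_fourier_L2 \<phi> \<psi>"
    by (auto simp: has_fourier_def)
  then show "has_fourier_L2 \<phi> \<psi>"
  proof cases
    case 1
    then show ?thesis
      by (intro has_fourier_L2_cong_AE[OF has_fourier_L2_L1[OF 1(1) assms]]) (auto elim: eventually_mono)
  qed
qed (simp add: has_fourier_def)

lemma has_fourier_integrable:
  assumes "integrable lebesgue \<phi>" "has_fourier \<phi> \<psi>"
  shows "AE p in lebesgue. \<psi> p = fourier_integral \<phi> p"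
  using assms(2) unfolding has_fourier_def
proof (elim disjE conjE)
  assume "has_fourier_L2 \<phi> \<psi>"
  then show ?thesis
    using has_fourier_L2_unique[OF _ has_fourier_L2_L1[OF assms(1)]] has_fourier_L2_square_integrable(1)
    by blast
qed

section \<open>Convolutions\<close>

lemma
  fixes h g :: "real^3 \<Rightarrow> complex"
  assumes h: "integrable lborel h" and g: "integrable lborel g"
  shows integrable_convolution_borel: "integrable lborel (\<lambda>x. LINT y|lborel. h (x - y) * g y)"
    and fourier_convolution_borel: "fourier_integral (\<lambda>x. LINT y|lborel. h (x - y) * g y) p
      = complex_of_real ((2 * pi) powr (3 / 2)) * fourier_integral h p * fourier_integral g p"
proof -
  have [measurable]: "h \<in> borel_measurable borel" "g \<in> borel_measurable borel"
    using h g by (auto dest: borel_measurable_integrable)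
  have pair: "integrable (lborel \<Otimes>\<^sub>M lborel) (\<lambda>(y, x). h (x - y) * g y)"
  proof (rule lborel_pair.Fubini_integrable)
    have "(LINT x|lborel. cmod (h (x - y))) = (LINT x|lborel. cmod (h x))" for y
      using integral_lborel_translate[of "\<lambda>x. cmod (h x)" y] by simp
    then show "integrable lborel (\<lambda>y. LINT x|lborel. norm (case (y, x) of (y, x) \<Rightarrow> h (x - y) * g y))"
      using g by (simp add: norm_mult)
    show "AE y in lborel. integrable lborel (\<lambda>x. case (y, x) of (y, x) \<Rightarrow> h (x - y) * g y)"
      using h integrable_lborel_translate[of h] by simp
  qed measurable
  show "integrable lborel (\<lambda>x. LINT y|lborel. h (x - y) * g y)"
    using lborel_pair.integrable_snd[OF pair] by simp
  define c where "c = complex_of_real ((2 * pi) powr (- 3 / 2))"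
  define E where "E x = exp (- \<i> * complex_of_real (p \<bullet> x))" for x :: "real^3"
  have [measurable]: "E \<in> borel_measurable borel"
    unfolding E_def by measurable
  \<comment> \<open>Multiplicativity of the character lets the inner integral be translated by
    \<open>y\<close>, after which the two integrals separate.\<close>
  have E: "E x = E (x - y) * E y" for x y
    unfolding E_def exp_add[symmetric] by (simp add: inner_diff_right algebra_simps)
  have pairE: "integrable (lborel \<Otimes>\<^sub>M lborel) (\<lambda>(y, x). h (x - y) * g y * E x)"
    by (rule Bochner_Integration.integrable_bound[OF pair]) (auto simp: norm_mult E_def)
  have conv_meas: "(\<lambda>x. LINT y|lborel. h (x - y) * g y) \<in> borel_measurable borel"
    by measurable
  have "fourier_integral (\<lambda>x. LINT y|lborel. h (x - y) * g y) p
      = c * (LINT x|lborel. (LINT y|lborel. h (x - y) * g y * E x))"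
    using conv_meas by (simp add: fourier_integral_lborel c_def E_def)
  also have "(LINT x|lborel. (LINT y|lborel. h (x - y) * g y * E x))
      = (LINT y|lborel. (LINT x|lborel. h (x - y) * g y * E x))"
    by (rule lborel_pair.Fubini_integral[OF pairE])
  also have "\<dots> = (LINT y|lborel. (g y * E y) * (LINT x|lborel. h (x - y) * E (x - y)))"
  proof -
    have "h (x - y) * g y * E x = (g y * E y) * (h (x - y) * E (x - y))" for x y
      using E[of x y] by (simp add: mult_ac)
    then show ?thesis
      by (simp only: integral_mult_right_zero)
  qed
  also have "\<dots> = (LINT y|lborel. (g y * E y) * (LINT x|lborel. h x * E x))"
    using integral_lborel_translate[of "\<lambda>x. h x * E x"] by simp
  also have "\<dots> = (LINT y|lborel. g y * E y) * (LINT x|lborel. h x * E x)"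
    by simp
  finally have *: "fourier_integral (\<lambda>x. LINT y|lborel. h (x - y) * g y) p
      = c * ((LINT y|lborel. g y * E y) * (LINT x|lborel. h x * E x))" .
  have "complex_of_real ((2 * pi) powr (3 / 2)) * c = 1"
    unfolding c_def of_real_mult[symmetric] powr_add[symmetric] by simp
  then have "c * (a * b) = complex_of_real ((2 * pi) powr (3 / 2)) * (c * b) * (c * a)" for a b
    by (metis mult.commute mult.left_commute mult_1)
  then show "fourier_integral (\<lambda>x. LINT y|lborel. h (x - y) * g y) p
      = complex_of_real ((2 * pi) powr (3 / 2)) * fourier_integral h p * fourier_integral g p"
    unfolding * by (simp add: fourier_integral_lborel c_def E_def)
qed

text \<open>Allows a representative of \<open>H\<close> to be exchanged inside a convolution at each
  fixed \<open>x\<close>, so that the convolution does not change at any point.\<close>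

lemma AE_lebesgue_translate_reflect:
  fixes x :: "'a::euclidean_space"
  assumes "AE z in lebesgue. P z"
  shows "AE y in lebesgue. P (x - y)"
proof -
  have "AE z in lborel. P z"
    using assms by (simp add: AE_completion_iff)
  then obtain N where N: "N \<in> null_sets lborel" "{z. \<not> P z} \<subseteq> N"
    by (auto simp: eventually_ae_filter)
  have "AE y in distr lborel borel (\<lambda>y. x - y). y \<notin> N"
    using N(1) by (simp add: lborel_distr_reflect AE_not_in)
  then have "AE y in lborel. x - y \<notin> N"
    by (rule AE_distrD[rotated]) simp
  then have "AE y in lborel. P (x - y)"
    using N(2) by (auto elim!: eventually_mono)
  then show ?thesis
    by (rule AE_completion)
qed

text \<open>The essential bound \<open>B\<close> on \<open>G\<close> makes the convolution bounded,
  and a bounded integrable function is square integrable.\<close>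

lemma
  fixes H G :: "real^3 \<Rightarrow> real"
  assumes H: "integrable lebesgue H" and G: "integrable lebesgue G"
    and B: "AE x in lebesgue. \<bar>G x\<bar> \<le> B"
  defines "F \<equiv> \<lambda>x. LINT y|lebesgue. H (x - y) * G y"
  shows integrable_convolution: "integrable lebesgue F"
    and square_integrable_convolution: "square_integrable F"
    and fourier_convolution: "fourier_integral (\<lambda>x. complex_of_real (F x)) p
      = complex_of_real ((2 * pi) powr (3 / 2)) * fourier_integral (\<lambda>x. complex_of_real (H x)) p
        * fourier_integral (\<lambda>x. complex_of_real (G x)) p"
proof -
  obtain h where h [measurable]: "h \<in> borel_measurable borel" and h_int: "integrable lborel h"
    and h_ae: "AE x in lebesgue. complex_of_real (H x) = h x"
    and FIh: "fourier_integral (\<lambda>x. complex_of_real (H x)) = fourier_integral h"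
    using H by (rule L1_borel_version[OF integrable_of_real])
  obtain g where g [measurable]: "g \<in> borel_measurable borel" and g_int: "integrable lborel g"
    and g_ae: "AE x in lebesgue. complex_of_real (G x) = g x"
    and FIg: "fourier_integral (\<lambda>x. complex_of_real (G x)) = fourier_integral g"
    using G by (rule L1_borel_version[OF integrable_of_real])
  define K where "K x = (LINT y|lborel. h (x - y) * g y)" for x
  have K_meas [measurable]: "K \<in> borel_measurable borel"
    unfolding K_def by measurable
  have K_int: "integrable lborel K"
    unfolding K_def by (rule integrable_convolution_borel[OF h_int g_int])
  have FK: "complex_of_real (F x) = K x" for x
  proof -
    have 1: "(\<lambda>y. h (x - y) * g y) \<in> borel_measurable lebesgue"
      by (rule measurable_completion) (simp, measurable)
    have 2: "AE y in lebesgue. h (x - y) * g y = complex_of_real (H (x - y) * G y)"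
      using AE_lebesgue_translate_reflect[OF h_ae, of x] g_ae by eventually_elim simp
    have "complex_of_real (F x) = (LINT y|lebesgue. complex_of_real (H (x - y) * G y))"
      by (simp add: F_def flip: integral_complex_of_real)
    also have "\<dots> = (LINT y|lebesgue. h (x - y) * g y)"
      using 2 by (intro integral_cong_AE borel_measurable_AE[OF 1 2] 1) (auto elim: eventually_mono)
    also have "\<dots> = K x"
      unfolding K_def by (rule integral_completion) (simp, measurable)
    finally show ?thesis .
  qed
  have "integrable lebesgue (\<lambda>x. complex_of_real (F x))"
    unfolding FK using K_int by (simp add: integrable_completion)
  then show F_int: "integrable lebesgue F"
    by (simp add: complex_of_real_integrable_eq)
  have B': "AE x in lebesgue. cmod (g x) \<le> B"
    using B g_ae by eventually_elim (metis norm_of_real)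
  define C where "C = B * (LINT y|lborel. cmod (h y))"
  have F_le: "\<bar>F x\<bar> \<le> C" for x
  proof -
    have "AE y in lborel. cmod (g y) \<le> B"
      using B' by (simp add: AE_completion_iff)
    then have le: "AE y in lborel. cmod (h (x - y) * g y) \<le> B * cmod (h (x - y))"
      by eventually_elim (subst mult.commute, simp add: norm_mult mult_right_mono)
    have hx: "integrable lborel (\<lambda>y. h (x - y))"
      using h_int integrable_lborel_reflect[of h] by simp
    have "cmod (K x) \<le> (LINT y|lborel. cmod (h (x - y) * g y))"
      unfolding K_def by (rule integral_norm_bound)
    also have "\<dots> \<le> (LINT y|lborel. B * cmod (h (x - y)))"
    proof (rule integral_mono_AE[OF _ _ le])
      show i: "integrable lborel (\<lambda>y. B * cmod (h (x - y)))"
        using hx by simp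
      show "integrable lborel (\<lambda>y. cmod (h (x - y) * g y))"
        using le by (intro Bochner_Integration.integrable_bound[OF i]) (auto elim!: eventually_mono)
    qed
    also have "\<dots> = C"
      using integral_lborel_reflect[of "\<lambda>y. cmod (h y)" x] by (simp add: C_def)
    finally show ?thesis
      using FK[of x] by (metis norm_of_real)
  qed
  note F_meas [measurable] = borel_measurable_integrable[OF F_int]
  have "integrable lebesgue (\<lambda>x. (norm (F x))\<^sup>2)"
  proof (rule Bochner_Integration.integrable_bound)
    show "integrable lebesgue (\<lambda>x. C * \<bar>F x\<bar>)"
      using F_int by simp
    have "\<bar>F x\<bar>\<^sup>2 \<le> C * \<bar>F x\<bar>" for x
      unfolding power2_eq_square by (intro mult_right_mono F_le) simp
    then show "AE x in lebesgue. norm ((norm (F x))\<^sup>2) \<le> norm (C * \<bar>F x\<bar>)"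
      by (intro AE_I2) (simp add: abs_le_iff order_trans[OF _ abs_ge_self])
  qed measurable
  then show "square_integrable F"
    using F_meas by (simp add: square_integrable_def)
  show "fourier_integral (\<lambda>x. complex_of_real (F x)) p
      = complex_of_real ((2 * pi) powr (3 / 2)) * fourier_integral (\<lambda>x. complex_of_real (H x)) p
        * fourier_integral (\<lambda>x. complex_of_real (G x)) p"
    unfolding FK FIh FIg K_def by (rule fourier_convolution_borel[OF h_int g_int])
qed

section \<open>Fractional Laplacians and the linear equation\<close>

lemma
  fixes \<phi> :: "real^3 \<Rightarrow> real"
  shows square_integrable_complex_of_real [simp]:
      "square_integrable (\<lambda>x. complex_of_real (\<phi> x)) \<longleftrightarrow> square_integrable \<phi>"
    and l2n_complex_of_real [simp]: "l2n (\<lambda>x. complex_of_real (\<phi> x)) = l2n \<phi>"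
proof -
  have "(\<lambda>x. complex_of_real (\<phi> x)) \<in> borel_measurable lebesgue \<longleftrightarrow> \<phi> \<in> borel_measurable lebesgue"
  proof
    assume "(\<lambda>x. complex_of_real (\<phi> x)) \<in> borel_measurable lebesgue"
    then have "(\<lambda>x. Re (complex_of_real (\<phi> x))) \<in> borel_measurable lebesgue"
      by measurable
    then show "\<phi> \<in> borel_measurable lebesgue" by simp
  qed (rule measurable_compose[OF _ borel_measurable_of_real])
  then show "square_integrable (\<lambda>x. complex_of_real (\<phi> x)) \<longleftrightarrow> square_integrable \<phi>"
    unfolding square_integrable_def by simp
  show "l2n (\<lambda>x. complex_of_real (\<phi> x)) = l2n \<phi>"
    by (simp add: l2n_def)
qed

abbreviation has_real_fourier :: "(real^3 \<Rightarrow> real) \<Rightarrow> (real^3 \<Rightarrow> complex) \<Rightarrow> bool" where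
  "has_real_fourier \<phi> \<psi> \<equiv> has_fourier_L2 (\<lambda>x. complex_of_real (\<phi> x)) \<psi>"

lemma has_real_fourier_square_integrable:
  assumes "has_real_fourier \<phi> \<psi>"
  shows "square_integrable \<phi>" "square_integrable \<psi>" "l2n \<psi> = l2n \<phi>"
  using has_fourier_L2_square_integrable[OF assms] plancherel[OF assms] by simp_all

lemma has_real_fourier_exists: "square_integrable \<phi> \<Longrightarrow> \<exists>\<psi>. has_real_fourier \<phi> \<psi>"
  by (rule fourier_L2_exists) simp

lemma has_real_fourier_unique:
  assumes "has_real_fourier \<phi> \<psi>" "has_real_fourier \<phi>' \<psi>'"
  shows "(AE x in lebesgue. \<phi> x = \<phi>' x) \<longleftrightarrow> (AE p in lebesgue. \<psi> p = \<psi>' p)"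
  using has_fourier_L2_unique[OF assms] by simp

lemma has_real_fourier_cong_AE:
  assumes "has_real_fourier \<phi> \<psi>" "AE x in lebesgue. \<phi> x = \<phi>' x" "AE p in lebesgue. \<psi> p = \<psi>' p"
  shows "has_real_fourier \<phi>' \<psi>'"
  using assms(2,3) by (intro has_fourier_L2_cong_AE[OF assms(1)]) (auto elim: eventually_mono)

lemma has_real_fourier_diff:
  assumes "has_real_fourier \<phi> \<psi>" "has_real_fourier \<phi>' \<psi>'"
  shows "has_real_fourier (\<lambda>x. \<phi> x - \<phi>' x) (\<lambda>p. \<psi> p - \<psi>' p)"
  using has_fourier_L2_diff[OF assms] by simp

lemma has_real_fourier_add:
  assumes "has_real_fourier \<phi> \<psi>" "has_real_fourier \<phi>' \<psi>'"
  shows "has_real_fourier (\<lambda>x. \<phi> x + \<phi>' x) (\<lambda>p. \<psi> p + \<psi>' p)"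
  using has_fourier_L2_add[OF assms] by simp

declare borel_measurable_lebesgue_ident [measurable del]

lemma norm_measurable_lebesgue: "norm \<in> borel_measurable (lebesgue :: (real^3) measure)"
  by (rule measurable_completion) simp

lemma norm_powr_measurable [measurable]:
  "(\<lambda>p::real^3. norm p powr a) \<in> borel_measurable lebesgue"
  by (rule measurable_completion) (simp, measurable)

lemma AE_lebesgue_nonzero: "AE p in lebesgue. (p::real^3) \<noteq> 0"
proof -
  have "AE p in lborel. (p::real^3) \<noteq> 0"
    by (rule AE_lborel_singleton)
  then show ?thesis by (rule AE_completion)
qed

lemma real_multiplier_inverse_fourier:
  fixes m :: "real^3 \<Rightarrow> real"
  assumes \<phi>: "has_real_fourier \<phi> \<psi>" and sq: "square_integrable (\<lambda>p. complex_of_real (m p) * \<psi> p)"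
    and even: "\<And>p. m (- p) = m p"
  shows "\<exists>h. has_real_fourier h (\<lambda>p. complex_of_real (m p) * \<psi> p)"
  using has_fourier_L2_real_hermitian[OF \<phi>]
  by (intro real_inverse_fourier[OF sq]) (auto simp: even elim: eventually_mono)

text \<open>For a square-integrable function either clause of \<open>has_fourier\<close> leads to
  the same transform, so the existentially quantified transforms can be replaced by one fixed
  \<open>\<psi>\<close>.\<close>

lemma has_frac_laplacian_iff:
  assumes \<phi>: "has_real_fourier \<phi> \<psi>"
  shows "has_frac_laplacian s \<phi> h \<longleftrightarrow> has_real_fourier h (\<lambda>p. complex_of_real (norm p powr (2 * s)) * \<psi> p)"
proof
  assume "has_frac_laplacian s \<phi> h"
  then obtain \<psi>' \<eta> where 1: "has_fourier (\<lambda>x. complex_of_real (\<phi> x)) \<psi>'" "has_real_fourier h \<eta>"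
      "AE p in lebesgue. \<eta> p = complex_of_real (norm p powr (2 * s)) * \<psi>' p"
    by (auto simp: has_frac_laplacian_def)
  have "has_real_fourier \<phi> \<psi>'"
    using 1(1) has_fourier_square_integrable has_real_fourier_square_integrable(1)[OF \<phi>] by simp
  from has_real_fourier_unique[OF this \<phi>] have "AE p in lebesgue. \<psi>' p = \<psi> p"
    by simp
  with 1(3) have "AE p in lebesgue. \<eta> p = complex_of_real (norm p powr (2 * s)) * \<psi> p"
    by eventually_elim simp
  then show "has_real_fourier h (\<lambda>p. complex_of_real (norm p powr (2 * s)) * \<psi> p)"
    by (intro has_real_fourier_cong_AE[OF 1(2)]) auto
next
  assume "has_real_fourier h (\<lambda>p. complex_of_real (norm p powr (2 * s)) * \<psi> p)"
  then show "has_frac_laplacian s \<phi> h"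
    using \<phi> unfolding has_frac_laplacian_def has_fourier_def by (intro exI conjI) auto
qed

lemma frac_laplacian_in_L2_iff:
  assumes \<phi>: "has_real_fourier \<phi> \<psi>"
  shows "frac_laplacian_in_L2 s \<phi> \<longleftrightarrow> square_integrable (\<lambda>p. complex_of_real (norm p powr (2 * s)) * \<psi> p)"
  unfolding frac_laplacian_in_L2_def has_frac_laplacian_iff[OF \<phi>]
  using real_multiplier_inverse_fourier[OF \<phi>, of "\<lambda>p. norm p powr (2 * s)"] has_real_fourier_square_integrable(2)
  by auto

lemma has_real_fourier_frac_laplacian:
  assumes \<phi>: "has_real_fourier \<phi> \<psi>" and "frac_laplacian_in_L2 s \<phi>"
  shows "has_real_fourier (frac_laplacian s \<phi>) (\<lambda>p. complex_of_real (norm p powr (2 * s)) * \<psi> p)"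
  using assms(2) unfolding has_frac_laplacian_iff[OF \<phi>, symmetric] frac_laplacian_in_L2_def frac_laplacian_def by (rule someI_ex)

lemma sobolev_space_2_iff:
  assumes \<phi>: "has_real_fourier \<phi> \<psi>"
  shows "\<phi> \<in> sobolev_space 2 \<longleftrightarrow> square_integrable (\<lambda>p. complex_of_real ((norm p)\<^sup>2) * \<psi> p)"
    and "\<phi> \<in> sobolev_space 2 \<Longrightarrow>
      (sobolev_norm 2 \<phi>)\<^sup>2 = (l2n \<psi>)\<^sup>2 + (l2n (\<lambda>p. complex_of_real ((norm p)\<^sup>2) * \<psi> p))\<^sup>2"
proof -
  have eq: "(\<lambda>p. complex_of_real (norm p powr (2 * 1)) * \<psi> p) = (\<lambda>p. complex_of_real ((norm p)\<^sup>2) * \<psi> p)"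
    by auto
  show iff: "\<phi> \<in> sobolev_space 2 \<longleftrightarrow> square_integrable (\<lambda>p. complex_of_real ((norm p)\<^sup>2) * \<psi> p)"
    using frac_laplacian_in_L2_iff[OF \<phi>, of 1] has_real_fourier_square_integrable(1)[OF \<phi>]
    unfolding eq by (simp add: sobolev_space_def)
  assume "\<phi> \<in> sobolev_space 2"
  then have "frac_laplacian_in_L2 1 \<phi>"
    by (simp add: sobolev_space_def)
  from has_real_fourier_square_integrable(3)[OF has_real_fourier_frac_laplacian[OF \<phi> this]]
  show "(sobolev_norm 2 \<phi>)\<^sup>2 = (l2n \<psi>)\<^sup>2 + (l2n (\<lambda>p. complex_of_real ((norm p)\<^sup>2) * \<psi> p))\<^sup>2"
    unfolding eq by (simp add: sobolev_norm_def L2_norm_eq_l2n has_real_fourier_square_integrable(3)[OF \<phi>])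
qed

lemma l2n_le_sobolev_norm: "l2n \<phi> \<le> sobolev_norm r \<phi>"
  unfolding sobolev_norm_def L2_norm_eq_l2n by (rule real_le_rsqrt) simp

text \<open>The data \<open>f\<close> and \<open>H\<close> are assumed integrable but not square
  integrable, so here the transform is the Fourier integral itself and only its product with the
  power of \<open>norm p\<close> lies in \<open>L\<^sup>2\<close>.\<close>

lemma
  assumes int: "integrable lebesgue f" and L2: "frac_laplacian_in_L2 s f"
  shows square_integrable_frac_laplacian_L1:
      "square_integrable (\<lambda>p. complex_of_real (norm p powr (2 * s)) * fourier_integral (\<lambda>x. complex_of_real (f x)) p)"
    and l2n_frac_laplacian_L1:
      "l2n (\<lambda>p. complex_of_real (norm p powr (2 * s)) * fourier_integral (\<lambda>x. complex_of_real (f x)) p)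
        = L2_norm (frac_laplacian s f)"
proof -
  have "has_frac_laplacian s f (frac_laplacian s f)"
    using L2 unfolding frac_laplacian_in_L2_def frac_laplacian_def by (rule someI_ex)
  then obtain \<psi> \<eta> where 1: "has_fourier (\<lambda>x. complex_of_real (f x)) \<psi>" "has_real_fourier (frac_laplacian s f) \<eta>"
      "AE p in lebesgue. \<eta> p = complex_of_real (norm p powr (2 * s)) * \<psi> p"
    by (auto simp: has_frac_laplacian_def)
  have "AE p in lebesgue. \<psi> p = fourier_integral (\<lambda>x. complex_of_real (f x)) p"
    by (rule has_fourier_integrable[OF _ 1(1)]) (use int in simp)
  with 1(3) have ae: "AE p in lebesgue. \<eta> p = complex_of_real (norm p powr (2 * s)) * fourier_integral (\<lambda>x. complex_of_real (f x)) p"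
    by eventually_elim simp
  show "square_integrable (\<lambda>p. complex_of_real (norm p powr (2 * s)) * fourier_integral (\<lambda>x. complex_of_real (f x)) p)"
    "l2n (\<lambda>p. complex_of_real (norm p powr (2 * s)) * fourier_integral (\<lambda>x. complex_of_real (f x)) p)
        = L2_norm (frac_laplacian s f)"
    using square_integrable_cong_AE[OF has_real_fourier_square_integrable(2)[OF 1(2)] ae]
      has_real_fourier_square_integrable(3)[OF 1(2)] by (simp_all add: L2_norm_eq_l2n)
qed

definition double_symbol :: "real \<Rightarrow> real \<Rightarrow> real^3 \<Rightarrow> real" where
  "double_symbol s t p = norm p powr (2 * s) + norm p powr (2 * t)"

lemma double_symbol_measurable [measurable]: "double_symbol s t \<in> borel_measurable lebesgue"
  unfolding double_symbol_def by measurable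

lemma double_symbol_pos: "p \<noteq> 0 \<Longrightarrow> 0 < double_symbol s t p"
  by (simp add: double_symbol_def add_pos_pos)

lemma double_symbol_even: "double_symbol s t (- p) = double_symbol s t p"
  by (simp add: double_symbol_def)

text \<open>Turns the equation into multiplication by \<open>double_symbol\<close>. In particular a
  right-hand side for which a square-integrable solution exists is itself square integrable.\<close>

lemma solves_double_scale_iff:
  assumes u: "has_real_fourier u \<psi>"
  shows "solves_double_scale s t u F \<longleftrightarrow>
    square_integrable (\<lambda>p. complex_of_real (norm p powr (2 * s)) * \<psi> p) \<and>
    square_integrable (\<lambda>p. complex_of_real (norm p powr (2 * t)) * \<psi> p) \<and>
    has_real_fourier F (\<lambda>p. complex_of_real (double_symbol s t p) * \<psi> p)"
proof (cases "frac_laplacian_in_L2 s u \<and> frac_laplacian_in_L2 t u")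
  case True
  then have sum: "has_real_fourier (\<lambda>x. frac_laplacian s u x + frac_laplacian t u x)
      (\<lambda>p. complex_of_real (double_symbol s t p) * \<psi> p)"
    using has_real_fourier_add[OF has_real_fourier_frac_laplacian[OF u, of s] has_real_fourier_frac_laplacian[OF u, of t]]
    by (simp add: double_symbol_def ring_distribs)
  have "(AE x in lebesgue. frac_laplacian s u x + frac_laplacian t u x = F x)
      \<longleftrightarrow> has_real_fourier F (\<lambda>p. complex_of_real (double_symbol s t p) * \<psi> p)"
    using has_real_fourier_cong_AE[OF sum, of F] has_real_fourier_unique[OF sum, of F] by auto
  then show ?thesis
    using True by (simp add: solves_double_scale_def frac_laplacian_in_L2_iff[OF u])
qed (auto simp: solves_double_scale_def frac_laplacian_in_L2_iff[OF u])

text \<open>The operator \<open>frac_laplacian\<close> chooses a representative that may depend on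
  the function and not just on its class, so invariance needs an argument. It is used where a fixed
  point is known only almost everywhere.\<close>

lemma solves_double_scale_cong_AE:
  assumes "square_integrable u" "AE x in lebesgue. u x = v x"
  shows "solves_double_scale s t u F \<longleftrightarrow> solves_double_scale s t v F"
proof -
  obtain \<psi> where u: "has_real_fourier u \<psi>"
    using has_real_fourier_exists[OF assms(1)] by blast
  have v: "has_real_fourier v \<psi>"
    by (rule has_real_fourier_cong_AE[OF u assms(2)]) simp
  show ?thesis
    unfolding solves_double_scale_iff[OF u] solves_double_scale_iff[OF v] ..
qed

text \<open>The symbol vanishes only at the origin, so division by it determines the transform
  almost everywhere.\<close>

lemma solves_double_scale_unique:
  assumes u: "square_integrable u" "solves_double_scale s t u F"
    and v: "square_integrable v" "solves_double_scale s t v F"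
  shows "AE x in lebesgue. u x = v x"
proof -
  obtain \<psi> \<theta> where f: "has_real_fourier u \<psi>" "has_real_fourier v \<theta>"
    using has_real_fourier_exists u(1) v(1) by blast
  have "AE p in lebesgue. complex_of_real (double_symbol s t p) * \<psi> p = complex_of_real (double_symbol s t p) * \<theta> p"
  proof (subst has_real_fourier_unique[symmetric])
    show "has_real_fourier F (\<lambda>p. complex_of_real (double_symbol s t p) * \<psi> p)"
      "has_real_fourier F (\<lambda>p. complex_of_real (double_symbol s t p) * \<theta> p)"
      using u(2) v(2) by (auto simp: solves_double_scale_iff[OF f(1)] solves_double_scale_iff[OF f(2)])
  qed simp
  then have "AE p in lebesgue. \<psi> p = \<theta> p"
    using AE_lebesgue_nonzero
  proof eventually_elim
    case (elim p)
    then show ?case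
      using double_symbol_pos[of p s t] by simp
  qed
  then show ?thesis
    using has_real_fourier_unique[OF f] by simp
qed

text \<open>The third bound is where the exponent \<open>1 - s\<close> of the assumptions
  originates: dividing the symbol of the Laplacian by \<open>double_symbol\<close> leaves at most
  the symbol of order \<open>1 - s\<close>.\<close>

lemma double_symbol_bounds:
  assumes "p \<noteq> 0"
  shows "norm p powr (2 * s) \<le> double_symbol s t p" "norm p powr (2 * t) \<le> double_symbol s t p"
    and "(norm p)\<^sup>2 \<le> norm p powr (2 * (1 - s)) * double_symbol s t p"
proof -
  show "norm p powr (2 * s) \<le> double_symbol s t p" "norm p powr (2 * t) \<le> double_symbol s t p"
    by (auto simp: double_symbol_def)
  have "(norm p)\<^sup>2 = norm p powr (2 * (1 - s)) * norm p powr (2 * s)"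
    using assms by (simp flip: powr_add)
  also have "\<dots> \<le> norm p powr (2 * (1 - s)) * double_symbol s t p"
    by (intro mult_left_mono) (auto simp: double_symbol_def)
  finally show "(norm p)\<^sup>2 \<le> norm p powr (2 * (1 - s)) * double_symbol s t p" .
qed

text \<open>The transform of \<open>f\<close> is \<open>double_symbol\<close> times that of
  \<open>u\<close>, so \<open>\<Delta> u\<close> is dominated on the Fourier side by the fractional
  Laplacian of order \<open>1 - s\<close> of \<open>f\<close>. This places \<open>u0\<close> in
  \<open>H\<^sup>2\<close> although it is only given in a space of lower order.\<close>

lemma solution_in_sobolev_space_2:
  assumes u: "square_integrable u" "solves_double_scale s t u f"
    and f: "integrable lebesgue f" "frac_laplacian_in_L2 (1 - s) f"
  shows "u \<in> sobolev_space 2"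
proof -
  obtain \<psi> where \<psi>: "has_real_fourier u \<psi>"
    using has_real_fourier_exists[OF u(1)] by blast
  note [measurable] = square_integrable_measurable[OF has_real_fourier_square_integrable(2)[OF \<psi>]]
    norm_measurable_lebesgue
  define \<Phi> where "\<Phi> = fourier_integral (\<lambda>x. complex_of_real (f x))"
  have F: "has_real_fourier f (\<lambda>p. complex_of_real (double_symbol s t p) * \<psi> p)"
    using u(2) by (simp add: solves_double_scale_iff[OF \<psi>])
  have "has_real_fourier f \<Phi>"
    unfolding \<Phi>_def using f(1) has_real_fourier_square_integrable(1)[OF F] by (intro has_fourier_L2_L1) auto
  from has_real_fourier_unique[OF F this]
  have ae: "AE p in lebesgue. complex_of_real (double_symbol s t p) * \<psi> p = \<Phi> p"
    by simp
  have "square_integrable (\<lambda>p. complex_of_real ((norm p)\<^sup>2) * \<psi> p)"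
  proof (rule square_integrable_bound(1)[OF square_integrable_frac_laplacian_L1[OF f], where K=1])
    show "AE p in lebesgue. cmod (complex_of_real ((norm p)\<^sup>2) * \<psi> p)
        \<le> 1 * cmod (complex_of_real (norm p powr (2 * (1 - s))) * fourier_integral (\<lambda>x. complex_of_real (f x)) p)"
      using ae AE_lebesgue_nonzero
    proof eventually_elim
      case (elim p)
      have "cmod (\<Phi> p) = double_symbol s t p * cmod (\<psi> p)"
        using elim(2) double_symbol_pos[of p s t] unfolding elim(1)[symmetric] by (simp add: norm_mult)
      then show ?case
        using mult_right_mono[OF double_symbol_bounds(3)[OF elim(2), of s t] norm_ge_zero[of "\<psi> p"]]
        by (simp add: norm_mult norm_power mult.assoc flip: \<Phi>_def)
    qed
  qed measurable
  then show ?thesis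
    using sobolev_space_2_iff(1)[OF \<psi>] by simp
qed

section \<open>The low-frequency estimate\<close>

lemma radial_layer_swap:
  fixes k :: "real \<Rightarrow> real"
  assumes [measurable]: "k \<in> borel_measurable borel"
  shows "(\<integral>\<^sup>+p. (\<integral>\<^sup>+r. (if norm (p::real^3) \<le> r \<and> r \<le> R then ennreal (k r) else 0) \<partial>lborel) \<partial>lborel)
      = (\<integral>\<^sup>+r. (\<integral>\<^sup>+p. (if norm (p::real^3) \<le> r \<and> r \<le> R then ennreal (k r) else 0) \<partial>lborel) \<partial>lborel)"
proof -
  have "(\<lambda>(p::real^3, r). if norm p \<le> r \<and> r \<le> R then ennreal (k r) else 0)
      \<in> borel_measurable (lborel \<Otimes>\<^sub>M lborel)"
    by measurable
  from lborel_pair.Fubini'[OF this] show ?thesis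
    by (rule sym)
qed

text \<open>A layer-cake argument in place of polar coordinates: the power at \<open>norm p\<close>
  is its value at \<open>R\<close> plus the integral of \<open>k\<close> from \<open>norm p\<close>
  to \<open>R\<close>. After exchanging integrals only volumes of balls remain.\<close>

lemma radial_powr_integral:
  assumes a: "0 < a" "a < 3" and R: "0 < R"
  shows "(\<integral>\<^sup>+p. ennreal (if norm (p::real^3) \<le> R then norm p powr (- a) else 0) \<partial>lborel)
    \<le> ennreal (4 * pi * R powr (3 - a) / (3 - a))"
proof -
  define k where "k r = a * r powr (- a - 1)" for r :: real
  have [measurable]: "k \<in> borel_measurable borel"
    unfolding k_def by measurable
  define V where "V = unit_ball_vol (real DIM(real^3))"
  have V: "V = 4 / 3 * pi"
    unfolding V_def using unit_ball_vol_3 by simp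
  have FTC: "(\<integral>\<^sup>+r. (if x \<le> r \<and> r \<le> R then ennreal (k r) else 0) \<partial>lborel) = ennreal (x powr (- a) - R powr (- a))"
    if "0 < x" "x \<le> R" for x
  proof -
    have "(\<integral>\<^sup>+r. ennreal (k r) * indicator {x..R} r \<partial>lborel)
        = ennreal (- (R powr (- a)) - (- (x powr (- a))))"
    proof (rule nn_integral_FTC_Icc)
      fix r assume "r \<in> {x..R}"
      then show "((\<lambda>r. - (r powr (- a))) has_real_derivative k r) (at r)" "0 \<le> k r"
        using that a unfolding k_def by (auto intro!: derivative_eq_intros)
    qed (use that in auto)
    also have "(\<integral>\<^sup>+r. ennreal (k r) * indicator {x..R} r \<partial>lborel)
        = (\<integral>\<^sup>+r. (if x \<le> r \<and> r \<le> R then ennreal (k r) else 0) \<partial>lborel)"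
      by (intro nn_integral_cong) (auto split: split_indicator)
    finally show ?thesis by simp
  qed
  \<comment> \<open>At the origin \<open>powr\<close> evaluates to 0, so the left side vanishes
    there and the inequality is trivial.\<close>
  have split: "ennreal (if norm p \<le> R then norm p powr (- a) else 0)
      \<le> ennreal (R powr (- a)) * indicator (cball 0 R) p
        + (\<integral>\<^sup>+r. (if norm p \<le> r \<and> r \<le> R then ennreal (k r) else 0) \<partial>lborel)" for p :: "real^3"
  proof (cases "p = 0 \<or> R < norm p")
    case False
    then have "R powr (- a) \<le> norm p powr (- a)"
      using a by (intro powr_mono2') auto
    then have "ennreal (norm p powr (- a)) = ennreal (R powr (- a)) + ennreal (norm p powr (- a) - R powr (- a))"
      by (subst ennreal_plus[symmetric]) auto
    then show ?thesis
      using False FTC[of "norm p"] by simp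
  qed auto
  have vol: "(\<integral>\<^sup>+p. indicator (cball (0::real^3) r) p \<partial>lborel) = ennreal (V * r ^ 3)" if "0 \<le> r" for r
    using emeasure_cball[of r "0::real^3"] that by (simp add: V_def)
  have "(\<integral>\<^sup>+p. (\<integral>\<^sup>+r. (if norm (p::real^3) \<le> r \<and> r \<le> R then ennreal (k r) else 0) \<partial>lborel) \<partial>lborel)
      = (\<integral>\<^sup>+r. (\<integral>\<^sup>+p. (if norm (p::real^3) \<le> r \<and> r \<le> R then ennreal (k r) else 0) \<partial>lborel) \<partial>lborel)"
    by (rule radial_layer_swap) measurable
  also have "\<dots> = (\<integral>\<^sup>+r. ennreal (V * a * r powr (2 - a)) * indicator {0..R} r \<partial>lborel)"
  proof (intro nn_integral_cong)
    fix r :: real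
    show "(\<integral>\<^sup>+p. (if norm (p::real^3) \<le> r \<and> r \<le> R then ennreal (k r) else 0) \<partial>lborel)
        = ennreal (V * a * r powr (2 - a)) * indicator {0..R} r"
    proof (cases "0 \<le> r \<and> r \<le> R")
      case True
      then have "(\<integral>\<^sup>+p. (if norm (p::real^3) \<le> r \<and> r \<le> R then ennreal (k r) else 0) \<partial>lborel)
          = (\<integral>\<^sup>+p. ennreal (k r) * indicator (cball (0::real^3) r) p \<partial>lborel)"
        by (intro nn_integral_cong) (auto split: split_indicator)
      also have "\<dots> = ennreal (k r) * ennreal (V * r ^ 3)"
        using True by (subst nn_integral_cmult)
          (auto simp: vol simp del: nn_integral_indicator intro!: borel_measurable_indicator)
      also have "\<dots> = ennreal (V * a * r powr (2 - a))"
      proof -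
        have "k r * (V * r ^ 3) = V * a * r powr (2 - a)"
        proof (cases "r = 0")
          case False
          then have "r powr (- a - 1) * r ^ 3 = r powr (2 - a)"
            using True by (simp flip: powr_numeral powr_add)
          then show ?thesis
            by (simp add: k_def mult_ac)
        qed (simp add: k_def)
        moreover have "0 \<le> k r"
          using a by (simp add: k_def)
        ultimately show ?thesis
          by (simp only: ennreal_mult'[symmetric])
      qed
      finally show ?thesis
        using True by simp
    next
      case False
      then have "(if norm p \<le> r \<and> r \<le> R then ennreal (k r) else 0) = 0" for p :: "real^3"
        using order_trans[OF norm_ge_zero[of p], of r] by auto
      then show ?thesis
        using False by simp
    qed
  qed
  also have "\<dots> = ennreal (V * a * (R powr (3 - a) / (3 - a)))"
  proof -
    have "((\<lambda>r. r powr (2 - a)) has_integral (R powr (2 - a + 1) / (2 - a + 1))) {0..R}"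
      using a R by (intro has_integral_powr_from_0) auto
    then have "((\<lambda>r. V * a * r powr (2 - a)) has_integral (V * a * (R powr (3 - a) / (3 - a)))) {0..R}"
      by (intro has_integral_mult_right) (simp add: algebra_simps)
    note int = this
    have "0 \<le> V"
      unfolding V by simp
    then have "(\<integral>\<^sup>+r. ennreal (indicator {0..R} r * (V * a * r powr (2 - a))) \<partial>lborel) = ennreal (V * a * (R powr (3 - a) / (3 - a)))"
      using nn_integral_has_integral_lebesgue[OF _ int] a by (simp add: nn_integral_completion)
    moreover have "ennreal (V * a * r powr (2 - a)) * indicator {0..R} r = ennreal (indicator {0..R} r * (V * a * r powr (2 - a)))" for r
      by (auto split: split_indicator)
    ultimately show ?thesis
      by (simp only:)
  qed
  finally have layer: "(\<integral>\<^sup>+p. (\<integral>\<^sup>+r. (if norm (p::real^3) \<le> r \<and> r \<le> R then ennreal (k r) else 0) \<partial>lborel) \<partial>lborel)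
      = ennreal (V * a * (R powr (3 - a) / (3 - a)))" .
  have vol_R: "ennreal (R powr (- a)) * ennreal (V * R ^ 3) = ennreal (V * R powr (3 - a))"
  proof -
    have "R powr (- a) * R ^ 3 = R powr (3 - a)"
      using R by (simp flip: powr_numeral powr_add)
    then show ?thesis
      using R V by (subst ennreal_mult'[symmetric]) (auto simp: mult_ac)
  qed
  have "(\<integral>\<^sup>+p. ennreal (if norm (p::real^3) \<le> R then norm p powr (- a) else 0) \<partial>lborel)
      \<le> (\<integral>\<^sup>+p. ennreal (R powr (- a)) * indicator (cball (0::real^3) R) p
        + (\<integral>\<^sup>+r. (if norm p \<le> r \<and> r \<le> R then ennreal (k r) else 0) \<partial>lborel) \<partial>lborel)"
    by (intro nn_integral_mono split)
  also have "\<dots> = ennreal (R powr (- a)) * ennreal (V * R ^ 3)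
        + (\<integral>\<^sup>+p. (\<integral>\<^sup>+r. (if norm (p::real^3) \<le> r \<and> r \<le> R then ennreal (k r) else 0) \<partial>lborel) \<partial>lborel)"
  proof -
    have "(\<integral>\<^sup>+p. ennreal (R powr (- a)) * indicator (cball (0::real^3) R) p \<partial>lborel)
        = ennreal (R powr (- a)) * ennreal (V * R ^ 3)"
      using R by (subst nn_integral_cmult) (auto simp: vol simp del: nn_integral_indicator intro!: borel_measurable_indicator)
    moreover have "(\<lambda>p::real^3. ennreal (R powr (- a)) * indicator (cball 0 R) p) \<in> borel_measurable lborel"
      by (intro borel_measurable_times_ennreal borel_measurable_indicator) auto
    moreover have "(\<lambda>p::real^3. \<integral>\<^sup>+r. (if norm p \<le> r \<and> r \<le> R then ennreal (k r) else 0) \<partial>lborel) \<in> borel_measurable lborel"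
      by measurable
    ultimately show ?thesis
      by (simp only: nn_integral_add)
  qed
  also have "\<dots> = ennreal (V * R powr (3 - a)) + ennreal (V * a * (R powr (3 - a) / (3 - a)))"
    by (simp only: layer vol_R)
  also have "\<dots> = ennreal (4 * pi * R powr (3 - a) / (3 - a))"
  proof -
    have "0 \<le> V * R powr (3 - a)" "0 \<le> V * a * (R powr (3 - a) / (3 - a))"
      unfolding V using a by auto
    \<comment> \<open>The two parts contribute the weights 1 and \<open>a / (3 - a)\<close>, whose
      sum is \<open>3 / (3 - a)\<close>; the 3 cancels against the volume of the unit ball.\<close>
    moreover have "V * Z + V * a * (Z / (3 - a)) = 4 * pi * Z / (3 - a)" for Z
    proof -
      have "V * Z + V * a * (Z / (3 - a)) = V * Z * ((3 - a) + a) / (3 - a)"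
        using a by (simp add: field_simps)
      then show ?thesis
        unfolding V by simp
    qed
    ultimately show ?thesis
      by (simp only: ennreal_plus[symmetric])
  qed
  finally show ?thesis .
qed

definition low_freq_const :: "real \<Rightarrow> real" where
  "low_freq_const s = 3 / ((3 - 4 * s) * (4 * s) powr (4 * s / 3) * (2 * pi\<^sup>2) powr (4 * s / 3))"

text \<open>Splitting at the radius \<open>R\<close> with \<open>R\<^sup>3 = 8\<pi>\<^sup>2s / W\<^sup>2\<close> balances the two contributions and
  produces the constant of the theorem.\<close>

lemma low_frequency_bound:
  fixes H G :: "real^3 \<Rightarrow> real"
  assumes H: "integrable lebesgue H" and G: "integrable lebesgue G" "square_integrable G"
    and s: "0 < s" "s < 3/4" and W: "0 < W"
    and G1: "L1_norm G \<le> W * b" and G2: "l2n G \<le> b" and b: "0 \<le> b"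
    and [measurable]: "\<psi> \<in> borel_measurable lebesgue"
    and \<psi>: "AE p in lebesgue. cmod (\<psi> p) \<le> norm p powr (- 2 * s) * ((2 * pi) powr (3 / 2)
        * cmod (fourier_integral (\<lambda>x. complex_of_real (H x)) p) * cmod (fourier_integral (\<lambda>x. complex_of_real (G x)) p))"
  shows "square_integrable \<psi>"
    and "(l2n \<psi>)\<^sup>2 \<le> (L1_norm H)\<^sup>2 * b\<^sup>2 * W powr (8 * s / 3) * low_freq_const s"
proof -
  define h where "h p = cmod (fourier_integral (\<lambda>x. complex_of_real (H x)) p)" for p
  define g where "g p = cmod (fourier_integral (\<lambda>x. complex_of_real (G x)) p)" for p
  define c where "c = (2 * pi) powr (3 / 2)"
  \<comment> \<open>Up to a common factor the two contributions are \<open>W\<^sup>2 / c\<^sup>2 *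
    (4 * pi * R powr (3 - 4 * s) / (3 - 4 * s))\<close> and \<open>R powr (- 4 * s)\<close>. Their
    sum is minimal exactly at this radius.\<close>
  define R where "R = (8 * pi\<^sup>2 * s / W\<^sup>2) powr (1 / 3)"
  define A where "A = (L1_norm H)\<^sup>2 * b\<^sup>2"
  have G': "integrable lebesgue (\<lambda>x. complex_of_real (G x))" "square_integrable (\<lambda>x. complex_of_real (G x))"
    using G by auto
  note [measurable] = fourier_integral_measurable[OF G'(1)] norm_measurable_lebesgue
  have R: "0 < R" using s W by (simp add: R_def)
  have c: "0 < c" "(2 * pi) powr (- 3 / 2) = inverse c" "c\<^sup>2 = 8 * pi ^ 3"
  proof -
    show "0 < c" by (simp add: c_def)
    show "(2 * pi) powr (- 3 / 2) = inverse c"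
      by (simp add: c_def powr_minus[symmetric])
    have "c\<^sup>2 = (2 * pi) powr 3"
      unfolding c_def by (simp add: power2_eq_square flip: powr_add)
    then show "c\<^sup>2 = 8 * pi ^ 3"
      by (simp add: power_mult_distrib)
  qed
  have L1_0: "0 \<le> L1_norm H" "0 \<le> L1_norm G"
    by (auto simp: L1_norm_def)
  have h: "c * h p \<le> L1_norm H" for p
    using norm_fourier_integral_le_L1[OF integrable_of_real[OF H], of p] c(1) unfolding c(2)
    by (simp add: h_def L1_norm_def field_simps)
  have g: "c * g p \<le> W * b" for p
    using norm_fourier_integral_le_L1[OF G'(1), of p] c(1) G1 unfolding c(2)
    by (simp add: g_def L1_norm_def field_simps)
  have nonneg: "0 \<le> h p" "0 \<le> g p" for p
    by (auto simp: h_def g_def)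
  have g_L2: "(\<integral>\<^sup>+p. ennreal ((g p)\<^sup>2) \<partial>lebesgue) \<le> ennreal (b\<^sup>2)"
  proof -
    have "(\<integral>\<^sup>+p. ennreal ((g p)\<^sup>2) \<partial>lebesgue) = ennreal ((l2n G)\<^sup>2)"
      unfolding g_def using plancherel_L1_L2[OF G'] by (simp add: nn_integral_eq_l2n)
    also have "\<dots> \<le> ennreal (b\<^sup>2)"
      by (intro ennreal_leI power_mono G2) simp
    finally show ?thesis .
  qed
  define K1 where "K1 = (L1_norm H)\<^sup>2 * (W * b)\<^sup>2 / c\<^sup>2"
  define K2 where "K2 = (L1_norm H)\<^sup>2 * R powr (- 4 * s)"
  have K: "0 \<le> K1" "0 \<le> K2"
    by (auto simp: K1_def K2_def)
  have "(\<integral>\<^sup>+p. ennreal ((norm (\<psi> p))\<^sup>2) \<partial>lebesgue)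
      \<le> (\<integral>\<^sup>+p. ennreal K1 * ennreal (if norm p \<le> R then norm p powr (- (4 * s)) else 0)
          + ennreal K2 * ennreal ((g p)\<^sup>2) \<partial>lebesgue)"
  proof (intro nn_integral_mono_AE, use \<psi> AE_lebesgue_nonzero in eventually_elim)
    case (elim p)
    define q where "q = norm p powr (- (4 * s))"
    have q: "0 \<le> q" "(norm p powr (- 2 * s))\<^sup>2 = q"
      by (auto simp: q_def power2_eq_square simp flip: powr_add)
    have "(cmod (\<psi> p))\<^sup>2 \<le> (norm p powr (- 2 * s) * (c * h p * g p))\<^sup>2"
      using elim(1) by (intro power_mono) (auto simp: c_def h_def g_def)
    also have "\<dots> = q * ((c * h p)\<^sup>2 * (g p)\<^sup>2)"
      by (simp only: power_mult_distrib q(2))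
    \<comment> \<open>The convolution constant \<open>c\<close> is absorbed into \<open>h\<close>,
      whose uniform bound serves in both regions. For \<open>g\<close> the \<open>L\<^sup>1\<close>
      bound is used inside the ball, which leaves the factor \<open>1 / c\<^sup>2\<close> in
      \<open>K1\<close>, and the \<open>L\<^sup>2\<close> bound outside.\<close>
    also have "\<dots> \<le> K1 * (if norm p \<le> R then q else 0) + K2 * (g p)\<^sup>2"
    proof (cases "norm p \<le> R")
      case True
      have "(c * h p)\<^sup>2 * (c * g p)\<^sup>2 \<le> (L1_norm H)\<^sup>2 * (W * b)\<^sup>2"
      proof (rule mult_mono)
        show "(c * h p)\<^sup>2 \<le> (L1_norm H)\<^sup>2"
          using nonneg c by (intro power_mono h) simp
        show "(c * g p)\<^sup>2 \<le> (W * b)\<^sup>2"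
          using nonneg c by (intro power_mono g) simp
      qed simp_all
      then have "(c * h p)\<^sup>2 * (g p)\<^sup>2 \<le> K1"
        using c(1) by (simp add: K1_def field_simps power_mult_distrib)
      then have "q * ((c * h p)\<^sup>2 * (g p)\<^sup>2) \<le> q * K1"
        using q by (intro mult_left_mono)
      also have "\<dots> \<le> K1 * q + K2 * (g p)\<^sup>2"
        using K by simp
      finally show ?thesis using True by simp
    next
      case False
      then have "q \<le> R powr (- 4 * s)"
        unfolding q_def using R s by (simp add: powr_mono2')
      then have "q * ((c * h p)\<^sup>2 * (g p)\<^sup>2) \<le> R powr (- 4 * s) * ((L1_norm H)\<^sup>2 * (g p)\<^sup>2)"
        using h[of p] nonneg c q by (intro mult_mono power_mono) auto
      then show ?thesis using False by (simp add: K2_def mult_ac)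
    qed
    finally have "ennreal ((cmod (\<psi> p))\<^sup>2) \<le> ennreal (K1 * (if norm p \<le> R then q else 0) + K2 * (g p)\<^sup>2)"
      by (rule ennreal_leI)
    also have "\<dots> = ennreal K1 * ennreal (if norm p \<le> R then q else 0) + ennreal K2 * ennreal ((g p)\<^sup>2)"
      using K q by (subst ennreal_plus) (auto simp: ennreal_mult)
    finally show ?case
      by (simp only: q_def)
  qed
  also have "\<dots> = ennreal K1 * (\<integral>\<^sup>+p. ennreal (if norm (p::real^3) \<le> R then norm p powr (- (4 * s)) else 0) \<partial>lebesgue)
      + ennreal K2 * (\<integral>\<^sup>+p. ennreal ((g p)\<^sup>2) \<partial>lebesgue)"
    unfolding g_def by (subst nn_integral_add) (auto simp: nn_integral_cmult)
  also have "(\<integral>\<^sup>+p. ennreal (if norm (p::real^3) \<le> R then norm p powr (- (4 * s)) else 0) \<partial>lebesgue)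
      \<le> ennreal (4 * pi * R powr (3 - 4 * s) / (3 - 4 * s))"
    unfolding nn_integral_completion by (rule radial_powr_integral) (use s R in auto)
  also note g_L2
  finally have "(\<integral>\<^sup>+p. ennreal ((norm (\<psi> p))\<^sup>2) \<partial>lebesgue)
      \<le> ennreal K1 * ennreal (4 * pi * R powr (3 - 4 * s) / (3 - 4 * s)) + ennreal K2 * ennreal (b\<^sup>2)"
    by (simp add: add_mono mult_left_mono)
  also have "\<dots> = ennreal (K1 * (4 * pi * R powr (3 - 4 * s) / (3 - 4 * s)) + K2 * b\<^sup>2)"
  proof -
    have Z: "0 \<le> 4 * pi * R powr (3 - 4 * s) / (3 - 4 * s)"
      using s by simp
    show ?thesis
      by (simp only: ennreal_plus[OF mult_nonneg_nonneg[OF K(1) Z] mult_nonneg_nonneg[OF K(2) zero_le_power2]]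
          ennreal_mult[OF K(1) Z] ennreal_mult[OF K(2) zero_le_power2])
  qed
  also have "K1 * (4 * pi * R powr (3 - 4 * s) / (3 - 4 * s)) + K2 * b\<^sup>2
      = A * W powr (8 * s / 3) * low_freq_const s"
  proof -
    have "R powr (3 - 4 * s) = R powr 3 * R powr (- 4 * s)"
      by (simp flip: powr_add)
    also have "R powr 3 = 8 * pi\<^sup>2 * s / W\<^sup>2"
      unfolding R_def powr_powr using s W by simp
    finally have R3: "R powr (3 - 4 * s) = 8 * pi\<^sup>2 * s / W\<^sup>2 * R powr (- 4 * s)" .
    have R4: "R powr (- 4 * s) = W powr (8 * s / 3) / ((4 * s) powr (4 * s / 3) * (2 * pi\<^sup>2) powr (4 * s / 3))"
    proof -
      have W2: "W\<^sup>2 = W powr 2" using W by simp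
      have "R powr (- 4 * s) = (8 * pi\<^sup>2 * s / W\<^sup>2) powr (- (4 * s / 3))"
        unfolding R_def powr_powr by simp
      also have "\<dots> = inverse (((4 * s) * (2 * pi\<^sup>2) / W\<^sup>2) powr (4 * s / 3))"
        by (simp add: powr_minus mult_ac)
      also have "\<dots> = (W\<^sup>2) powr (4 * s / 3) / ((4 * s) powr (4 * s / 3) * (2 * pi\<^sup>2) powr (4 * s / 3))"
        unfolding powr_divide powr_mult by simp
      also have "(W\<^sup>2) powr (4 * s / 3) = W powr (8 * s / 3)"
        unfolding W2 powr_powr by simp
      finally show ?thesis .
    qed
    \<comment> \<open>At the chosen radius the low frequencies contribute
      \<open>4 * s / (3 - 4 * s)\<close> times the high ones, so the total factor is
      \<open>3 / (3 - 4 * s)\<close>.\<close>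
    have "K1 * (4 * pi * R powr (3 - 4 * s) / (3 - 4 * s)) + K2 * b\<^sup>2
        = A * R powr (- 4 * s) * (W\<^sup>2 / c\<^sup>2 * (4 * pi * (8 * pi\<^sup>2 * s / W\<^sup>2) / (3 - 4 * s)) + 1)"
      unfolding R3 by (simp add: K1_def K2_def A_def power_mult_distrib algebra_simps)
    also have "W\<^sup>2 / c\<^sup>2 * (4 * pi * (8 * pi\<^sup>2 * s / W\<^sup>2) / (3 - 4 * s)) + 1 = 3 / (3 - 4 * s)"
      using W s unfolding c(3) by (simp add: field_simps power2_eq_square power3_eq_cube)
    finally show ?thesis
      unfolding R4 low_freq_const_def by (simp add: mult_ac)
  qed
  finally have fin: "(\<integral>\<^sup>+p. ennreal ((norm (\<psi> p))\<^sup>2) \<partial>lebesgue) \<le> ennreal (A * W powr (8 * s / 3) * low_freq_const s)" .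
  show sq: "square_integrable \<psi>"
    using fin by (auto simp: square_integrable_iff_nn_integral intro: le_less_trans)
  have "0 \<le> A * W powr (8 * s / 3) * low_freq_const s"
    using s by (simp add: A_def low_freq_const_def)
  then show "(l2n \<psi>)\<^sup>2 \<le> (L1_norm H)\<^sup>2 * b\<^sup>2 * W powr (8 * s / 3) * low_freq_const s"
    using fin by (simp add: nn_integral_eq_l2n[OF sq] A_def)
qed

section \<open>The superposition operator\<close>

lemma C_norm_bounds:
  assumes "compact I" "continuous_on I k" "z \<in> I"
  shows "\<bar>k z\<bar> \<le> C_norm I k" and "0 \<le> C_norm I k"
proof -
  have "compact ((\<lambda>z. \<bar>k z\<bar>) ` I)"
    using assms by (intro compact_continuous_image continuous_intros)
  then have "bdd_above ((\<lambda>z. \<bar>k z\<bar>) ` I)"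
    by (simp add: compact_imp_bounded bounded_imp_bdd_above)
  then show "\<bar>k z\<bar> \<le> C_norm I k"
    unfolding C_norm_def using assms(3) by (intro cSUP_upper)
  then show "0 \<le> C_norm I k"
    using abs_ge_zero order_trans by blast
qed

text \<open>At a boundary point \<open>partial_on\<close> reads off one chosen Frechet derivative
  within \<open>I\<close>. Being linear, that derivative is recovered from its values on the
  axes.\<close>

lemma has_derivative_partial_on:
  fixes k :: "real^'n::finite \<Rightarrow> real"
  assumes "k differentiable_on I" "z \<in> I"
  shows "(k has_derivative (\<lambda>v. \<Sum>n\<in>UNIV. v $ n * partial_on I n k z)) (at z within I)"
proof -
  define D where "D = frechet_derivative k (at z within I)"
  have D: "(k has_derivative D) (at z within I)"
    unfolding D_def using assms by (simp add: differentiable_on_def flip: frechet_derivative_works)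
  then have lin: "linear D"
    by (rule has_derivative_linear)
  have "D v = (\<Sum>n\<in>UNIV. v $ n * partial_on I n k z)" for v
  proof -
    have "D v = D (\<Sum>n\<in>UNIV. (v $ n) *\<^sub>R axis n 1)"
      by (simp add: basis_expansion flip: scalar_mult_eq_scaleR)
    also have "\<dots> = (\<Sum>n\<in>UNIV. v $ n * partial_on I n k z)"
      unfolding partial_on_def D_def[symmetric] by (simp add: linear_sum[OF lin] linear_scale[OF lin])
    finally show ?thesis .
  qed
  then show ?thesis
    using D by presburger
qed

lemma abs_sum_mult_component_le:
  fixes v :: "real^'n::finite"
  assumes "\<And>n. \<bar>d n\<bar> \<le> B n"
  shows "\<bar>\<Sum>n\<in>UNIV. v $ n * d n\<bar> \<le> (\<Sum>n\<in>UNIV. B n) * norm v"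
proof -
  have "\<bar>\<Sum>n\<in>UNIV. v $ n * d n\<bar> \<le> (\<Sum>n\<in>UNIV. \<bar>v $ n * d n\<bar>)"
    by (rule sum_abs)
  also have "\<dots> \<le> (\<Sum>n\<in>UNIV. norm v * B n)"
    unfolding abs_mult by (intro sum_mono mult_mono component_le_norm_cart assms) auto
  finally show ?thesis
    by (simp add: sum_distrib_left mult.commute)
qed

lemma lipschitz_from_partials:
  fixes k :: "real^'n::finite \<Rightarrow> real"
  assumes "convex I" and k: "k differentiable_on I"
    and B: "\<And>z n. z \<in> I \<Longrightarrow> \<bar>partial_on I n k z\<bar> \<le> B n" and z: "z \<in> I" "z' \<in> I"
  shows "\<bar>k z - k z'\<bar> \<le> (\<Sum>n\<in>UNIV. B n) * norm (z - z')"
proof -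
  have "norm (k z - k z') \<le> (\<Sum>n\<in>UNIV. B n) * norm (z - z')"
  proof (rule differentiable_bound[OF \<open>convex I\<close> has_derivative_partial_on[OF k] _ z])
    fix x assume x: "x \<in> I"
    then have "0 \<le> B n" for n
      using B[OF x, of n] by linarith
    then show "onorm (\<lambda>v. \<Sum>n\<in>UNIV. v $ n * partial_on I n k x) \<le> (\<Sum>n\<in>UNIV. B n)"
      using abs_sum_mult_component_le[of "\<lambda>n. partial_on I n k x" B] B[OF x]
      by (intro onorm_bound sum_nonneg) auto
  qed
  then show ?thesis by simp
qed

text \<open>Integrating the linear bound on the gradient along the segment gives the mean
  \<open>(norm z + norm z') / 2\<close>; a mere supremum bound would lose the factor \<open>2\<close> needed below.\<close>

lemma quadratic_lipschitz:
  fixes h :: "real^'n::finite \<Rightarrow> real"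
  assumes "convex I" and h: "h differentiable_on I"
    and K: "\<And>z. z \<in> I \<Longrightarrow> (\<Sum>n\<in>UNIV. \<bar>partial_on I n h z\<bar>) \<le> K * norm z" and "0 \<le> K"
    and z: "z \<in> I" "z' \<in> I"
  shows "\<bar>h z - h z'\<bar> \<le> K * ((norm z + norm z') / 2 * norm (z - z'))"
proof -
  define c where "c t = z' + t *\<^sub>R (z - z')" for t :: real
  have c_eq: "c t = (1 - t) *\<^sub>R z' + t *\<^sub>R z" for t
    by (simp add: c_def algebra_simps)
  have cI: "c t \<in> I" if "t \<in> {0..1}" for t
    unfolding c_eq using that z \<open>convex I\<close> by (intro convexD) auto
  define h' where "h' t = (\<Sum>n\<in>UNIV. (z - z') $ n * partial_on I n h (c t))" for t
  \<comment> \<open>A primitive, as a function of \<open>t\<close>, of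
    \<open>K * norm (z - z') * ((1 - t) * norm z' + t * norm z)\<close>, which bounds the derivative
    along the segment by convexity of the norm.\<close>
  define q where "q t = K * norm (z - z') * (norm z' * t + (norm z - norm z') * (t\<^sup>2 / 2))" for t :: real
  have der: "((\<lambda>t. h (c t)) has_vector_derivative h' t) (at t within {0..1})" if t: "t \<in> {0..1}" for t
  proof -
    have "(c has_derivative (\<lambda>s. s *\<^sub>R (z - z'))) (at t within {0..1})"
      unfolding c_def by (auto intro!: derivative_eq_intros)
    moreover have "(h has_derivative (\<lambda>v. \<Sum>n\<in>UNIV. v $ n * partial_on I n h (c t))) (at (c t) within c ` {0..1})"
      using has_derivative_partial_on[OF h cI[OF t]] by (rule has_derivative_subset) (use cI in auto)
    ultimately have "(h \<circ> c has_derivative (\<lambda>v. \<Sum>n\<in>UNIV. v $ n * partial_on I n h (c t)) \<circ> (\<lambda>s. s *\<^sub>R (z - z'))) (at t within {0..1})"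
      by (rule diff_chain_within)
    then show ?thesis
      by (simp add: has_vector_derivative_def o_def h'_def sum_distrib_left mult.assoc)
  qed
  have "norm (h (c 1) - h (c 0)) \<le> q 1 - q 0"
  proof (rule differentiable_bound_general)
    show "continuous_on {0..1} (\<lambda>t. h (c t))"
      using der by (meson has_vector_derivative_continuous continuous_on_eq_continuous_within)
    show "continuous_on {0..1} q"
      unfolding q_def by (auto intro!: continuous_intros)
    fix t :: real assume t: "0 < t" "t < 1"
    then show "((\<lambda>t. h (c t)) has_vector_derivative h' t) (at t)"
      using der[of t] at_within_interior[of t "{0..1}"] by simp
    show "(q has_vector_derivative K * norm (z - z') * ((1 - t) * norm z' + t * norm z)) (at t)"
      unfolding q_def has_real_derivative_iff_has_vector_derivative[symmetric]
      by (auto intro!: derivative_eq_intros simp: field_simps)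
    have "norm (h' t) \<le> (\<Sum>n\<in>UNIV. \<bar>partial_on I n h (c t)\<bar>) * norm (z - z')"
      unfolding h'_def real_norm_def by (rule abs_sum_mult_component_le) simp
    also have "\<dots> \<le> K * norm (c t) * norm (z - z')"
      using K[OF cI] t by (intro mult_right_mono) auto
    also have "\<dots> \<le> K * ((1 - t) * norm z' + t * norm z) * norm (z - z')"
    proof (intro mult_right_mono mult_left_mono)
      show "norm (c t) \<le> (1 - t) * norm z' + t * norm z"
        unfolding c_eq using t norm_triangle_ineq[of "(1 - t) *\<^sub>R z'" "t *\<^sub>R z"] by simp
    qed (use \<open>0 \<le> K\<close> in auto)
    finally show "norm (h' t) \<le> K * norm (z - z') * ((1 - t) * norm z' + t * norm z)"
      by (simp add: mult_ac)
  qed simp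
  also have "q 1 - q 0 = K * ((norm z + norm z') / 2 * norm (z - z'))"
    by (simp add: q_def field_simps)
  finally show ?thesis
    by (simp add: c_def)
qed

text \<open>The first bound uses the first partials alone. For the second, the partials vanish at 0
  and are Lipschitz with constants formed from the second partials, so the gradient grows at most
  linearly and \<open>quadratic_lipschitz\<close> applies.\<close>

lemma C2_estimates:
  fixes h :: "real^'n::finite \<Rightarrow> real"
  assumes I: "I = cball 0 r" "0 < r" and C2: "C2_on I h" and grad: "GDERIV h 0 :> 0"
    and z: "z \<in> I" "z' \<in> I"
  shows "\<bar>h z - h z'\<bar> \<le> C2_norm I h * norm (z - z')"
    and "\<bar>h z - h z'\<bar> \<le> C2_norm I h * ((norm z + norm z') / 2 * norm (z - z'))"
    and "0 \<le> C2_norm I h"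
proof -
  have cI: "compact I" "convex I" "0 \<in> I" and int: "0 \<in> interior I"
    using I by auto
  have d: "h differentiable_on I" "\<And>n. partial_on I n h differentiable_on I"
    and c2: "\<And>n l. continuous_on I (partial_on I n (partial_on I l h))"
    using C2 by (auto simp: C2_on_def)
  note c = differentiable_imp_continuous_on[OF d(1)] differentiable_imp_continuous_on[OF d(2)]
  define K0 where "K0 = C_norm I h"
  define K1 where "K1 n = C_norm I (partial_on I n h)" for n
  define K2 where "K2 n l = C_norm I (partial_on I n (partial_on I l h))" for n l
  have K_nonneg: "0 \<le> K0" "0 \<le> K1 n" "0 \<le> K2 n l" for n l
    unfolding K0_def K1_def K2_def using C_norm_bounds(2)[OF cI(1) _ cI(3)] c c2 by auto
  have K1: "\<bar>partial_on I n h z\<bar> \<le> K1 n" if "z \<in> I" for n z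
    unfolding K1_def by (rule C_norm_bounds(1)[OF cI(1) c(2) that])
  have K2: "\<bar>partial_on I n (partial_on I l h) z\<bar> \<le> K2 n l" if "z \<in> I" for n l z
    unfolding K2_def by (rule C_norm_bounds(1)[OF cI(1) c2 that])
  have norm_eq: "C2_norm I h = K0 + (\<Sum>n\<in>UNIV. K1 n) + (\<Sum>n\<in>UNIV. \<Sum>l\<in>UNIV. K2 n l)"
    by (simp add: C2_norm_def K0_def K1_def K2_def)
  have sum_nn: "0 \<le> (\<Sum>n\<in>UNIV. K1 n)" "0 \<le> (\<Sum>n\<in>UNIV. \<Sum>l\<in>UNIV. K2 n l)"
    using K_nonneg by (auto intro!: sum_nonneg)
  show nn: "0 \<le> C2_norm I h"
    unfolding norm_eq using K_nonneg(1) sum_nn by simp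
  have "\<bar>h z - h z'\<bar> \<le> (\<Sum>n\<in>UNIV. K1 n) * norm (z - z')"
    by (rule lipschitz_from_partials[OF cI(2) d(1) K1 z])
  also have "\<dots> \<le> C2_norm I h * norm (z - z')"
    unfolding norm_eq using K_nonneg(1) sum_nn by (intro mult_right_mono) auto
  finally show "\<bar>h z - h z'\<bar> \<le> C2_norm I h * norm (z - z')" .
  \<comment> \<open>The origin is interior to \<open>I\<close>, where the derivative within
    \<open>I\<close> is unique and agrees with the gradient in the hypothesis.\<close>
  have at0: "partial_on I n h 0 = 0" for n
  proof -
    have "(h has_derivative (\<lambda>v. v \<bullet> 0)) (at 0)"
      using grad by (simp add: gderiv_def)
    from frechet_derivative_at[OF this] show ?thesis
      unfolding partial_on_def at_within_interior[OF int] by (simp add: fun_eq_iff)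
  qed
  show "\<bar>h z - h z'\<bar> \<le> C2_norm I h * ((norm z + norm z') / 2 * norm (z - z'))"
  proof (rule quadratic_lipschitz[OF cI(2) d(1) _ nn z])
    fix y assume y: "y \<in> I"
    have "\<bar>partial_on I l h y\<bar> \<le> (\<Sum>n\<in>UNIV. K2 n l) * norm y" for l
      using lipschitz_from_partials[OF cI(2) d(2) K2 y cI(3), of l] by (simp add: at0)
    then have "(\<Sum>l\<in>UNIV. \<bar>partial_on I l h y\<bar>) \<le> (\<Sum>l\<in>UNIV. (\<Sum>n\<in>UNIV. K2 n l) * norm y)"
      by (intro sum_mono)
    also have "\<dots> = (\<Sum>n\<in>UNIV. \<Sum>l\<in>UNIV. K2 n l) * norm y"
      by (subst sum.swap) (simp add: sum_distrib_right)
    also have "\<dots> \<le> C2_norm I h * norm y"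
      unfolding norm_eq using K_nonneg(1) sum_nn by (intro mult_right_mono) auto
    finally show "(\<Sum>l\<in>UNIV. \<bar>partial_on I l h y\<bar>) \<le> C2_norm I h * norm y" .
  qed
qed

lemma borel_measurable_vec_iff:
  fixes u :: "real^3 \<Rightarrow> real^'n::finite"
  shows "u \<in> borel_measurable M \<longleftrightarrow> (\<forall>m. (\<lambda>x. u x $ m) \<in> borel_measurable M)"
  by (subst borel_measurable_euclidean_space) (auto simp: Basis_vec_def inner_axis)

lemma
  fixes u :: "real^3 \<Rightarrow> real^'n::finite"
  shows square_integrable_vec_iff: "square_integrable u \<longleftrightarrow> (\<forall>m. square_integrable (\<lambda>x. u x $ m))"
    and l2n_vec: "square_integrable u \<Longrightarrow> (l2n u)\<^sup>2 = (\<Sum>m\<in>UNIV. (l2n (\<lambda>x. u x $ m))\<^sup>2)"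
proof -
  have norm_eq: "(norm (u x))\<^sup>2 = (\<Sum>m\<in>UNIV. (norm (u x $ m))\<^sup>2)" for x
    unfolding power2_norm_eq_inner inner_vec_def ..
  show iff: "square_integrable u \<longleftrightarrow> (\<forall>m. square_integrable (\<lambda>x. u x $ m))"
  proof
    assume u: "square_integrable u"
    show "\<forall>m. square_integrable (\<lambda>x. u x $ m)"
      using square_integrable_measurable[OF u] component_le_norm_cart[of "u x" for x]
      by (intro allI square_integrable_bound(1)[OF u, where K=1]) (auto simp: borel_measurable_vec_iff)
  next
    assume "\<forall>m. square_integrable (\<lambda>x. u x $ m)"
    then show "square_integrable u"
      unfolding square_integrable_def norm_eq by (auto simp: borel_measurable_vec_iff)
  qed
  assume "square_integrable u"
  then have "integrable lebesgue (\<lambda>x. (norm (u x $ m))\<^sup>2)" for m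
    using iff square_integrable_integrable by blast
  then show "(l2n u)\<^sup>2 = (\<Sum>m\<in>UNIV. (l2n (\<lambda>x. u x $ m))\<^sup>2)"
    unfolding l2n_power2 norm_eq by (rule Bochner_Integration.integral_sum)
qed

text \<open>Off \<open>I\<close> nothing is known about \<open>h\<close>. Setting it to 0 there
  gives a Borel function, and the composition changes only on a null set, which the completed
  measure tolerates.\<close>

lemma measurable_continuous_on_AE:
  fixes h :: "real^'n::finite \<Rightarrow> real" and a :: "real^3 \<Rightarrow> real^'n"
  assumes a: "a \<in> borel_measurable lebesgue" "AE x in lebesgue. a x \<in> I"
    and h: "continuous_on I h" "closed I"
  shows "(\<lambda>x. h (a x)) \<in> borel_measurable lebesgue"
proof (rule borel_measurable_AE)
  have "(\<lambda>z. indicator I z *\<^sub>R h z) \<in> borel_measurable borel"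
    using h by (intro borel_measurable_continuous_on_indicator) auto
  from measurable_compose[OF a(1) this]
  show "(\<lambda>x. indicator I (a x) *\<^sub>R h (a x)) \<in> borel_measurable lebesgue" .
  show "AE x in lebesgue. indicator I (a x) *\<^sub>R h (a x) = h (a x)"
    using a(2) by eventually_elim simp
qed

text \<open>The linear bound gives the \<open>L\<^sup>2\<close> estimate, and the quadratic bound
  with Cauchy-Schwarz gives the \<open>L\<^sup>1\<close> estimate. Taking \<open>b\<close> to be 0
  recovers estimates of a single composition when \<open>h\<close> vanishes at 0.\<close>

lemma superposition_estimates:
  fixes h :: "real^'n::finite \<Rightarrow> real" and a b :: "real^3 \<Rightarrow> real^'n"
  assumes I: "I = cball 0 r" "0 < r" and C2: "C2_on I h" and grad: "GDERIV h 0 :> 0" and M: "C2_norm I h \<le> M"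
    and a: "square_integrable a" "AE x in lebesgue. a x \<in> I"
    and b: "square_integrable b" "AE x in lebesgue. b x \<in> I"
  shows "integrable lebesgue (\<lambda>x. h (a x) - h (b x))"
    and "L1_norm (\<lambda>x. h (a x) - h (b x)) \<le> M * ((l2n a + l2n b) / 2 * l2n (\<lambda>x. a x - b x))"
    and "square_integrable (\<lambda>x. h (a x) - h (b x))"
    and "l2n (\<lambda>x. h (a x) - h (b x)) \<le> M * l2n (\<lambda>x. a x - b x)"
    and "AE x in lebesgue. \<bar>h (a x) - h (b x)\<bar> \<le> M * (2 * r)"
proof -
  have "h differentiable_on I"
    using C2 by (auto simp: C2_on_def)
  then have cont: "continuous_on I h"
    by (rule differentiable_imp_continuous_on)
  have "closed I" using I by simp
  note [measurable] = measurable_continuous_on_AE[OF square_integrable_measurable[OF a(1)] a(2) cont \<open>closed I\<close>]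
    measurable_continuous_on_AE[OF square_integrable_measurable[OF b(1)] b(2) cont \<open>closed I\<close>]
    square_integrable_measurable[OF a(1)] square_integrable_measurable[OF b(1)]
  note est = C2_estimates[OF I C2 grad]
  have "0 \<in> I" using I by simp
  then have M0: "0 \<le> M" using est(3) M by force
  have lip: "AE x in lebesgue. \<bar>h (a x) - h (b x)\<bar> \<le> M * norm (a x - b x)"
    using a(2) b(2)
  proof eventually_elim
    case (elim x)
    then show ?case
      using est(1)[of "a x" "b x"] mult_right_mono[OF M norm_ge_zero[of "a x - b x"]] by linarith
  qed
  have quad: "AE x in lebesgue. \<bar>h (a x) - h (b x)\<bar> \<le> M / 2 * (norm (a x) * norm (a x - b x) + norm (b x) * norm (a x - b x))"
    using a(2) b(2)
  proof eventually_elim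
    case (elim x)
    have "\<bar>h (a x) - h (b x)\<bar> \<le> M * ((norm (a x) + norm (b x)) / 2 * norm (a x - b x))"
      using est(2)[OF elim] mult_right_mono[OF M, of "(norm (a x) + norm (b x)) / 2 * norm (a x - b x)"] by simp
    then show ?case
      by (simp add: field_simps)
  qed
  note sqd = square_integrable_diff[OF a(1) b(1)]
  show "square_integrable (\<lambda>x. h (a x) - h (b x))" "l2n (\<lambda>x. h (a x) - h (b x)) \<le> M * l2n (\<lambda>x. a x - b x)"
    using square_integrable_bound[OF sqd, of "\<lambda>x. h (a x) - h (b x)" M] lip M0 by auto
  note ints = integrable_norm_mult[OF a(1) sqd] integrable_norm_mult[OF b(1) sqd]
  have dom: "integrable lebesgue (\<lambda>x. M / 2 * (norm (a x) * norm (a x - b x) + norm (b x) * norm (a x - b x)))"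
    using ints by simp
  show int: "integrable lebesgue (\<lambda>x. h (a x) - h (b x))"
    using quad by (intro Bochner_Integration.integrable_bound[OF dom]) (auto elim!: eventually_mono)
  have "L1_norm (\<lambda>x. h (a x) - h (b x)) \<le> (LINT x|lebesgue. M / 2 * (norm (a x) * norm (a x - b x) + norm (b x) * norm (a x - b x)))"
    unfolding L1_norm_def using quad int dom by (intro integral_mono_AE) auto
  also have "\<dots> = M / 2 * ((LINT x|lebesgue. norm (a x) * norm (a x - b x)) + (LINT x|lebesgue. norm (b x) * norm (a x - b x)))"
    using ints by simp
  also have "\<dots> \<le> M / 2 * (l2n a * l2n (\<lambda>x. a x - b x) + l2n b * l2n (\<lambda>x. a x - b x))"
    using M0 integral_norm_mult_le[OF a(1) sqd] integral_norm_mult_le[OF b(1) sqd]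
    by (intro mult_left_mono add_mono) auto
  finally show "L1_norm (\<lambda>x. h (a x) - h (b x)) \<le> M * ((l2n a + l2n b) / 2 * l2n (\<lambda>x. a x - b x))"
    by (simp add: field_simps)
  show "AE x in lebesgue. \<bar>h (a x) - h (b x)\<bar> \<le> M * (2 * r)"
    using lip a(2) b(2)
  proof eventually_elim
    case (elim x)
    have "norm (a x - b x) \<le> 2 * r"
      using elim(2,3) norm_triangle_ineq4[of "a x" "b x"] by (simp add: I)
    then have "M * norm (a x - b x) \<le> M * (2 * r)"
      using M0 by (rule mult_left_mono)
    then show ?case
      using elim(1) by linarith
  qed
qed

section \<open>The linear equation with a convolution on the right\<close>

text \<open>At the origin the denominator is 0 and the value defaults to 0, so Hermitian symmetry
  holds at every frequency.\<close>

definition solution_symbol ::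
    "real \<Rightarrow> real \<Rightarrow> real \<Rightarrow> (real^3 \<Rightarrow> real) \<Rightarrow> (real^3 \<Rightarrow> real) \<Rightarrow> real^3 \<Rightarrow> complex" where
  "solution_symbol e s t H G p = complex_of_real (e * (2 * pi) powr (3 / 2) / double_symbol s t p) *
     (fourier_integral (\<lambda>x. complex_of_real (H x)) p * fourier_integral (\<lambda>x. complex_of_real (G x)) p)"

lemma solution_symbol_diff:
  assumes "integrable lebesgue G" "integrable lebesgue G'"
  shows "solution_symbol e s t H (\<lambda>x. G x - G' x) p = solution_symbol e s t H G p - solution_symbol e s t H G' p"
  using fourier_integral_diff[OF integrable_of_real[OF assms(1)] integrable_of_real[OF assms(2)], of p]
  by (simp add: solution_symbol_def right_diff_distrib)

lemma solution_symbol_hermitian: "solution_symbol e s t H G (- p) = cnj (solution_symbol e s t H G p)"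
proof -
  have "fourier_integral (\<lambda>x. complex_of_real (\<phi> x)) (- p) = cnj (fourier_integral (\<lambda>x. complex_of_real (\<phi> x)) p)" for \<phi>
    using fourier_integral_cnj[of "\<lambda>x. complex_of_real (\<phi> x)" "- p"] by simp
  then show ?thesis
    by (simp add: solution_symbol_def double_symbol_even)
qed

text \<open>The parameter \<open>b\<close> is the \<open>L\<^sup>2\<close> bound on the source and
  \<open>W\<close> the ratio of its \<open>L\<^sup>1\<close> bound to \<open>b\<close>. The first
  summand comes from the frequency splitting; the second from
  \<open>|p|\<^sup>2 / double_symbol\<close>, which costs the power \<open>2 * (1 - s)\<close> on
  the transform of \<open>H\<close> and leaves a uniform bound on that of \<open>G\<close>.\<close>

lemma solution_symbol_bounds:
  assumes H: "integrable lebesgue H" "frac_laplacian_in_L2 (1 - s) H"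
    and G: "integrable lebesgue G" "square_integrable G"
    and s: "0 < s" "s < 3/4" and W: "0 < W"
    and G1: "L1_norm G \<le> W * b" and G2: "l2n G \<le> b" and b: "0 \<le> b"
  shows "square_integrable (solution_symbol e s t H G)"
    and "square_integrable (\<lambda>p. complex_of_real ((norm p)\<^sup>2) * solution_symbol e s t H G p)"
    and "(l2n (solution_symbol e s t H G))\<^sup>2 + (l2n (\<lambda>p. complex_of_real ((norm p)\<^sup>2) * solution_symbol e s t H G p))\<^sup>2
      \<le> e\<^sup>2 * b\<^sup>2 * ((L1_norm H)\<^sup>2 * W powr (8 * s / 3) * low_freq_const s
          + W\<^sup>2 * (L2_norm (frac_laplacian (1 - s) H))\<^sup>2)"
proof -
  define h where "h p = fourier_integral (\<lambda>x. complex_of_real (H x)) p" for p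
  define g where "g p = fourier_integral (\<lambda>x. complex_of_real (G x)) p" for p
  define c where "c = (2 * pi) powr (3 / 2)"
  have c: "0 < c" "(2 * pi) powr (- 3 / 2) = inverse c"
    by (auto simp: c_def powr_minus[symmetric])
  have [measurable]: "h \<in> borel_measurable lebesgue" "g \<in> borel_measurable lebesgue"
    unfolding h_def g_def using H(1) G(1) by (auto intro!: fourier_integral_measurable)
  note [measurable] = norm_measurable_lebesgue
  define \<psi> where "\<psi> p = complex_of_real (c / double_symbol s t p) * (h p * g p)" for p
  have [measurable]: "\<psi> \<in> borel_measurable lebesgue"
    unfolding \<psi>_def by measurable
  have eq: "solution_symbol e s t H G = (\<lambda>p. complex_of_real e * \<psi> p)"
    by (auto simp: solution_symbol_def \<psi>_def c_def h_def g_def)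
  have \<psi>_le: "AE p in lebesgue. cmod (\<psi> p) \<le> norm p powr (- 2 * s) * (c * cmod (h p) * cmod (g p))"
    using AE_lebesgue_nonzero
  proof eventually_elim
    case (elim p)
    have pos: "0 < norm p powr (2 * s)"
      using elim by simp
    have "c / double_symbol s t p \<le> c / norm p powr (2 * s)"
      using c pos double_symbol_bounds(1)[OF elim, of s t] double_symbol_pos[OF elim, of s t]
      by (intro divide_left_mono mult_pos_pos) auto
    also have "\<dots> = norm p powr (- 2 * s) * c"
      by (simp add: powr_minus divide_inverse mult.commute)
    finally have "c / double_symbol s t p * (cmod (h p) * cmod (g p)) \<le> norm p powr (- 2 * s) * c * (cmod (h p) * cmod (g p))"
      by (intro mult_right_mono) auto
    moreover have "cmod (\<psi> p) = c / double_symbol s t p * (cmod (h p) * cmod (g p))"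
      using c double_symbol_pos[OF elim, of s t] by (simp add: \<psi>_def norm_mult norm_divide)
    ultimately show ?case
      by (simp add: mult.assoc)
  qed
  note low = low_frequency_bound[OF H(1) G s W G1 G2 b \<open>\<psi> \<in> _\<close> \<psi>_le[unfolded c_def h_def g_def]]
  have g_le: "c * cmod (g p) \<le> W * b" for p
    using norm_fourier_integral_le_L1[OF integrable_of_real[OF G(1)], of p] c(1) G1 unfolding c(2)
    by (simp add: g_def L1_norm_def field_simps)
  have high_le: "AE p in lebesgue. cmod (complex_of_real ((norm p)\<^sup>2) * \<psi> p)
      \<le> W * b * cmod (complex_of_real (norm p powr (2 * (1 - s))) * h p)"
    using AE_lebesgue_nonzero
  proof eventually_elim
    case (elim p)
    have D: "0 < double_symbol s t p"
      by (rule double_symbol_pos[OF elim])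
    have "(norm p)\<^sup>2 / double_symbol s t p \<le> norm p powr (2 * (1 - s))"
      using double_symbol_bounds(3)[OF elim, of s t] D by (simp add: field_simps)
    then have "((norm p)\<^sup>2 / double_symbol s t p * cmod (h p)) * (c * cmod (g p))
        \<le> (norm p powr (2 * (1 - s)) * cmod (h p)) * (W * b)"
      using c W b by (intro mult_mono[OF mult_right_mono g_le]) auto
    moreover have "cmod (complex_of_real ((norm p)\<^sup>2) * \<psi> p) = ((norm p)\<^sup>2 / double_symbol s t p * cmod (h p)) * (c * cmod (g p))"
      using c D by (simp add: \<psi>_def norm_mult norm_divide norm_power)
    moreover have "cmod (complex_of_real (norm p powr (2 * (1 - s))) * h p) = norm p powr (2 * (1 - s)) * cmod (h p)"
      by (simp add: norm_mult)
    ultimately show ?case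
      by (simp only: mult_ac)
  qed
  have "0 \<le> W * b" using W b by simp
  have high_meas: "(\<lambda>p. complex_of_real ((norm p)\<^sup>2) * \<psi> p) \<in> borel_measurable lebesgue"
    by measurable
  note high = square_integrable_bound[OF square_integrable_frac_laplacian_L1[OF H] high_meas \<open>0 \<le> W * b\<close> high_le[unfolded h_def],
      unfolded l2n_frac_laplacian_L1[OF H]]
  have cmult: "square_integrable (\<lambda>p. complex_of_real e * \<theta> p) \<and> l2n (\<lambda>p. complex_of_real e * \<theta> p) = \<bar>e\<bar> * l2n \<theta>"
    if "square_integrable \<theta>" for \<theta>
    using square_integrable_scaleR[OF that, of e] by (simp add: scaleR_conv_of_real)
  have eq2: "(\<lambda>p. complex_of_real ((norm p)\<^sup>2) * solution_symbol e s t H G p) = (\<lambda>p. complex_of_real e * (complex_of_real ((norm p)\<^sup>2) * \<psi> p))"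
    by (auto simp: eq)
  show "square_integrable (solution_symbol e s t H G)"
    "square_integrable (\<lambda>p. complex_of_real ((norm p)\<^sup>2) * solution_symbol e s t H G p)"
    using cmult[OF low(1)] cmult[OF high(1)] unfolding eq2 unfolding eq by auto
  have "(l2n (\<lambda>p. complex_of_real ((norm p)\<^sup>2) * \<psi> p))\<^sup>2 \<le> (W * b * L2_norm (frac_laplacian (1 - s) H))\<^sup>2"
    by (intro power_mono high(2)) simp
  with low(2) have "e\<^sup>2 * ((l2n \<psi>)\<^sup>2 + (l2n (\<lambda>p. complex_of_real ((norm p)\<^sup>2) * \<psi> p))\<^sup>2)
      \<le> e\<^sup>2 * ((L1_norm H)\<^sup>2 * b\<^sup>2 * W powr (8 * s / 3) * low_freq_const s + (W * b * L2_norm (frac_laplacian (1 - s) H))\<^sup>2)"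
    by (intro mult_left_mono add_mono) auto
  also have "e\<^sup>2 * ((l2n \<psi>)\<^sup>2 + (l2n (\<lambda>p. complex_of_real ((norm p)\<^sup>2) * \<psi> p))\<^sup>2)
      = (l2n (solution_symbol e s t H G))\<^sup>2 + (l2n (\<lambda>p. complex_of_real ((norm p)\<^sup>2) * solution_symbol e s t H G p))\<^sup>2"
    using cmult[OF low(1)] cmult[OF high(1)] unfolding eq2 unfolding eq by (simp add: power_mult_distrib ring_distribs)
  finally show "(l2n (solution_symbol e s t H G))\<^sup>2 + (l2n (\<lambda>p. complex_of_real ((norm p)\<^sup>2) * solution_symbol e s t H G p))\<^sup>2
      \<le> e\<^sup>2 * b\<^sup>2 * ((L1_norm H)\<^sup>2 * W powr (8 * s / 3) * low_freq_const s
          + W\<^sup>2 * (L2_norm (frac_laplacian (1 - s) H))\<^sup>2)"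
    by (simp add: power_mult_distrib algebra_simps)
qed

text \<open>An intermediate power is at most \<open>1 + (norm p)\<^sup>2\<close>. This gives both
  fractional Laplacians of the equation from \<open>L\<^sup>2\<close> and \<open>H\<^sup>2\<close>
  membership.\<close>

lemma square_integrable_intermediate_power:
  assumes "square_integrable \<psi>" "square_integrable (\<lambda>p. complex_of_real ((norm p)\<^sup>2) * \<psi> p)"
    and s: "0 \<le> s" "s \<le> 1"
  shows "square_integrable (\<lambda>p. complex_of_real (norm p powr (2 * s)) * \<psi> p)"
proof -
  note [measurable] = square_integrable_measurable[OF assms(1)] norm_measurable_lebesgue
  define \<theta> where "\<theta> p = complex_of_real (cmod (\<psi> p) + cmod (complex_of_real ((norm p)\<^sup>2) * \<psi> p))" for p
  have "square_integrable \<theta>"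
    unfolding \<theta>_def square_integrable_complex_of_real using assms(1,2)
    by (intro square_integrable_add) (auto simp: square_integrable_def)
  then show ?thesis
  proof (rule square_integrable_bound(1)[where K=1])
    show "AE p in lebesgue. cmod (complex_of_real (norm p powr (2 * s)) * \<psi> p) \<le> 1 * cmod (\<theta> p)"
    proof (intro AE_I2)
      fix p :: "real^3"
      have "norm p powr (2 * s) \<le> 1 + (norm p)\<^sup>2"
      proof (cases "norm p \<le> 1")
        case True
        then have "norm p powr (2 * s) \<le> 1"
          using s by (intro powr_le1) auto
        then show ?thesis by (simp add: add_increasing2)
      next
        case False
        then have "norm p powr (2 * s) \<le> norm p powr 2"
          using s by (intro powr_mono) auto
        also have "\<dots> = (norm p)\<^sup>2"
          using False by (simp add: powr_numeral)
        finally show ?thesis by simp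
      qed
      then have "norm p powr (2 * s) * cmod (\<psi> p) \<le> (1 + (norm p)\<^sup>2) * cmod (\<psi> p)"
        by (rule mult_right_mono) simp
      also have "\<dots> = cmod (\<theta> p)"
        unfolding \<theta>_def norm_of_real by (simp add: norm_mult norm_power algebra_simps)
      finally show "cmod (complex_of_real (norm p powr (2 * s)) * \<psi> p) \<le> 1 * cmod (\<theta> p)"
        by (simp add: norm_mult)
    qed
  qed measurable
qed

lemma linear_solution_exists:
  assumes H: "integrable lebesgue H" "frac_laplacian_in_L2 (1 - s) H"
    and G: "integrable lebesgue G" "square_integrable G" "AE x in lebesgue. \<bar>G x\<bar> \<le> B"
    and s: "0 < s" "s < 3/4" "s < t" "t < 1"
  shows "\<exists>u. has_real_fourier u (solution_symbol e s t H G) \<and> u \<in> sobolev_space 2 \<and>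
    solves_double_scale s t u (\<lambda>x. e * (LINT y|lebesgue. H (x - y) * G y))"
proof -
  \<comment> \<open>A crude bound used with \<open>W = 1\<close>: only membership in the spaces is
    needed here.\<close>
  define b where "b = L1_norm G + l2n G"
  have L1: "0 \<le> L1_norm G" by (simp add: L1_norm_def)
  note sq = solution_symbol_bounds(1,2)[OF H G(1,2) s(1,2), of 1 b e t]
  have sq: "square_integrable (solution_symbol e s t H G)"
    "square_integrable (\<lambda>p. complex_of_real ((norm p)\<^sup>2) * solution_symbol e s t H G p)"
    by (rule sq; use L1 in \<open>simp add: b_def\<close>)+
  obtain u where u: "has_real_fourier u (solution_symbol e s t H G)"
    using real_inverse_fourier[OF sq(1)] solution_symbol_hermitian by fastforce
  define F where "F x = (LINT y|lebesgue. H (x - y) * G y)" for x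
  note conv = integrable_convolution[OF H(1) G(1,3)] square_integrable_convolution[OF H(1) G(1,3)]
  have eF: "integrable lebesgue (\<lambda>x. complex_of_real (e * F x))" "square_integrable (\<lambda>x. complex_of_real (e * F x))"
    using conv(1) square_integrable_scaleR(1)[OF conv(2), of e] unfolding F_def square_integrable_complex_of_real
    by (auto simp: complex_of_real_integrable_eq)
  have FI: "fourier_integral (\<lambda>x. complex_of_real (e * F x)) p
      = complex_of_real (e * (2 * pi) powr (3 / 2)) *
     (fourier_integral (\<lambda>x. complex_of_real (H x)) p * fourier_integral (\<lambda>x. complex_of_real (G x)) p)" for p
    using fourier_convolution[OF H(1) G(1,3), of p] fourier_integral_cmult[of "complex_of_real e" "\<lambda>x. complex_of_real (F x)" p]
    by (simp add: F_def mult.assoc)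
  have "AE p in lebesgue. fourier_integral (\<lambda>x. complex_of_real (e * F x)) p
      = complex_of_real (double_symbol s t p) * solution_symbol e s t H G p"
    using AE_lebesgue_nonzero
  proof eventually_elim
    case (elim p)
    then show ?case
      using double_symbol_pos[OF elim, of s t] unfolding FI solution_symbol_def by simp
  qed
  then have "has_real_fourier (\<lambda>x. e * F x) (\<lambda>p. complex_of_real (double_symbol s t p) * solution_symbol e s t H G p)"
    by (intro has_fourier_L2_cong_AE[OF has_fourier_L2_L1[OF eF]]) auto
  then have "solves_double_scale s t u (\<lambda>x. e * F x)"
    using square_integrable_intermediate_power[OF sq] s by (simp add: solves_double_scale_iff[OF u])
  then show ?thesis
    using u sq(2) sobolev_space_2_iff(1)[OF u] unfolding F_def by blast
qed

lemma linear_solution_sobolev_bound: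
  assumes H: "integrable lebesgue H" "frac_laplacian_in_L2 (1 - s) H"
    and G: "integrable lebesgue G" "square_integrable G"
    and s: "0 < s" "s < 3/4" and W: "0 < W"
    and bnd: "L1_norm G \<le> W * b" "l2n G \<le> b" "0 \<le> b"
    and u: "has_real_fourier u (solution_symbol e s t H G)"
  shows "(sobolev_norm 2 u)\<^sup>2 \<le> e\<^sup>2 * b\<^sup>2 * ((L1_norm H)\<^sup>2 * W powr (8 * s / 3) * low_freq_const s
          + W\<^sup>2 * (L2_norm (frac_laplacian (1 - s) H))\<^sup>2)"
  using solution_symbol_bounds[OF H G s W bnd, of e t] sobolev_space_2_iff[OF u] by simp

text \<open>Here \<open>1/4 < s1\<close> enters: the base \<open>4 * s1\<close> exceeds 1, so the
  powers grow in the exponent as well as in the base, while \<open>3 - 4 * s\<close> decreases in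
  \<open>s\<close>. The whole denominator is therefore smallest with \<open>s1\<close> in the powers
  and \<open>S1\<close> in the linear factor.\<close>

lemma low_freq_const_le:
  assumes "1/4 < s1" "s1 \<le> s" "s \<le> S" "S < 3/4"
  shows "0 \<le> low_freq_const s"
    and "low_freq_const s \<le> (1 / (4 * s1) powr (4 * s1 / 3)) * (3 / ((3 - 4 * S) * (2 * pi\<^sup>2) powr (4 * s1 / 3)))"
proof -
  show "0 \<le> low_freq_const s"
    using assms by (simp add: low_freq_const_def)
  have "1 \<le> 2 * pi\<^sup>2"
    using pi_ge_two power_mono[of 2 pi 2] by simp
  then have 1: "(2 * pi\<^sup>2) powr (4 * s1 / 3) \<le> (2 * pi\<^sup>2) powr (4 * s / 3)"
    using assms by (intro powr_mono) auto
  have "(4 * s1) powr (4 * s1 / 3) \<le> (4 * s) powr (4 * s1 / 3)"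
    using assms by (intro powr_mono2) auto
  also have "\<dots> \<le> (4 * s) powr (4 * s / 3)"
    using assms by (intro powr_mono) auto
  finally have 2: "(4 * s1) powr (4 * s1 / 3) \<le> (4 * s) powr (4 * s / 3)" .
  have "(3 - 4 * S) * (4 * s1) powr (4 * s1 / 3) * (2 * pi\<^sup>2) powr (4 * s1 / 3)
      \<le> (3 - 4 * s) * (4 * s) powr (4 * s / 3) * (2 * pi\<^sup>2) powr (4 * s / 3)"
    using assms by (intro mult_mono 1 2) auto
  moreover have "0 < (3 - 4 * S) * (4 * s1) powr (4 * s1 / 3) * (2 * pi\<^sup>2) powr (4 * s1 / 3)"
    using assms by auto
  ultimately have "low_freq_const s \<le> 3 / ((3 - 4 * S) * (4 * s1) powr (4 * s1 / 3) * (2 * pi\<^sup>2) powr (4 * s1 / 3))"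
    unfolding low_freq_const_def by (intro divide_left_mono) auto
  then show "low_freq_const s \<le> (1 / (4 * s1) powr (4 * s1 / 3)) * (3 / ((3 - 4 * S) * (2 * pi\<^sup>2) powr (4 * s1 / 3)))"
    by (simp add: mult_ac)
qed

section \<open>The contraction\<close>

lemma H2_vec_square_integrable:
  assumes "u \<in> H2_vec"
  shows "square_integrable u"
  using assms by (auto simp: H2_vec_def square_integrable_vec_iff sobolev_space_def)

lemma H2_norm_nonneg [simp]: "0 \<le> H2_norm u"
  by (simp add: H2_norm_def sum_nonneg)

lemma l2n_le_H2_norm:
  assumes "square_integrable u"
  shows "l2n u \<le> H2_norm u"
proof -
  have "(l2n u)\<^sup>2 \<le> (\<Sum>m\<in>UNIV. (sobolev_norm 2 (\<lambda>x. u x $ m))\<^sup>2)"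
    unfolding l2n_vec[OF assms] by (intro sum_mono power_mono l2n_le_sobolev_norm) simp
  then show ?thesis
    unfolding H2_norm_def by (rule real_le_rsqrt)
qed

text \<open>The Euclidean length and \<open>H2_norm\<close> are both root sums of squares over
  components, so the scalar constant carries over unchanged.\<close>

lemma sobolev_embedding_vec:
  assumes "sobolev_embedding_const c" "u \<in> H2_vec"
  shows "AE x in lebesgue. norm (u x) \<le> c * H2_norm u"
proof -
  have c: "0 < c" and emb: "\<And>m. AE x in lebesgue. \<bar>u x $ m\<bar> \<le> c * sobolev_norm 2 (\<lambda>x. u x $ m)"
    using assms unfolding sobolev_embedding_const_def H2_vec_def by auto
  have "AE x in lebesgue. \<forall>m\<in>UNIV. \<bar>u x $ m\<bar> \<le> c * sobolev_norm 2 (\<lambda>x. u x $ m)"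
    using emb by (intro AE_finite_allI) auto
  then show ?thesis
  proof eventually_elim
    case (elim x)
    have "(norm (u x))\<^sup>2 = (\<Sum>m\<in>UNIV. \<bar>u x $ m\<bar>\<^sup>2)"
      unfolding power2_norm_eq_inner inner_vec_def by (simp add: power2_eq_square)
    also have "\<dots> \<le> (\<Sum>m\<in>UNIV. (c * sobolev_norm 2 (\<lambda>x. u x $ m))\<^sup>2)"
      using elim by (intro sum_mono power_mono) auto
    also have "\<dots> = (c * H2_norm u)\<^sup>2"
      by (simp add: H2_norm_def power_mult_distrib sum_nonneg sum_distrib_left)
    finally show ?case
      by (rule power2_le_imp_le) (use c in simp)
  qed
qed

text \<open>The excess of \<open>norm (a x)\<close> over \<open>r\<close> is dominated by
  \<open>norm (f n x - a x)\<close> for every \<open>n\<close>, hence has norm 0. This avoids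
  extracting a pointwise convergent subsequence.\<close>

lemma l2_limit_in_cball:
  fixes a :: "real^3 \<Rightarrow> 'b::euclidean_space"
  assumes "square_integrable a" "\<And>n. square_integrable (f n)"
    and lim: "(\<lambda>n::nat. l2n (\<lambda>x. f n x - a x)) \<longlonglongrightarrow> 0" and r: "\<And>n. AE x in lebesgue. f n x \<in> cball 0 r"
  shows "AE x in lebesgue. a x \<in> cball 0 r"
proof -
  note [measurable] = square_integrable_measurable[OF assms(1)]
  define \<theta> where "\<theta> x = max 0 (norm (a x) - r)" for x
  have bound: "AE x in lebesgue. norm (\<theta> x) \<le> 1 * norm (f n x - a x)" for n
    using r[of n]
  proof eventually_elim
    case (elim x)
    then have "norm (a x) \<le> r + norm (f n x - a x)"
      using norm_triangle_ineq4[of "f n x" "f n x - a x"] by simp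
    then show ?case by (auto simp: \<theta>_def)
  qed
  have meas: "\<theta> \<in> borel_measurable lebesgue"
    unfolding \<theta>_def by measurable
  have \<theta>: "square_integrable \<theta>" "l2n \<theta> \<le> l2n (\<lambda>x. f n x - a x)" for n
    using square_integrable_bound[OF square_integrable_diff[OF assms(2)[of n] assms(1)] meas _ bound[of n]] by auto
  have "l2n \<theta> \<le> 0"
    using lim by (rule tendsto_lowerbound) (auto simp: \<theta>)
  then have "l2n \<theta> = 0"
    using l2n_nonneg by (rule antisym)
  then have "AE x in lebesgue. \<theta> x = 0"
    using l2n_eq_0_iff[OF \<theta>(1)] by blast
  then show ?thesis
    by eventually_elim (auto simp: \<theta>_def max_def split: if_splits)
qed

theorem theorem1p3:
  fixes s1m s2m epsm :: "'n::finite \<Rightarrow> real"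
    and f H :: "'n \<Rightarrow> real^3 \<Rightarrow> real"
    and u0 :: "real^3 \<Rightarrow> real^'n"
    and g :: "real^'n \<Rightarrow> real^'n"
    and I :: "(real^'n) set"
    and eps s1 S1 Hc Qc ce M \<rho> :: real
  assumes "CARD('n) \<ge> 2"
    and "\<And>m. 1/4 < s1m m \<and> s1m m < 3/4"
    and "\<And>m. s1m m < s2m m \<and> s2m m < 1"
    and "\<And>m. epsm m \<ge> 0"
    and "eps = Max (range epsm)" and "s1 = Min (range s1m)" and "S1 = Max (range s1m)"
    and "\<And>m. integrable lebesgue (f m)" and "\<And>m. frac_laplacian_in_L2 (1 - s1m m) (f m)"
    and "\<And>m. integrable lebesgue (H m)" and "\<And>m. frac_laplacian_in_L2 (1 - s1m m) (H m)"
    and "\<exists>m. \<not> (AE x in lebesgue. f m x = 0)"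
    and "Hc = sqrt (\<Sum>m\<in>UNIV. (L1_norm (H m))\<^sup>2)" and "Hc\<^sup>2 > 0"
    and "Qc = sqrt (\<Sum>m\<in>UNIV. (L2_norm (frac_laplacian (1 - s1m m) (H m)))\<^sup>2)" and "Qc\<^sup>2 > 0"
    and "\<And>m. (\<lambda>x. u0 x $ m) \<in> sobolev_space (2 * s2m m)"
    and "\<And>m. solves_double_scale (s1m m) (s2m m) (\<lambda>x. u0 x $ m) (f m)"
    and "sobolev_embedding_const ce"
    and "I = {z. norm z \<le> ce * H2_norm u0 + ce}"
    and "M > 0"
    and "g 0 = 0" and "\<And>m. GDERIV (\<lambda>z. g z $ m) 0 :> 0"
    and "\<And>m. C2_on I (\<lambda>z. g z $ m)" and "C2_norm_vec I g \<le> M"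
    and "\<exists>z\<in>I. g z \<noteq> 0"
    and "0 < \<rho>" and "\<rho> \<le> 1"
    and "0 < eps"
    and "eps \<le> \<rho> / (M * (H2_norm u0 + 1)\<^sup>2) *
           (Hc\<^sup>2 * (H2_norm u0 + 1) powr (8 * S1 / 3 - 2) * (1 / (4 * s1) powr (4 * s1 / 3)) *
              (3 / ((3 - 4 * S1) * (2 * pi\<^sup>2) powr (4 * s1 / 3))) + Qc\<^sup>2) powr (- 1 / 2)"
  shows "\<exists>\<tau>.
      (\<forall>v\<in>H2_ball \<rho>. \<tau> v \<in> H2_ball \<rho> \<and> solves_system s1m s2m epsm H g u0 v (\<tau> v) \<and>
         (\<forall>u\<in>H2_ball \<rho>. solves_system s1m s2m epsm H g u0 v u \<longrightarrow>
            (AE x in lebesgue. u x = \<tau> v x))) \<and>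
      (\<exists>k. 0 \<le> k \<and> k < 1 \<and>
         (\<forall>v\<in>H2_ball \<rho>. \<forall>w\<in>H2_ball \<rho>.
            H2_norm (\<lambda>x. \<tau> v x - \<tau> w x) \<le> k * H2_norm (\<lambda>x. v x - w x))) \<and>
      (\<exists>up\<in>H2_ball \<rho>.
         (AE x in lebesgue. \<tau> up x = up x) \<and>
         (\<forall>w\<in>H2_ball \<rho>. (AE x in lebesgue. \<tau> w x = w x) \<longrightarrow> (AE x in lebesgue. w x = up x)) \<and>
         solves_system s1m s2m epsm H g u0 up up \<and>
         (\<forall>w\<in>H2_ball \<rho>. solves_system s1m s2m epsm H g u0 w w \<longrightarrow>
            (AE x in lebesgue. w x = up x)))"
proof -

  \<comment> \<open>Constants and the smallness condition\<close>
  define U where "U = H2_norm u0"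
  define W where "W = U + 1"
  \<comment> \<open>The bracket of the smallness condition. The 2 subtracted in the exponent of
    \<open>W\<close> comes from factoring \<open>W\<^sup>2\<close> out of both summands of the
    Sobolev bound.\<close>
  define X where "X = Hc\<^sup>2 * W powr (8 * S1 / 3 - 2) * (1 / (4 * s1) powr (4 * s1 / 3)) *
              (3 / ((3 - 4 * S1) * (2 * pi\<^sup>2) powr (4 * s1 / 3))) + Qc\<^sup>2"
  define q where "q = eps * M * W * sqrt X"
  note s = assms(2) and st = assms(3) and Hm = assms(10,11)
  have s_bounds: "s1 \<le> s1m m" "s1m m \<le> S1" "epsm m \<le> eps" for m
    using assms(5,6,7) by auto
  have "1/4 < s1" "S1 < 3/4"
  proof -
    have "s1 \<in> range s1m" "S1 \<in> range s1m"
      unfolding assms(6,7) by (auto intro!: Min_in Max_in)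
    then show "1/4 < s1" "S1 < 3/4"
      using s by auto
  qed
  have s': "0 < s1m m" "s1m m < 3/4" for m
    using s[of m] by auto
  have M: "0 < M" and \<rho>: "0 < \<rho>" "\<rho> \<le> 1" and eps: "0 < eps"
    using assms by auto
  have U0: "0 \<le> U" by (simp add: U_def)
  have W1: "1 \<le> W" "0 < W" using U0 by (auto simp: W_def)
  have ce: "0 < ce"
    using assms(19) by (simp add: sobolev_embedding_const_def)
  have I: "I = cball 0 (ce * U + ce)" "0 < ce * U + ce"
    using assms(20) ce U0 by (auto simp: U_def add_nonneg_pos)
  have Icl: "z \<in> I \<longleftrightarrow> norm z \<le> ce * U + ce" for z
    by (simp add: I)
  have I0: "0 \<in> I" using I by simp
  have C2: "C2_on I (\<lambda>z. g z $ m)" and grad: "GDERIV (\<lambda>z. g z $ m) 0 :> 0" for m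
    using assms(23,24) by auto
  have C2M: "C2_norm I (\<lambda>z. g z $ m) \<le> M" for m
  proof -
    have "C2_norm I (\<lambda>z. g z $ m) \<le> C2_norm_vec I g"
      unfolding C2_norm_vec_def
      using C2_estimates(3)[OF I C2 grad I0 I0] by (intro member_le_sum) auto
    then show ?thesis using assms(25) by simp
  qed
  have u0: "u0 \<in> H2_vec"
    using solution_in_sobolev_space_2[OF _ assms(18) assms(8,9)] assms(17)
    by (auto simp: H2_vec_def sobolev_space_def)
  have u0_sq: "square_integrable u0"
    by (rule H2_vec_square_integrable[OF u0])
  \<comment> \<open>If \<open>u0\<close> vanished, its transform would be 0 and the equation would
    force every \<open>f m\<close> to vanish almost everywhere.\<close>
  have U_pos: "0 < U"
  proof (rule ccontr)
    assume "\<not> 0 < U"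
    then have "l2n u0 \<le> 0"
      using l2n_le_H2_norm[OF u0_sq] by (simp add: U_def)
    then have "l2n u0 = 0"
      using l2n_nonneg by (rule antisym)
    then have zero: "AE x in lebesgue. u0 x = 0"
      using l2n_eq_0_iff[OF u0_sq] by simp
    have "AE x in lebesgue. f m x = 0" for m
    proof -
      have z: "AE x in lebesgue. (\<lambda>_. 0) x = u0 x $ m"
        using zero by eventually_elim simp
      \<comment> \<open>Whatever transform 0 has, subtracting it from itself shows that 0 is
        one.\<close>
      have z0: "has_real_fourier (\<lambda>_. 0) (\<lambda>_. 0)"
        using has_real_fourier_exists[of "\<lambda>_. 0"] has_real_fourier_diff[of "\<lambda>_. 0" _ "\<lambda>_. 0"] by fastforce
      have "has_real_fourier (\<lambda>x. u0 x $ m) (\<lambda>_. 0)"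
        by (rule has_real_fourier_cong_AE[OF z0 z]) simp
      from solves_double_scale_iff[OF this] assms(18)[of m]
      have "has_real_fourier (f m) (\<lambda>_. 0)"
        by simp
      from has_real_fourier_unique[OF this z0] show ?thesis
        by simp
    qed
    then show False
      using assms(12) by blast
  qed
  have X_pos: "0 < X"
  proof -
    have "0 \<le> Hc\<^sup>2 * W powr (8 * S1 / 3 - 2) * (1 / (4 * s1) powr (4 * s1 / 3)) *
              (3 / ((3 - 4 * S1) * (2 * pi\<^sup>2) powr (4 * s1 / 3)))"
      using \<open>S1 < 3/4\<close> by simp
    then show ?thesis
      unfolding X_def using assms(16) by (rule add_nonneg_pos)
  qed
  have qW: "q * W \<le> \<rho>"
  proof -
    have "eps \<le> \<rho> / (M * W\<^sup>2) * X powr (- 1 / 2)"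
      using assms(30) by (simp add: X_def W_def U_def)
    also have "X powr (- 1 / 2) = 1 / sqrt X"
      using X_pos by (simp add: powr_minus_divide powr_half_sqrt)
    finally have "eps * (M * W\<^sup>2 * sqrt X) \<le> \<rho> / (M * W\<^sup>2) * (1 / sqrt X) * (M * W\<^sup>2 * sqrt X)"
      using M W1 X_pos by (intro mult_right_mono) auto
    also have "\<dots> = \<rho>"
      using M W1 X_pos by (simp add: field_simps)
    finally show ?thesis
      by (simp add: q_def power2_eq_square mult_ac)
  qed
  have q0: "0 \<le> q"
    using eps M W1 X_pos by (simp add: q_def)
  have q1: "q < 1"
  proof (rule ccontr)
    assume "\<not> q < 1"
    then have "1 * W \<le> q * W"
      using W1 by (intro mult_right_mono) auto
    also note qW
    also note \<rho>(2)
    finally have "W \<le> 1"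
      by simp
    then show False
      using U_pos by (simp add: W_def)
  qed

  \<comment> \<open>Estimates of the nonlinearity and of the linear solution\<close>
  define G where "G a m y = g (a y) $ m" for a :: "real^3 \<Rightarrow> real^'n" and m y
  define symb where "symb m = solution_symbol (epsm m) (s1m m) (s2m m) (H m)" for m
  \<comment> \<open>The class contains 0 and every \<open>u0 + v\<close> with \<open>v\<close> in
    the ball, but asks for no \<open>H\<^sup>2\<close> regularity, so it also accepts
    \<open>u0\<close> plus an \<open>L\<^sup>2\<close> limit of iterates.\<close>
  define adm where "adm a \<longleftrightarrow> square_integrable a \<and> (AE x in lebesgue. a x \<in> I) \<and> l2n a \<le> W" for a :: "real^3 \<Rightarrow> real^'n"

  \<comment> \<open>Stated for a general source \<open>K\<close>, to be applied both to
    \<open>G a\<close> and to differences of two such sources.\<close>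
  have key: "H2_norm u \<le> q * d"
    if d: "0 \<le> d"
      and K: "\<And>m. integrable lebesgue (K m)" "\<And>m. square_integrable (K m)"
        "\<And>m. L1_norm (K m) \<le> W * (M * d)" "\<And>m. l2n (K m) \<le> M * d"
      and u: "\<And>m. has_real_fourier (\<lambda>x. u x $ m) (symb m (K m))"
    for u :: "real^3 \<Rightarrow> real^'n" and K d
  proof -
    define C where "C = (1 / (4 * s1) powr (4 * s1 / 3)) * (3 / ((3 - 4 * S1) * (2 * pi\<^sup>2) powr (4 * s1 / 3)))"
    have C0: "0 \<le> C"
      using \<open>S1 < 3/4\<close> by (simp add: C_def)
    define L where "L m = L1_norm (H m)" for m
    define Q where "Q m = L2_norm (frac_laplacian (1 - s1m m) (H m))" for m
    have comp: "(sobolev_norm 2 (\<lambda>x. u x $ m))\<^sup>2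
        \<le> eps\<^sup>2 * (M * d)\<^sup>2 * ((L m)\<^sup>2 * (W powr (8 * S1 / 3) * C) + W\<^sup>2 * (Q m)\<^sup>2)" for m
    proof -
      have "(sobolev_norm 2 (\<lambda>x. u x $ m))\<^sup>2 \<le> (epsm m)\<^sup>2 * (M * d)\<^sup>2 * ((L m)\<^sup>2 * W powr (8 * s1m m / 3) * low_freq_const (s1m m)
          + W\<^sup>2 * (Q m)\<^sup>2)"
        unfolding L_def Q_def
        using M d by (intro linear_solution_sobolev_bound[OF Hm K(1,2) s' W1(2) K(3,4) _ u[unfolded symb_def]]) simp
      also have "\<dots> \<le> eps\<^sup>2 * (M * d)\<^sup>2 * ((L m)\<^sup>2 * (W powr (8 * S1 / 3) * C) + W\<^sup>2 * (Q m)\<^sup>2)"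
      proof (rule mult_mono)
        show "(epsm m)\<^sup>2 * (M * d)\<^sup>2 \<le> eps\<^sup>2 * (M * d)\<^sup>2"
          using assms(4) s_bounds(3) by (intro mult_right_mono power_mono) auto
        have low: "0 \<le> low_freq_const (s1m m)" "low_freq_const (s1m m) \<le> C"
          unfolding C_def by (rule low_freq_const_le[OF \<open>1/4 < s1\<close> s_bounds(1,2) \<open>S1 < 3/4\<close>])+
        \<comment> \<open>Since \<open>W \<ge> 1\<close>, its power increases with the
          exponent.\<close>
        have "W powr (8 * s1m m / 3) * low_freq_const (s1m m) \<le> W powr (8 * S1 / 3) * C"
          using W1 s_bounds(2)[of m] low by (intro mult_mono powr_mono) auto
        then have "(L m)\<^sup>2 * (W powr (8 * s1m m / 3) * low_freq_const (s1m m)) \<le> (L m)\<^sup>2 * (W powr (8 * S1 / 3) * C)"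
          by (rule mult_left_mono) simp
        then show "(L m)\<^sup>2 * W powr (8 * s1m m / 3) * low_freq_const (s1m m) + W\<^sup>2 * (Q m)\<^sup>2
            \<le> (L m)\<^sup>2 * (W powr (8 * S1 / 3) * C) + W\<^sup>2 * (Q m)\<^sup>2"
          by (simp add: mult.assoc)
        show "0 \<le> (L m)\<^sup>2 * W powr (8 * s1m m / 3) * low_freq_const (s1m m) + W\<^sup>2 * (Q m)\<^sup>2"
          using low by simp
      qed simp
      finally show ?thesis .
    qed
    have "(H2_norm u)\<^sup>2 = (\<Sum>m\<in>UNIV. (sobolev_norm 2 (\<lambda>x. u x $ m))\<^sup>2)"
      by (simp add: H2_norm_def sum_nonneg)
    also have "\<dots> \<le> (\<Sum>m\<in>UNIV. eps\<^sup>2 * (M * d)\<^sup>2 * ((L m)\<^sup>2 * (W powr (8 * S1 / 3) * C) + W\<^sup>2 * (Q m)\<^sup>2))"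
      by (intro sum_mono comp)
    also have "\<dots> = eps\<^sup>2 * (M * d)\<^sup>2 * (Hc\<^sup>2 * (W powr (8 * S1 / 3) * C) + W\<^sup>2 * Qc\<^sup>2)"
      using assms(13,15)
      by (simp add: L_def Q_def sum_nonneg sum.distrib flip: sum_distrib_left sum_distrib_right)
    also have "\<dots> = eps\<^sup>2 * (M * d)\<^sup>2 * W\<^sup>2 * X"
    proof -
      have "W powr (8 * S1 / 3) = W\<^sup>2 * W powr (8 * S1 / 3 - 2)"
        using W1 by (simp add: powr_diff)
      then show ?thesis
        unfolding X_def C_def by (simp only:) (simp add: ring_distribs mult_ac)
    qed
    also have "\<dots> = (q * d)\<^sup>2"
      using X_pos by (simp add: q_def power_mult_distrib mult_ac)
    finally show ?thesis
      by (rule power2_le_imp_le) (use q0 d in simp)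
  qed

  have G_est: "integrable lebesgue (\<lambda>y. G a m y - G b m y)" "square_integrable (\<lambda>y. G a m y - G b m y)"
      "L1_norm (\<lambda>y. G a m y - G b m y) \<le> W * (M * l2n (\<lambda>x. a x - b x))"
      "l2n (\<lambda>y. G a m y - G b m y) \<le> M * l2n (\<lambda>x. a x - b x)"
      "AE y in lebesgue. \<bar>G a m y - G b m y\<bar> \<le> M * (2 * (ce * U + ce))"
    if a: "adm a" and b: "adm b" for a b m
  proof -
    note est = superposition_estimates[OF I C2[of m] grad[of m] C2M[of m], of a b]
    note ab = a[unfolded adm_def] b[unfolded adm_def]
    show "integrable lebesgue (\<lambda>y. G a m y - G b m y)" "square_integrable (\<lambda>y. G a m y - G b m y)"
      "l2n (\<lambda>y. G a m y - G b m y) \<le> M * l2n (\<lambda>x. a x - b x)"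
      "AE y in lebesgue. \<bar>G a m y - G b m y\<bar> \<le> M * (2 * (ce * U + ce))"
      unfolding G_def using est ab by blast+
    have "L1_norm (\<lambda>y. G a m y - G b m y) \<le> M * ((l2n a + l2n b) / 2 * l2n (\<lambda>x. a x - b x))"
      unfolding G_def using est ab by blast
    \<comment> \<open>The mean of two norms bounded by \<open>W\<close> is again at most
      \<open>W\<close>; with the sum in its place the constant would double.\<close>
    also have "\<dots> \<le> M * (W * l2n (\<lambda>x. a x - b x))"
      using M ab by (intro mult_left_mono mult_right_mono) auto
    finally show "L1_norm (\<lambda>y. G a m y - G b m y) \<le> W * (M * l2n (\<lambda>x. a x - b x))"
      by (simp add: mult_ac)
  qed
  have adm0: "adm (\<lambda>_. 0)"
    using I0 W1 by (simp add: adm_def)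
  have G0: "G (\<lambda>_. 0) m y = 0" for m y
    using assms(22) by (simp add: G_def)
  \<comment> \<open>As \<open>g 0 = 0\<close>, comparison with the zero argument gives the estimates
    for \<open>G a\<close> itself.\<close>
  note G_est0 = G_est[OF _ adm0, unfolded G0 diff_zero]

  \<comment> \<open>The solution operator and its Lipschitz bounds\<close>
  have "\<exists>u. \<forall>m. has_real_fourier (\<lambda>x. u x $ m) (symb m (G a m)) \<and> (\<lambda>x. u x $ m) \<in> sobolev_space 2 \<and>
      solves_double_scale (s1m m) (s2m m) (\<lambda>x. u x $ m) (\<lambda>x. epsm m * (LINT y|lebesgue. H m (x - y) * G a m y))"
    if a: "adm a" for a
  proof -
    have "\<exists>u. has_real_fourier u (symb m (G a m)) \<and> u \<in> sobolev_space 2 \<and>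
      solves_double_scale (s1m m) (s2m m) u (\<lambda>x. epsm m * (LINT y|lebesgue. H m (x - y) * G a m y))" for m
      unfolding symb_def
      by (rule linear_solution_exists[OF Hm G_est0(1)[OF a] G_est0(2)[OF a] G_est0(5)[OF a] s']) (use st in auto)
    then have "\<exists>w. \<forall>m. has_real_fourier (w m) (symb m (G a m)) \<and> w m \<in> sobolev_space 2 \<and>
      solves_double_scale (s1m m) (s2m m) (w m) (\<lambda>x. epsm m * (LINT y|lebesgue. H m (x - y) * G a m y))"
      by (intro choice allI)
    then obtain w where w: "\<And>m. has_real_fourier (w m) (symb m (G a m)) \<and> w m \<in> sobolev_space 2 \<and>
      solves_double_scale (s1m m) (s2m m) (w m) (\<lambda>x. epsm m * (LINT y|lebesgue. H m (x - y) * G a m y))"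
      by blast
    show ?thesis
      by (rule exI[of _ "\<lambda>x. vec_lambda (\<lambda>m. w m x)"]) (use w in simp)
  qed
  then have "\<forall>a. \<exists>u. adm a \<longrightarrow> (\<forall>m. has_real_fourier (\<lambda>x. u x $ m) (symb m (G a m)) \<and> (\<lambda>x. u x $ m) \<in> sobolev_space 2 \<and>
      solves_double_scale (s1m m) (s2m m) (\<lambda>x. u x $ m) (\<lambda>x. epsm m * (LINT y|lebesgue. H m (x - y) * G a m y)))"
    by blast
  then have "\<exists>S. \<forall>a. adm a \<longrightarrow> (\<forall>m. has_real_fourier (\<lambda>x. S a x $ m) (symb m (G a m)) \<and> (\<lambda>x. S a x $ m) \<in> sobolev_space 2 \<and>
      solves_double_scale (s1m m) (s2m m) (\<lambda>x. S a x $ m) (\<lambda>x. epsm m * (LINT y|lebesgue. H m (x - y) * G a m y)))"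
    by (rule choice)
  then obtain S where S_all: "\<forall>a. adm a \<longrightarrow> (\<forall>m. has_real_fourier (\<lambda>x. S a x $ m) (symb m (G a m)) \<and> (\<lambda>x. S a x $ m) \<in> sobolev_space 2 \<and>
      solves_double_scale (s1m m) (s2m m) (\<lambda>x. S a x $ m) (\<lambda>x. epsm m * (LINT y|lebesgue. H m (x - y) * G a m y)))"
    by blast
  have S: "has_real_fourier (\<lambda>x. S a x $ m) (symb m (G a m))"
      "(\<lambda>x. S a x $ m) \<in> sobolev_space 2"
      "solves_double_scale (s1m m) (s2m m) (\<lambda>x. S a x $ m) (\<lambda>x. epsm m * (LINT y|lebesgue. H m (x - y) * G a m y))"
    if "adm a" for a m
    using S_all that by blast+
  have S_H2: "S a \<in> H2_vec" if "adm a" for a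
    using S(2)[OF that] by (simp add: H2_vec_def)
  have S_le: "H2_norm (S a) \<le> q * l2n a" if a: "adm a" for a
    using G_est0[OF a] S(1)[OF a] by (intro key[where K="G a"]) auto
  have S_ball: "S a \<in> H2_ball \<rho>" if a: "adm a" for a
  proof -
    have "q * l2n a \<le> q * W"
      using a q0 by (intro mult_left_mono) (auto simp: adm_def)
    then show ?thesis
      using S_le[OF a] S_H2[OF a] qW by (simp add: H2_ball_def)
  qed
  \<comment> \<open>The symbol is linear in the source, so a difference of solutions is a solution
    with the difference of the sources.\<close>
  have S_diff: "H2_norm (\<lambda>x. S a x - S b x) \<le> q * l2n (\<lambda>x. a x - b x)" if a: "adm a" and b: "adm b" for a b
  proof (rule key[where K="\<lambda>m y. G a m y - G b m y"])
    show "has_real_fourier (\<lambda>x. (S a x - S b x) $ m) (symb m (\<lambda>y. G a m y - G b m y))" for m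
      using has_real_fourier_diff[OF S(1)[OF a, of m] S(1)[OF b, of m]]
      unfolding symb_def solution_symbol_diff[OF G_est0(1)[OF a] G_est0(1)[OF b], abs_def] by simp
  qed (use G_est[OF a b] in auto)
  have S_l2: "l2n (\<lambda>x. S a x - S b x) \<le> q * l2n (\<lambda>x. a x - b x)" if a: "adm a" and b: "adm b" for a b
    using S_diff[OF a b] l2n_le_H2_norm[OF square_integrable_diff[OF S_H2[OF a, THEN H2_vec_square_integrable] S_H2[OF b, THEN H2_vec_square_integrable]]]
    by linarith

  \<comment> \<open>The map on the ball\<close>
  have ball: "square_integrable v" "l2n v \<le> \<rho>" "AE x in lebesgue. norm (v x) \<le> ce"
    if v: "v \<in> H2_ball \<rho>" for v :: "real^3 \<Rightarrow> real^'n"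
  proof -
    have vH: "v \<in> H2_vec" "H2_norm v \<le> \<rho>"
      using v by (auto simp: H2_ball_def)
    show sq: "square_integrable v"
      by (rule H2_vec_square_integrable[OF vH(1)])
    show "l2n v \<le> \<rho>"
      using l2n_le_H2_norm[OF sq] vH(2) by linarith
    have "ce * H2_norm v \<le> ce * 1"
      using ce vH(2) \<rho> by (intro mult_left_mono) auto
    then show "AE x in lebesgue. norm (v x) \<le> ce"
      using sobolev_embedding_vec[OF assms(19) vH(1)] by (auto elim!: eventually_mono)
  qed
  \<comment> \<open>The premises are only the consequences of ball membership that survive
    \<open>L\<^sup>2\<close> limits.\<close>
  have adm_ball: "adm (\<lambda>x. u0 x + v x)"
    if v: "square_integrable v" "l2n v \<le> \<rho>" "AE x in lebesgue. norm (v x) \<le> ce" for v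
    unfolding adm_def
  proof (intro conjI)
    show "square_integrable (\<lambda>x. u0 x + v x)"
      by (rule square_integrable_add[OF u0_sq v(1)])
    show "AE x in lebesgue. u0 x + v x \<in> I"
      using sobolev_embedding_vec[OF assms(19) u0] v(3)
    proof eventually_elim
      case (elim x)
      then show ?case
        using norm_triangle_ineq[of "u0 x" "v x"] by (simp add: Icl U_def)
    qed
    show "l2n (\<lambda>x. u0 x + v x) \<le> W"
      using l2n_triangle[OF u0_sq v(1)] l2n_le_H2_norm[OF u0_sq] v(2) \<rho>(2) by (simp add: W_def U_def)
  qed
  define \<tau> where "\<tau> v = S (\<lambda>x. u0 x + v x)" for v
  have adm_v: "adm (\<lambda>x. u0 x + v x)" if "v \<in> H2_ball \<rho>" for v
    using adm_ball[OF ball[OF that]] .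
  have \<tau>_ball: "\<tau> v \<in> H2_ball \<rho>" if "v \<in> H2_ball \<rho>" for v
    unfolding \<tau>_def by (rule S_ball[OF adm_v[OF that]])
  have \<tau>_solves: "solves_system s1m s2m epsm H g u0 v (\<tau> v)" if "v \<in> H2_ball \<rho>" for v
    using S(3)[OF adm_v[OF that]] unfolding solves_system_def \<tau>_def G_def by blast
  have \<tau>_unique: "AE x in lebesgue. u x = \<tau> v x"
    if v: "v \<in> H2_ball \<rho>" and u: "u \<in> H2_ball \<rho>" "solves_system s1m s2m epsm H g u0 v u" for u v
  proof -
    have sq: "square_integrable (\<lambda>x. w x $ m)" if "w \<in> H2_ball \<rho>" for w :: "real^3 \<Rightarrow> real^'n" and m
      using ball(1)[OF that] by (simp add: square_integrable_vec_iff)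
    have "AE x in lebesgue. u x $ m = \<tau> v x $ m" for m
      using solves_double_scale_unique[OF sq[OF u(1)] _ sq[OF \<tau>_ball[OF v]]] u(2) \<tau>_solves[OF v]
      unfolding solves_system_def by blast
    then have "AE x in lebesgue. \<forall>m\<in>UNIV. u x $ m = \<tau> v x $ m"
      by (intro AE_finite_allI) auto
    then show ?thesis
      by eventually_elim (simp add: vec_eq_iff)
  qed
  have \<tau>_l2: "l2n (\<lambda>x. \<tau> v x - \<tau> w x) \<le> q * l2n (\<lambda>x. v x - w x)"
    and \<tau>_H2: "H2_norm (\<lambda>x. \<tau> v x - \<tau> w x) \<le> q * l2n (\<lambda>x. v x - w x)"
    if "v \<in> H2_ball \<rho>" "w \<in> H2_ball \<rho>" for v w
    using S_l2[OF adm_v adm_v, OF that] S_diff[OF adm_v adm_v, OF that] by (simp_all add: \<tau>_def)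
  have contraction: "H2_norm (\<lambda>x. \<tau> v x - \<tau> w x) \<le> q * H2_norm (\<lambda>x. v x - w x)"
    if v: "v \<in> H2_ball \<rho>" and w: "w \<in> H2_ball \<rho>" for v w
    using \<tau>_H2[OF v w] mult_left_mono[OF l2n_le_H2_norm[OF square_integrable_diff[OF ball(1)[OF v] ball(1)[OF w]]] q0]
    by linarith

  \<comment> \<open>Convergence of the iterates\<close>
  define it where "it n = (\<tau> ^^ n) (\<lambda>_. 0)" for n
  have zero_ball: "(\<lambda>_. 0) \<in> H2_ball \<rho>"
  proof -
    have "S (\<lambda>_. 0) \<in> H2_ball \<rho>"
      by (rule S_ball[OF adm0])
    have z0: "has_real_fourier (\<lambda>_. 0) (\<lambda>_. 0)"
      using has_real_fourier_exists[of "\<lambda>_. 0"] has_real_fourier_diff[of "\<lambda>_. 0" _ "\<lambda>_. 0"] by fastforce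
    have "(\<lambda>_. 0) \<in> sobolev_space 2" "(sobolev_norm 2 (\<lambda>_. 0))\<^sup>2 = 0"
      using sobolev_space_2_iff[OF z0] by simp_all
    then show ?thesis
      using \<rho> by (simp add: H2_ball_def H2_vec_def H2_norm_def)
  qed
  have it_ball: "it n \<in> H2_ball \<rho>" for n
    by (induction n) (simp_all add: it_def zero_ball \<tau>_ball)
  note it_sq = ball(1)[OF it_ball]
  define d where "d = l2n (\<lambda>x. it 1 x - it 0 x)"
  have step: "l2n (\<lambda>x. it (Suc n) x - it n x) \<le> q ^ n * d" for n
  proof (induction n)
    case 0
    show ?case by (simp add: d_def)
  next
    case (Suc n)
    have "l2n (\<lambda>x. it (Suc (Suc n)) x - it (Suc n) x) \<le> q * l2n (\<lambda>x. it (Suc n) x - it n x)"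
      using \<tau>_l2[OF it_ball[of "Suc n"] it_ball[of n]] by (simp add: it_def)
    also have "\<dots> \<le> q * (q ^ n * d)"
      by (intro mult_left_mono Suc q0)
    finally show ?case by (simp add: mult.assoc)
  qed
  have far: "l2n (\<lambda>x. it (n + k) x - it n x) \<le> (\<Sum>i<k. q ^ (n + i) * d)" for n k
  proof (induction k)
    case (Suc k)
    have "l2n (\<lambda>x. it (n + Suc k) x - it n x) \<le> l2n (\<lambda>x. it (Suc (n + k)) x - it (n + k) x) + l2n (\<lambda>x. it (n + k) x - it n x)"
      using l2n_triangle_mid[OF it_sq[of "n + Suc k"] it_sq[of n] it_sq[of "n + k"]] by simp
    then show ?case
      using Suc step[of "n + k"] by simp
  qed simp
  have d0: "0 \<le> d" by (simp add: d_def)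
  have far': "l2n (\<lambda>x. it (n + k) x - it n x) \<le> q ^ n * (d / (1 - q))" for n k
  proof -
    have "(\<Sum>i<k. q ^ i) \<le> 1 / (1 - q)"
      using q0 q1 sum_le_suminf[of "\<lambda>i. q ^ i" "{..<k}"] suminf_geometric[of q] summable_geometric[of q] by simp
    then have "q ^ n * d * (\<Sum>i<k. q ^ i) \<le> q ^ n * d * (1 / (1 - q))"
      using q0 d0 by (intro mult_left_mono) auto
    moreover have "(\<Sum>i<k. q ^ (n + i) * d) = q ^ n * d * (\<Sum>i<k. q ^ i)"
      by (simp add: sum_distrib_left power_add mult_ac)
    ultimately show ?thesis
      using far[of n k] by simp
  qed
  have "(\<lambda>n. q ^ n * (d / (1 - q))) \<longlonglongrightarrow> 0"
    using q0 q1 by (intro tendsto_mult_left_zero LIMSEQ_realpow_zero) auto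
  note far_lim = this
  have "\<exists>v. square_integrable v \<and> (\<lambda>n. l2n (\<lambda>x. it n x - v x)) \<longlonglongrightarrow> 0"
  proof (rule l2_complete[OF it_sq])
    fix e :: real assume e: "0 < e"
    then obtain N where N: "\<And>n. n \<ge> N \<Longrightarrow> q ^ n * (d / (1 - q)) < e"
      using order_tendstoD(2)[OF far_lim e] by (auto simp: eventually_sequentially)
    have "l2n (\<lambda>x. it m x - it n x) < e" if "m \<ge> N" "n \<ge> N" for m n
    proof (cases "n \<le> m")
      case True
      then show ?thesis
        using far'[of n "m - n"] N[OF that(2)] by simp
    next
      case False
      then show ?thesis
        using far'[of m "n - m"] N[OF that(1)] by (simp add: l2n_minus_commute[of "it m"])
    qed
    then show "\<exists>N. \<forall>m\<ge>N. \<forall>n\<ge>N. l2n (\<lambda>x. it m x - it n x) < e"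
      by blast
  qed
  then obtain v where v: "square_integrable v" and lim: "(\<lambda>n. l2n (\<lambda>x. it n x - v x)) \<longlonglongrightarrow> 0"
    by blast
  have v_ce: "AE x in lebesgue. norm (v x) \<le> ce"
    using l2_limit_in_cball[OF v it_sq lim, of ce] ball(3)[OF it_ball] by simp
  have v_\<rho>: "l2n v \<le> \<rho>"
  proof (rule tendsto_lowerbound)
    show "(\<lambda>n. l2n (\<lambda>x. it n x - v x) + \<rho>) \<longlonglongrightarrow> \<rho>"
      using tendsto_add[OF lim tendsto_const[of \<rho>]] by simp
    show "\<forall>\<^sub>F n in sequentially. l2n v \<le> l2n (\<lambda>x. it n x - v x) + \<rho>"
    proof (intro always_eventually allI)
      show "l2n v \<le> l2n (\<lambda>x. it n x - v x) + \<rho>" for n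
        using l2n_diff_abs_le[OF it_sq v, of n] ball(2)[OF it_ball, of n] by linarith
    qed
  qed simp
  \<comment> \<open>Membership of \<open>v\<close> in \<open>H\<^sup>2\<close> is not known here;
    the three limit properties suffice.\<close>
  note adm_lim = adm_ball[OF v v_\<rho> v_ce]

  \<comment> \<open>The fixed point and its uniqueness\<close>
  define up where "up = S (\<lambda>x. u0 x + v x)"
  have up_ball: "up \<in> H2_ball \<rho>"
    unfolding up_def by (rule S_ball[OF adm_lim])
  \<comment> \<open>The shifted iterates converge to \<open>v\<close> as a subsequence and to
    \<open>up\<close> by the Lipschitz bound.\<close>
  have up_v: "AE x in lebesgue. up x = v x"
  proof (rule l2_limit_unique[where f="\<lambda>n. it (Suc n)"])
    show "(\<lambda>n. l2n (\<lambda>x. it (Suc n) x - v x)) \<longlonglongrightarrow> 0"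
      using LIMSEQ_Suc[OF lim] .
    show "(\<lambda>n. l2n (\<lambda>x. it (Suc n) x - up x)) \<longlonglongrightarrow> 0"
    proof (rule tendsto_sandwich[OF _ _ tendsto_const])
      show "(\<lambda>n. q * l2n (\<lambda>x. it n x - v x)) \<longlonglongrightarrow> 0"
        using tendsto_mult_right_zero[OF lim] .
      show "\<forall>\<^sub>F n in sequentially. l2n (\<lambda>x. it (Suc n) x - up x) \<le> q * l2n (\<lambda>x. it n x - v x)"
        using S_l2[OF adm_v[OF it_ball] adm_lim] by (simp add: up_def it_def \<tau>_def)
    qed simp
  qed (use ball(1)[OF up_ball] v it_sq in auto)
  \<comment> \<open>The functions \<open>up\<close> and \<open>v\<close> agree only almost
    everywhere, so \<open>up\<close> cannot be substituted in the chosen operator \<open>S\<close>;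
    the Lipschitz bound with distance 0 takes the place of substitution.\<close>
  have fixed: "AE x in lebesgue. \<tau> up x = up x"
  proof -
    have "l2n (\<lambda>x. up x - v x) = 0"
      using l2n_diff_eq_0_iff[OF ball(1)[OF up_ball] v] up_v by simp
    then have "l2n (\<lambda>x. \<tau> up x - up x) \<le> 0"
      using S_l2[OF adm_v[OF up_ball] adm_lim] by (simp add: \<tau>_def up_def)
    then have "l2n (\<lambda>x. \<tau> up x - up x) = 0"
      using l2n_nonneg by (rule antisym)
    then show ?thesis
      using l2n_diff_eq_0_iff[OF ball(1)[OF \<tau>_ball[OF up_ball]] ball(1)[OF up_ball]] by simp
  qed
  have fixed_unique: "AE x in lebesgue. w x = up x"
    if w: "w \<in> H2_ball \<rho>" and wf: "AE x in lebesgue. \<tau> w x = w x" for w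
  proof -
    note sq = ball(1)[OF w] ball(1)[OF up_ball] ball(1)[OF \<tau>_ball[OF w]] ball(1)[OF \<tau>_ball[OF up_ball]]
    have "AE x in lebesgue. \<tau> w x - \<tau> up x = w x - up x"
      using wf fixed by eventually_elim simp
    from l2n_cong_AE[OF square_integrable_measurable[OF square_integrable_diff[OF sq(3,4)]] this]
    have "l2n (\<lambda>x. w x - up x) \<le> q * l2n (\<lambda>x. w x - up x)"
      using \<tau>_l2[OF w up_ball] by simp
    then have "(1 - q) * l2n (\<lambda>x. w x - up x) \<le> 0"
      by (simp add: algebra_simps)
    then have "l2n (\<lambda>x. w x - up x) = 0"
      using q1 l2n_nonneg[of "\<lambda>x. w x - up x"] by (simp add: mult_le_0_iff)
    then show ?thesis
      using l2n_diff_eq_0_iff[OF sq(1,2)] by simp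
  qed
  \<comment> \<open>The right-hand side already contains \<open>up\<close>; only the unknown changes
    from \<open>\<tau> up\<close> to \<open>up\<close>, and for the unknown the equation is
    invariant under null sets.\<close>
  have up_solves: "solves_system s1m s2m epsm H g u0 up up"
    unfolding solves_system_def
  proof
    fix m
    have ae: "AE x in lebesgue. \<tau> up x $ m = up x $ m"
      using fixed by eventually_elim simp
    have sq: "square_integrable (\<lambda>x. \<tau> up x $ m)"
      using ball(1)[OF \<tau>_ball[OF up_ball]] by (simp add: square_integrable_vec_iff)
    show "solves_double_scale (s1m m) (s2m m) (\<lambda>x. up x $ m)
        (\<lambda>x. epsm m * (LINT y|lebesgue. H m (x - y) * (g (u0 y + up y) $ m)))"
      using \<tau>_solves[OF up_ball] unfolding solves_system_def solves_double_scale_cong_AE[OF sq ae, symmetric]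
      by (rule spec)
  qed
  show ?thesis
  proof (rule exI[of _ \<tau>], intro conjI)
    show "\<forall>v\<in>H2_ball \<rho>. \<tau> v \<in> H2_ball \<rho> \<and> solves_system s1m s2m epsm H g u0 v (\<tau> v) \<and>
         (\<forall>u\<in>H2_ball \<rho>. solves_system s1m s2m epsm H g u0 v u \<longrightarrow> (AE x in lebesgue. u x = \<tau> v x))"
      using \<tau>_ball \<tau>_solves \<tau>_unique by blast
    show "\<exists>k. 0 \<le> k \<and> k < 1 \<and> (\<forall>v\<in>H2_ball \<rho>. \<forall>w\<in>H2_ball \<rho>.
            H2_norm (\<lambda>x. \<tau> v x - \<tau> w x) \<le> k * H2_norm (\<lambda>x. v x - w x))"
      using q0 q1 contraction by blast
    have "AE x in lebesgue. w x = up x"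
      if w: "w \<in> H2_ball \<rho>" and ws: "solves_system s1m s2m epsm H g u0 w w" for w
    proof (rule fixed_unique[OF w])
      show "AE x in lebesgue. \<tau> w x = w x"
        using \<tau>_unique[OF w w ws] by eventually_elim simp
    qed
    then show "\<exists>up\<in>H2_ball \<rho>. (AE x in lebesgue. \<tau> up x = up x) \<and>
         (\<forall>w\<in>H2_ball \<rho>. (AE x in lebesgue. \<tau> w x = w x) \<longrightarrow> (AE x in lebesgue. w x = up x)) \<and>
         solves_system s1m s2m epsm H g u0 up up \<and>
         (\<forall>w\<in>H2_ball \<rho>. solves_system s1m s2m epsm H g u0 w w \<longrightarrow> (AE x in lebesgue. w x = up x))"
      using up_ball fixed fixed_unique up_solves by blast
  qed
qed

end
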